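(* Let $(M,\nabla_M)$ be a compact affine manifold endowed with a codimension $1$ transversely oriented linear foliation ${\cal F}_M^U$. Suppose that ${\cal F}_M^U$ has a compact leaf $F_0$ without holonomy (i.e. with trivial holonomy group). Then every leaf of ${\cal F}_M^U$ is compact, and there exists an affine morphism $(M,\nabla_M)\to S^1$, where $S^1$ is endowed with some structure of an affine manifold, whose fibres are the leaves of ${\cal F}_M^U$.
   Context: All manifolds are connected and without boundary. An $n$-dimensional affine manifold $(M,\nabla_M)$ is a smooth $n$-manifold $M$ with a flat torsion-free connection $\nabla_M$ (equivalently, an atlas whose coordinate changes are affine transformations of $\mathbb{R}^n$). An affine morphism between affine manifolds is a differentiable map which is affine in affine charts. Let $p_M:\hat M\to M$ be the universal cover, on which $\pi_1(M)$ acts by deck transformations, $D_M:\hat M\to\mathbb{R}^n$ the developing map (a local diffeomorphism which is affine for the pulled-back connection), $h_M:\pi_1(M)\to Aff(\mathbb{R}^n)$ the holonomy, characterized by $D_M\circ\gamma=h_M(\gamma)\circ D_M$, and $L(h_M):\pi_1(M)\to Gl(\mathbb{R}^n)$ its linear part. If $U\subset\mathbb{R}^n$ is a vector subspace with $L(h_M)(\gamma)(U)=U$ for all $\gamma\in\pi_1(M)$, the foliation of $\mathbb{R}^n$ by affine subspaces parallel to $U$ pulls back under $D_M$ to a $\pi_1(M)$-invariant foliation ${\cal F}^U_{\hat M}$ of $\hat M$, which is the pullback by $p_M$ of a foliation ${\cal F}^U_M$ of $M$; ${\cal F}^U_M$ is called a linear foliation. Its codimension is $n-\dim U$. The holonomy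 of a leaf is its usual holonomy as a leaf of a foliation (germs of transverse diffeomorphisms). *)

theory Defs
  imports "HOL-Analysis.Analysis"
begin

text \<open>
  Manifolds are subsets \<open>M\<close> of a topological space with the subspace topology. A chart is a pair
  of an open subset of \<open>M\<close> and a function whose values outside that subset are irrelevant.
\<close>

type_synonym ('a, 'e) chart = "'a set \<times> ('a \<Rightarrow> 'e)"

section \<open>Smooth maps between Euclidean spaces\<close>

text \<open>Only meant for open \<open>S\<close>.\<close>

primrec Ck_on :: "nat \<Rightarrow> ('e::euclidean_space \<Rightarrow> 'f::euclidean_space) \<Rightarrow> 'e set \<Rightarrow> bool" where
  "Ck_on 0 f S \<longleftrightarrow> continuous_on S f"
| "Ck_on (Suc k) f S \<longleftrightarrow>
     f differentiable_on S \<and> (\<forall>v. Ck_on k (\<lambda>x. frechet_derivative f (at x) v) S)"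

definition smooth_on :: "'e::euclidean_space set \<Rightarrow> ('e \<Rightarrow> 'f::euclidean_space) \<Rightarrow> bool" where
  "smooth_on S f \<longleftrightarrow> (\<forall>k. Ck_on k f S)"

definition submersion_at :: "('e::euclidean_space \<Rightarrow> 'f::euclidean_space) \<Rightarrow> 'e \<Rightarrow> bool" where
  "submersion_at g x \<longleftrightarrow>
     (\<exists>S. open S \<and> x \<in> S \<and> smooth_on S g) \<and> surj (frechet_derivative g (at x))"

definition local_diffeo_at :: "('f::euclidean_space \<Rightarrow> 'f) \<Rightarrow> 'f \<Rightarrow> bool" where
  "local_diffeo_at h c \<longleftrightarrow>
     (\<exists>S k. open S \<and> c \<in> S \<and> open (h ` S) \<and> smooth_on S h \<and> smooth_on (h ` S) k \<and>
            (\<forall>y\<in>S. k (h y) = y))"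

section \<open>Affine manifolds and affine morphisms\<close>

definition affine_map :: "('e::real_vector \<Rightarrow> 'f::real_vector) \<Rightarrow> bool" where
  "affine_map a \<longleftrightarrow> (\<exists>l b. linear l \<and> a = (\<lambda>x. l x + b))"

definition linear_part :: "('e::real_vector \<Rightarrow> 'f::real_vector) \<Rightarrow> 'e \<Rightarrow> 'f" where
  "linear_part a = (\<lambda>v. a v - a 0)"

text \<open>
  Coordinate changes are affine near each point: domains of charts may overlap in a disconnected
  set, on whose components the coordinate change may be given by different affine transformations.
\<close>

definition affine_atlas :: "'a::topological_space set \<Rightarrow> ('a, 'e::euclidean_space) chart set \<Rightarrow> bool"
  where "affine_atlas M A \<longleftrightarrow>
     \<Union>(fst ` A) = M \<and>
     (\<forall>(V, \<phi>)\<in>A. openin (top_of_set M) V \<and> open (\<phi> ` V) \<and> (\<exists>\<psi>. homeomorphism V (\<phi> ` V) \<phi> \<psi>)) \<and>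
     (\<forall>(V, \<phi>)\<in>A. \<forall>(W, \<psi>)\<in>A. \<forall>x\<in>V \<inter> W.
        \<exists>T a. openin (top_of_set M) T \<and> x \<in> T \<and> T \<subseteq> V \<inter> W \<and>
              affine_map a \<and> bij a \<and> (\<forall>y\<in>T. \<psi> y = a (\<phi> y)))"

definition affine_manifold ::
    "'a::topological_space set \<Rightarrow> ('a, 'e::euclidean_space) chart set \<Rightarrow> bool"
  where "affine_manifold M A \<longleftrightarrow>
     Hausdorff_space (top_of_set M) \<and> second_countable (top_of_set M) \<and>
     connected M \<and> M \<noteq> {} \<and> affine_atlas M A"

definition affine_morphism ::
    "'a::topological_space set \<Rightarrow> ('a, 'e::euclidean_space) chart set \<Rightarrow>
     'b::topological_space set \<Rightarrow> ('b, 'f::euclidean_space) chart set \<Rightarrow> ('a \<Rightarrow> 'b) \<Rightarrow> bool"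
  where "affine_morphism M A M' B f \<longleftrightarrow>
     continuous_on M f \<and> f ` M \<subseteq> M' \<and>
     (\<forall>(V, \<phi>)\<in>A. \<forall>(W, \<psi>)\<in>B. \<forall>x\<in>V \<inter> f -` W.
        \<exists>T a. openin (top_of_set M) T \<and> x \<in> T \<and> T \<subseteq> V \<inter> f -` W \<and>
              affine_map a \<and> (\<forall>y\<in>T. \<psi> (f y) = a (\<phi> y)))"

text \<open>
  An affine structure on the unit circle, as a smooth manifold: the charts are required to be
  smooth charts for the standard smooth structure, the one for which \<open>cis\<close> is a local
  diffeomorphism from the real line.
\<close>

definition affine_structure_on_circle :: "(complex, real) chart set \<Rightarrow> bool" where
  "affine_structure_on_circle B \<longleftrightarrow>
     affine_manifold (sphere 0 1) B \<and>
     (\<forall>(V, \<psi>)\<in>B. smooth_on (cis -` V) (\<psi> \<circ> cis) \<and> (\<forall>t\<in>cis -` V. deriv (\<psi> \<circ> cis) t \<noteq> 0))"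

section \<open>Universal cover, developing map and holonomy\<close>

definition universal_cover ::
    "'u::topological_space set \<Rightarrow> ('u \<Rightarrow> 'a::topological_space) \<Rightarrow> 'a set \<Rightarrow> bool"
  where "universal_cover N p M \<longleftrightarrow> covering_space N p M \<and> simply_connected N"

text \<open>The fundamental group of the base is identified with the group of deck transformations.\<close>

definition deck_transformations ::
    "'u::topological_space set \<Rightarrow> ('u \<Rightarrow> 'a::topological_space) \<Rightarrow> ('u \<Rightarrow> 'u) set"
  where "deck_transformations N p =
     {\<gamma>. (\<exists>\<delta>. homeomorphism N N \<gamma> \<delta>) \<and> (\<forall>x\<in>N. p (\<gamma> x) = p x)}"

definition pullback_atlas ::
    "'u::topological_space set \<Rightarrow> ('u \<Rightarrow> 'a::topological_space) \<Rightarrow> 'a set \<Rightarrow>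
     ('a, 'e) chart set \<Rightarrow> ('u, 'e) chart set"
  where "pullback_atlas N p M A =
     {(W, \<phi> \<circ> p) |W V \<phi>. (V, \<phi>) \<in> A \<and> openin (top_of_set N) W \<and> p ` W \<subseteq> V \<and>
        openin (top_of_set M) (p ` W) \<and> (\<exists>q. homeomorphism W (p ` W) p q)}"

text \<open>
  In affine charts of a manifold of the same dimension as the target, a developing map is given by
  affine maps; these are local diffeomorphisms as soon as they are local homeomorphisms.
\<close>

definition developing_map ::
    "'u::topological_space set \<Rightarrow> ('u \<Rightarrow> 'a::topological_space) \<Rightarrow> 'a set \<Rightarrow>
     ('a, 'e::euclidean_space) chart set \<Rightarrow> ('u \<Rightarrow> 'e) \<Rightarrow> bool"
  where "developing_map N p M A D \<longleftrightarrow>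
     affine_morphism N (pullback_atlas N p M A) UNIV {(UNIV, id)} D \<and>
     (\<forall>x\<in>N. \<exists>W q. openin (top_of_set N) W \<and> x \<in> W \<and> open (D ` W) \<and> homeomorphism W (D ` W) D q)"

definition holonomy_representation ::
    "'u::topological_space set \<Rightarrow> ('u \<Rightarrow> 'a::topological_space) \<Rightarrow> ('u \<Rightarrow> 'e::euclidean_space) \<Rightarrow>
     (('u \<Rightarrow> 'u) \<Rightarrow> 'e \<Rightarrow> 'e) \<Rightarrow> bool"
  where "holonomy_representation N p D h \<longleftrightarrow>
     (\<forall>\<gamma>\<in>deck_transformations N p.
        affine_map (h \<gamma>) \<and> bij (h \<gamma>) \<and> (\<forall>x\<in>N. D (\<gamma> x) = h \<gamma> (D x)))"

section \<open>Foliations\<close>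

text \<open>
  A foliation of codimension \<open>DIM('q)\<close> is given by a Haefliger cocycle: local submersions to \<open>'q\<close>
  whose domains cover the manifold and which differ, near each common point of their domains,
  by a local diffeomorphism of \<open>'q\<close>. The plaques are the components of the fibres of these
  submersions. Two cocycles define the same foliation if their union is a cocycle.
  The predicate \<open>transition_germ M c c' x h\<close> says that \<open>h\<close> represents the germ of the
  transition at \<open>x\<close> from the distinguished map \<open>c\<close> to \<open>c'\<close>.
\<close>

definition transition_germ ::
    "'a::topological_space set \<Rightarrow> ('a, 'q::euclidean_space) chart \<Rightarrow> ('a, 'q) chart \<Rightarrow> 'a \<Rightarrow>
     ('q \<Rightarrow> 'q) \<Rightarrow> bool"
  where "transition_germ M c c' x h \<longleftrightarrow>
     local_diffeo_at h (snd c x) \<and>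
     (\<exists>T. openin (top_of_set M) T \<and> x \<in> T \<and> T \<subseteq> fst c \<inter> fst c' \<and>
          (\<forall>y\<in>T. snd c' y = h (snd c y)))"

definition foliation ::
    "'a::topological_space set \<Rightarrow> ('a, 'e::euclidean_space) chart set \<Rightarrow>
     ('a, 'q::euclidean_space) chart set \<Rightarrow> bool"
  where "foliation M A F \<longleftrightarrow>
     \<Union>(fst ` F) = M \<and>
     (\<forall>(W, f)\<in>F. openin (top_of_set M) W \<and>
        (\<forall>(V, \<phi>)\<in>A. \<forall>x\<in>V \<inter> W.
           \<exists>T g. openin (top_of_set M) T \<and> x \<in> T \<and> T \<subseteq> V \<inter> W \<and>
                 submersion_at g (\<phi> x) \<and> (\<forall>y\<in>T. f y = g (\<phi> y)))) \<and>
     (\<forall>c\<in>F. \<forall>c'\<in>F. \<forall>x\<in>fst c \<inter> fst c'. \<exists>h. transition_germ M c c' x h)"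

definition same_foliation ::
    "'a::topological_space set \<Rightarrow> ('a, 'e::euclidean_space) chart set \<Rightarrow>
     ('a, 'q::euclidean_space) chart set \<Rightarrow> ('a, 'q) chart set \<Rightarrow> bool"
  where "same_foliation M A F G \<longleftrightarrow>
     foliation M A F \<and> foliation M A G \<and> foliation M A (F \<union> G)"

definition pullback_foliation :: "'b set \<Rightarrow> ('b \<Rightarrow> 'a) \<Rightarrow> ('a, 'q) chart set \<Rightarrow> ('b, 'q) chart set"
  where "pullback_foliation N g F = {(N \<inter> g -` W, f \<circ> g) |W f. (W, f) \<in> F}"

text \<open>
  The foliation by the affine subspaces parallel to \<open>U\<close>, which are the fibres of the linear
  surjections with kernel \<open>U\<close>. Such surjections to \<open>'q\<close> exist only if \<open>DIM('q)\<close> is the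
  codimension of \<open>U\<close>.
\<close>

definition parallel_foliation ::
    "'e::euclidean_space set \<Rightarrow> ('e, 'q::euclidean_space) chart set"
  where "parallel_foliation U = {(UNIV, l) |l. linear l \<and> surj l \<and> {x. l x = 0} = U}"

text \<open>
  \<open>F\<close> is the foliation of \<open>M\<close> whose pullback to \<open>N\<close> is the pullback under \<open>D\<close> of the foliation
  parallel to \<open>U\<close>.
\<close>

definition linear_foliation ::
    "'a::topological_space set \<Rightarrow> ('a, 'e::euclidean_space) chart set \<Rightarrow>
     'u::topological_space set \<Rightarrow> ('u \<Rightarrow> 'a) \<Rightarrow> ('u \<Rightarrow> 'e) \<Rightarrow> 'e set \<Rightarrow>
     ('a, 'q::euclidean_space) chart set \<Rightarrow> bool"
  where "linear_foliation M A N p D U F \<longleftrightarrow>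
     foliation M A F \<and>
     same_foliation N (pullback_atlas N p M A)
       (pullback_foliation N p F) (pullback_foliation N D (parallel_foliation U))"

text \<open>A transverse orientation of a codimension one foliation: an oriented defining cocycle.\<close>

definition transversely_oriented ::
    "'a::topological_space set \<Rightarrow> ('a, real) chart set \<Rightarrow> bool"
  where "transversely_oriented M F \<longleftrightarrow>
     (\<forall>c\<in>F. \<forall>c'\<in>F. \<forall>x h. transition_germ M c c' x h \<longrightarrow> deriv h (snd c x) > 0)"

subsection \<open>Leaves\<close>

definition leaf_topology ::
    "'a::topological_space set \<Rightarrow> ('a, 'q) chart set \<Rightarrow> 'a topology"
  where "leaf_topology M F = topology_generated_by
     {T \<inter> (W \<inter> f -` {c}) |T W f c. openin (top_of_set M) T \<and> (W, f) \<in> F}"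

definition leaves :: "'a::topological_space set \<Rightarrow> ('a, 'q) chart set \<Rightarrow> 'a set set" where
  "leaves M F = connected_components_of (leaf_topology M F)"

definition compact_leaf ::
    "'a::topological_space set \<Rightarrow> ('a, 'q) chart set \<Rightarrow> 'a set \<Rightarrow> bool"
  where "compact_leaf M F L \<longleftrightarrow> L \<in> leaves M F \<and> compactin (leaf_topology M F) L"

text \<open>
  \<open>holonomy_along M F \<gamma> c t c' h\<close>: following the path \<open>\<gamma>\<close> in a leaf from time \<open>0\<close> to time \<open>t\<close>
  through a chain of distinguished maps that starts with \<open>c\<close> and ends with \<open>c'\<close>, the composition of
  the transitions met along the way is \<open>h\<close>. Its germ at \<open>snd c (\<gamma> 0)\<close> is the holonomy of \<open>\<gamma>\<close>,
  with the local quotients by the plaques serving as transversals.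
\<close>

inductive holonomy_along ::
    "'a::topological_space set \<Rightarrow> ('a, 'q::euclidean_space) chart set \<Rightarrow> (real \<Rightarrow> 'a) \<Rightarrow>
     ('a, 'q) chart \<Rightarrow> real \<Rightarrow> ('a, 'q) chart \<Rightarrow> ('q \<Rightarrow> 'q) \<Rightarrow> bool"
  for M F \<gamma> c where
  start: "c \<in> F \<Longrightarrow> \<gamma> 0 \<in> fst c \<Longrightarrow> holonomy_along M F \<gamma> c 0 c id"
| slide: "holonomy_along M F \<gamma> c s c' h \<Longrightarrow> s \<le> t \<Longrightarrow> t \<le> 1 \<Longrightarrow> \<gamma> ` {s..t} \<subseteq> fst c' \<Longrightarrow>
          holonomy_along M F \<gamma> c t c' h"
| change: "holonomy_along M F \<gamma> c t c' h \<Longrightarrow> c'' \<in> F \<Longrightarrow> transition_germ M c' c'' (\<gamma> t) g \<Longrightarrow>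
           holonomy_along M F \<gamma> c t c'' (g \<circ> h)"

definition without_holonomy ::
    "'a::topological_space set \<Rightarrow> ('a, 'q::euclidean_space) chart set \<Rightarrow> 'a set \<Rightarrow> bool"
  where "without_holonomy M F L \<longleftrightarrow>
     (\<forall>\<gamma> c h. pathin (leaf_topology M F) \<gamma> \<and> \<gamma> 0 \<in> L \<and> \<gamma> 1 = \<gamma> 0 \<and> holonomy_along M F \<gamma> c 1 c h
        \<longrightarrow> (\<forall>\<^sub>F y in nhds (snd c (\<gamma> 0)). h y = y))"

end

(*
  Near every point the foliation is given by a transverse chart: a function that is affine in affine
  charts and increasing along the transverse orientation. Two transverse charts differ locally by an
  orientation preserving affine transformation of the line.

  Since the leaf F0 is compact without holonomy, a transverse chart at one of its points is transported
  along the leaf without ambiguity; the resulting germs glue to a transverse chart on a neighbourhood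
  of F0, so that F0 is a level of a tube, a saturated open set on which a transverse chart u has
  compact connected levels. Take a maximal tube W immediately above F0 = {u = 0}. A transversal through
  a boundary point of W cannot run in and out of W infinitely often, as every passage meets each level
  of u and levels are closed. So near such a point W contains an entire side or misses it, and u
  extends affinely. The points where W ends upwards form a compact connected leaf; were it not F0, then
  W could be extended beyond it. Hence W and F0 cover M, and u tends to some b > 0 as one returns to
  F0 from below, where u = r u0 + b for the chart u0 around F0. This is the developing map of an affine
  circle with holonomy x -> r x + b, and u descends to the required morphism onto it.
*)

theory Submission
  imports Defs
begin

section \<open>Transversely affine structures\<close>

text \<open>The delicate point is why a tube can be continued through the leaf at its upper end,
  about whose holonomy nothing is assumed. Affine rigidity settles it: the affine extensions of
  \<open>u\<close> to different end points all take the supremum of \<open>u\<close> there, and an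
  affine map of the line that fixes this value and one value below it is the identity. So the
  extensions glue to one chart across the end, which is a compact connected level of it and has a
  tube around it. The same extensions show that \<open>u\<close> is bounded, so a tube cannot spiral
  for ever towards a limit leaf. For \<open>r \<noteq> 1\<close> the return map has a fixed point,
  and the circle is the quotient of a half line by a homothety instead of a quotient of the line by
  translations; hence the exponential developing map. Up to the fibration, leaves appear only as
  levels of transverse charts. The leaf topology and paths enter twice: to transport charts along
  the compact leaf, and to recognise closed connected levels as leaves.\<close>

lemma connectedin_subset_closedin:
  assumes "connectedin X P" "closedin X C" "P \<inter> C \<noteq> {}"
    and "\<And>x. x \<in> P \<inter> C \<Longrightarrow> \<exists>T. openin X T \<and> x \<in> T \<and> P \<inter> T \<subseteq> C"
  shows "P \<subseteq> C"
proof (rule ccontr)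
  assume "\<not> P \<subseteq> C"
  obtain T where T: "\<And>x. x \<in> P \<inter> C \<Longrightarrow> openin X (T x) \<and> x \<in> T x \<and> P \<inter> T x \<subseteq> C"
    using assms(4) by metis
  \<comment> \<open>\<open>C\<close> is relatively open in \<open>P\<close> by the local condition,
    so \<open>E\<close> and the complement of \<open>C\<close> are open and would separate
    \<open>P\<close>.\<close>
  define E where "E = \<Union>(T ` (P \<inter> C))"
  have "openin X E" unfolding E_def using T by blast
  moreover have "openin X (topspace X - C)" using assms(2) by blast
  moreover have "P \<subseteq> E \<union> (topspace X - C)"
    using T connectedin_subset_topspace[OF assms(1)] unfolding E_def by fastforce
  moreover have "E \<inter> (topspace X - C) \<inter> P = {}" using T unfolding E_def by blast
  moreover have "E \<inter> P \<noteq> {}" using assms(3) T unfolding E_def by blast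
  moreover have "(topspace X - C) \<inter> P \<noteq> {}"
    using \<open>\<not> P \<subseteq> C\<close> connectedin_subset_topspace[OF assms(1)] by blast
  ultimately show False using assms(1) unfolding connectedin by blast
qed

text \<open>The indices whose set lies in one fixed component cannot form a proper subset of
  \<open>I\<close>. The linking condition is phrased by cuts rather than by chains of indices
  because a connected level covered by boxes supplies cuts directly.\<close>

lemma connectedin_UN_chain:
  assumes "\<And>i. i \<in> I \<Longrightarrow> connectedin X (S i)" "\<And>i. i \<in> I \<Longrightarrow> S i \<noteq> {}"
    and "\<And>J. J \<subseteq> I \<Longrightarrow> J \<noteq> {} \<Longrightarrow> J \<noteq> I \<Longrightarrow> \<exists>i\<in>J. \<exists>j\<in>I - J. S i \<inter> S j \<noteq> {}"
  shows "connectedin X (\<Union>i\<in>I. S i)"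
proof (cases "I = {}")
  case False
  then obtain i0 x0 where i0: "i0 \<in> I" "x0 \<in> S i0" using assms(2) by blast
  let ?Y = "subtopology X (\<Union>i\<in>I. S i)"
  let ?C = "connected_component_of_set ?Y x0"
  have con: "connectedin ?Y (S i)" if "i \<in> I" for i
    using assms(1)[OF that] that by (auto simp: connectedin_subtopology)
  have absorb: "S i \<subseteq> ?C" if i: "i \<in> I" "S i \<inter> ?C \<noteq> {}" for i
  proof -
    obtain y where y: "y \<in> S i" "connected_component_of ?Y x0 y" using i(2) by blast
    then have "S i \<subseteq> connected_component_of_set ?Y y"
      using con[OF i(1)] by (simp add: connected_component_of_maximal)
    with y(2) show ?thesis by (auto intro: connected_component_of_trans)
  qed
  define J where "J = {i\<in>I. S i \<subseteq> ?C}"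
  have "S i0 \<subseteq> ?C" using con[OF i0(1)] i0(2) by (simp add: connected_component_of_maximal)
  then have "i0 \<in> J" using i0 by (simp add: J_def)
  have "J = I"
  proof (rule ccontr)
    assume "J \<noteq> I"
    then obtain i j where ij: "i \<in> J" "j \<in> I - J" "S i \<inter> S j \<noteq> {}"
      using assms(3)[of J] \<open>i0 \<in> J\<close> unfolding J_def by blast
    then have "S j \<inter> ?C \<noteq> {}" unfolding J_def by blast
    then show False using absorb ij unfolding J_def by blast
  qed
  then have "(\<Union>i\<in>I. S i) \<subseteq> ?C" unfolding J_def by blast
  moreover have "?C \<subseteq> (\<Union>i\<in>I. S i)"
    using connected_component_of_subset_topspace[of ?Y x0] by auto
  ultimately have "(\<Union>i\<in>I. S i) = ?C" by blast
  then show ?thesis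
    using connectedin_connected_component_of[of ?Y x0] by (simp add: connectedin_subtopology)
qed simp

text \<open>A real affine function is determined by its values on any nondegenerate interval, so the
  local slope and intercept are locally constant functions of the point, hence constant on an
  interval.\<close>

lemma locally_affine_imp_affine:
  fixes f :: "real \<Rightarrow> real"
  assumes "a < b"
    and "\<And>t. t \<in> {a<..<b} \<Longrightarrow> \<exists>\<delta>>0. \<exists>\<alpha>>0. \<exists>\<beta>. \<forall>s. \<bar>s - t\<bar> < \<delta> \<longrightarrow> f s = \<alpha> * s + \<beta>"
  shows "\<exists>\<alpha>>0. \<exists>\<beta>. \<forall>t\<in>{a<..<b}. f t = \<alpha> * t + \<beta>"
proof -
  obtain d al be where loc: "\<And>t. t \<in> {a<..<b} \<Longrightarrow>
      d t > 0 \<and> al t > 0 \<and> (\<forall>s. \<bar>s - t\<bar> < d t \<longrightarrow> f s = al t * s + be t)"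
    using assms(2) by metis
  have loc_const: "al s = al t \<and> be s = be t"
    if st: "t \<in> {a<..<b}" "s \<in> {a<..<b}" "\<bar>s - t\<bar> < d t" for s t
  proof -
    define w where "w = \<bar>s - t\<bar>"
    \<comment> \<open>\<open>e\<close> is small enough for \<open>s + e\<close> to stay in the
      neighbourhoods of both \<open>s\<close> and \<open>t\<close>; the values at \<open>s\<close>
      and \<open>s + e\<close> then determine both coefficients.\<close>
    define e where "e = min (d s) (d t - w) / 2"
    have w: "0 < d s" "w < d t" using loc[OF st(2)] st(3) unfolding w_def by auto
    then have e: "e > 0" "e < d s" "w + e < d t"
      unfolding e_def by (auto simp: min_def field_simps)
    have "f s = al t * s + be t" "f (s + e) = al t * (s + e) + be t"
      using loc[OF st(1)] st(3) e w_def by auto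
    moreover have "f s = al s * s + be s" "f (s + e) = al s * (s + e) + be s"
      using loc[OF st(2)] e by auto
    ultimately have eq: "al s * s + be s = al t * s + be t"
        "al s * (s + e) + be s = al t * (s + e) + be t" by simp_all
    then have "al s * (s + e) - al s * s = al t * (s + e) - al t * s" by linarith
    then have "(al s - al t) * e = 0" by (simp add: algebra_simps)
    then have "al s = al t" using e(1) by simp
    then show ?thesis using eq(1) by simp
  qed
  define m where "m = (a + b) / 2"
  have m: "m \<in> {a<..<b}" using assms(1) unfolding m_def by auto
  have "(al t, be t) = (al m, be m)" if t: "t \<in> {a<..<b}" for t
  proof (rule connected_local_const[where A = "{a<..<b}" and f = "\<lambda>t. (al t, be t)"])
    show "\<forall>t\<in>{a<..<b}. \<forall>\<^sub>F s in at t within {a<..<b}. (al t, be t) = (al s, be s)"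
    proof
      fix t assume t: "t \<in> {a<..<b}"
      then have "0 < d t" using loc by blast
      then show "\<forall>\<^sub>F s in at t within {a<..<b}. (al t, be t) = (al s, be s)"
        unfolding eventually_at dist_real_def using loc_const[OF t] by fastforce
    qed
  qed (use t m in auto)
  then have "f t = al m * t + be m" if "t \<in> {a<..<b}" for t
    using loc[OF that] that by simp
  then show ?thesis using loc[OF m] by blast
qed

section \<open>Germs, transversal boxes, and charts up to affine change\<close>

definition germ_eq :: "'m topology \<Rightarrow> 'm \<Rightarrow> ('m \<Rightarrow> real) \<Rightarrow> ('m \<Rightarrow> real) \<Rightarrow> bool" where
  "germ_eq X x f g \<longleftrightarrow> (\<exists>T. openin X T \<and> x \<in> T \<and> (\<forall>y\<in>T. f y = g y))"

lemma germ_eq_sym: "germ_eq X x f g \<Longrightarrow> germ_eq X x g f"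
  unfolding germ_eq_def by metis

lemma germ_eq_trans:
  assumes "germ_eq X x f g" "germ_eq X x g k"
  shows "germ_eq X x f k"
proof -
  obtain S T where "openin X S" "x \<in> S" "\<forall>y\<in>S. f y = g y" "openin X T" "x \<in> T" "\<forall>y\<in>T. g y = k y"
    using assms unfolding germ_eq_def by metis
  then show ?thesis unfolding germ_eq_def by (intro exI[of _ "S \<inter> T"]) auto
qed

lemma germ_eqD: "germ_eq X x f g \<Longrightarrow> f x = g x"
  unfolding germ_eq_def by blast

lemma openin_germ_eq: "openin X {x. germ_eq X x f g}"
  unfolding germ_eq_def by (subst openin_subopen) blast

text \<open>The map \<open>\<sigma>\<close> is a transversal through \<open>x\<close> parametrised by \<open>\<tau>\<close>.\<close>

definition box :: "'m topology \<Rightarrow> 'm set \<Rightarrow> ('m \<Rightarrow> real) \<Rightarrow> 'm \<Rightarrow> 'm set \<Rightarrow> real \<Rightarrow> (real \<Rightarrow> 'm) \<Rightarrow> bool"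
  where "box X H \<tau> x G \<epsilon> \<sigma> \<longleftrightarrow> openin X G \<and> x \<in> G \<and> G \<subseteq> H \<and> 0 < \<epsilon> \<and>
    \<tau> ` G \<subseteq> {\<tau> x - \<epsilon><..<\<tau> x + \<epsilon>} \<and> (\<forall>t. connectedin X {y\<in>G. \<tau> y = t}) \<and>
    continuous_map (top_of_set {\<tau> x - \<epsilon><..<\<tau> x + \<epsilon>}) X \<sigma> \<and> \<sigma> (\<tau> x) = x \<and>
    (\<forall>t\<in>{\<tau> x - \<epsilon><..<\<tau> x + \<epsilon>}. \<sigma> t \<in> G \<and> \<tau> (\<sigma> t) = t)"

lemma box_shrink:
  assumes "box X H \<tau> x G \<epsilon> \<sigma>" "0 < \<delta>" "\<delta> \<le> \<epsilon>" "continuous_map (subtopology X H) euclideanreal \<tau>"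
    "openin X H"
  shows "box X H \<tau> x {y\<in>G. \<bar>\<tau> y - \<tau> x\<bar> < \<delta>} \<delta> \<sigma>"
proof -
  have "openin X {y\<in>G. \<bar>\<tau> y - \<tau> x\<bar> < \<delta>}"
  proof -
    have "openin (subtopology X H) {y \<in> topspace (subtopology X H). \<tau> y \<in> {\<tau> x - \<delta><..<\<tau> x + \<delta>}}"
      using assms(4) by (rule openin_continuous_map_preimage) auto
    then have "openin X {y \<in> topspace (subtopology X H). \<tau> y \<in> {\<tau> x - \<delta><..<\<tau> x + \<delta>}}"
      using assms(5) openin_trans_full by blast
    moreover have "{y\<in>G. \<bar>\<tau> y - \<tau> x\<bar> < \<delta>} =
        G \<inter> {y \<in> topspace (subtopology X H). \<tau> y \<in> {\<tau> x - \<delta><..<\<tau> x + \<delta>}}"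
      using assms(1) openin_subset[OF assms(5)] unfolding box_def by auto
    ultimately show ?thesis using assms(1) unfolding box_def by auto
  qed
  moreover have "{y \<in> {y\<in>G. \<bar>\<tau> y - \<tau> x\<bar> < \<delta>}. \<tau> y = t} =
      (if \<bar>t - \<tau> x\<bar> < \<delta> then {y\<in>G. \<tau> y = t} else {})" for t
    by auto
  moreover have "continuous_map (top_of_set {\<tau> x - \<delta><..<\<tau> x + \<delta>}) X \<sigma>"
  proof -
    have "continuous_map (top_of_set {\<tau> x - \<epsilon><..<\<tau> x + \<epsilon>}) X \<sigma>"
      using assms(1) unfolding box_def by blast
    then show ?thesis
      by (rule continuous_map_from_subtopology_mono) (use assms(3) in auto)
  qed
  ultimately show ?thesis using assms(1-3) unfolding box_def by auto
qed

lemma box_transversal_open: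
  assumes "box X H \<tau> x G \<epsilon> \<sigma>" "openin X S"
  shows "open {t \<in> {\<tau> x - \<epsilon><..<\<tau> x + \<epsilon>}. \<sigma> t \<in> S}"
proof -
  have "openin (top_of_set {\<tau> x - \<epsilon><..<\<tau> x + \<epsilon>}) {t \<in> {\<tau> x - \<epsilon><..<\<tau> x + \<epsilon>}. \<sigma> t \<in> S}"
    using openin_continuous_map_preimage[of "top_of_set {\<tau> x - \<epsilon><..<\<tau> x + \<epsilon>}" X \<sigma> S] assms
    unfolding box_def by simp
  then show ?thesis by (meson openin_open_trans open_greaterThanLessThan)
qed

text \<open>The parameters at which the transversal avoids \<open>S\<close> form an open set. In
  this form closed slabs of a tube catch the endpoint of a transversal.\<close>

lemma box_transversal_limit:
  assumes "box X H \<tau> x G \<epsilon> \<sigma>" "closedin X S" "q \<in> {\<tau> x - \<epsilon><..<\<tau> x + \<epsilon>}"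
    and "\<And>\<delta>. \<delta> > 0 \<Longrightarrow> \<exists>t\<in>{\<tau> x - \<epsilon><..<\<tau> x + \<epsilon>}. \<bar>t - q\<bar> < \<delta> \<and> \<sigma> t \<in> S"
  shows "\<sigma> q \<in> S"
proof (rule ccontr)
  assume "\<sigma> q \<notin> S"
  let ?O = "{t \<in> {\<tau> x - \<epsilon><..<\<tau> x + \<epsilon>}. \<sigma> t \<in> topspace X - S}"
  have "open ?O" using assms(1,2) by (intro box_transversal_open) auto
  moreover have "\<sigma> q \<in> G" "openin X G" using assms(1,3) unfolding box_def by auto
  then have "q \<in> ?O" using assms(3) \<open>\<sigma> q \<notin> S\<close> openin_subset[of X G] by auto
  ultimately obtain \<delta> where "\<delta> > 0" "\<forall>t. \<bar>t - q\<bar> < \<delta> \<longrightarrow> t \<in> ?O"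
    unfolding open_dist dist_real_def by blast
  then show False using assms(4)[of \<delta>] by blast
qed

text \<open>What the argument uses of a linear foliation: \<open>tch\<close> is a class of charts
  closed under local agreement and increasing affine changes, any two of them differ locally by such
  a change, and every point has arbitrarily small boxes. Leaves are not mentioned; they occur as
  closed connected levels.\<close>

locale transverse_affine =
  fixes X :: "'m topology" and tch :: "'m set \<Rightarrow> ('m \<Rightarrow> real) \<Rightarrow> bool"
  assumes compact_X: "compact_space X" and Hausdorff_X: "Hausdorff_space X"
    and connected_X: "connected_space X"
    and tch_open: "\<And>G \<tau>. tch G \<tau> \<Longrightarrow> openin X G"
    and tch_continuous: "\<And>G \<tau>. tch G \<tau> \<Longrightarrow> continuous_map (subtopology X G) euclideanreal \<tau>"
    and tch_local: "\<And>G \<tau>. openin X G \<Longrightarrow>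
      (\<And>x. x \<in> G \<Longrightarrow> \<exists>H \<mu> T. tch H \<mu> \<and> openin X T \<and> x \<in> T \<and> T \<subseteq> H \<and> (\<forall>y\<in>T. \<tau> y = \<mu> y)) \<Longrightarrow>
      tch G \<tau>"
    and tch_affine: "\<And>G \<tau> \<alpha> \<beta>. tch G \<tau> \<Longrightarrow> 0 < \<alpha> \<Longrightarrow> tch G (\<lambda>y. \<alpha> * \<tau> y + \<beta>)"
    and tch_transition: "\<And>G \<tau> G' \<tau>' x. tch G \<tau> \<Longrightarrow> tch G' \<tau>' \<Longrightarrow> x \<in> G \<Longrightarrow> x \<in> G' \<Longrightarrow>
      \<exists>T \<alpha> \<beta>. openin X T \<and> x \<in> T \<and> T \<subseteq> G \<inter> G' \<and> 0 < \<alpha> \<and> (\<forall>y\<in>T. \<tau>' y = \<alpha> * \<tau> y + \<beta>)"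
    and tch_exists: "\<And>x. x \<in> topspace X \<Longrightarrow> \<exists>G \<tau>. tch G \<tau> \<and> x \<in> G"
    and box_exists: "\<And>H \<tau> x V. tch H \<tau> \<Longrightarrow> x \<in> H \<Longrightarrow> openin X V \<Longrightarrow> x \<in> V \<Longrightarrow>
      \<exists>G \<epsilon> \<sigma>. box X H \<tau> x G \<epsilon> \<sigma> \<and> G \<subseteq> V"
begin

lemma tch_subset: "tch G \<tau>" if "tch H \<tau>" "openin X G" "G \<subseteq> H"
  using that tch_open by (intro tch_local) blast+

lemma tch_preimage_open:
  assumes "tch G \<tau>" "open S"
  shows "openin X {y\<in>G. \<tau> y \<in> S}"
proof -
  have "openin (subtopology X G) {y \<in> topspace (subtopology X G). \<tau> y \<in> S}"
    using tch_continuous[OF assms(1)] assms(2) by (intro openin_continuous_map_preimage) auto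
  moreover have "topspace (subtopology X G) = G"
    using tch_open[OF assms(1)] openin_subset by fastforce
  ultimately show ?thesis
    using openin_trans_full[OF _ tch_open[OF assms(1)], of "{y\<in>G. \<tau> y \<in> S}"] by metis
qed

lemma tch_preimage_closed:
  assumes "tch G \<tau>" "closedin X Q" "Q \<subseteq> G" "closed S"
  shows "closedin X {y\<in>Q. \<tau> y \<in> S}"
proof -
  have "{y\<in>Q. \<tau> y \<in> S} = Q - {y\<in>G. \<tau> y \<in> - S}" using assms(3) by auto
  then show ?thesis using tch_preimage_open[OF assms(1), of "- S"] assms(2,4) by auto
qed

lemma tch_image_ball:
  assumes "tch G \<tau>" "openin X S" "x \<in> S" "x \<in> G"
  shows "\<exists>\<rho>>0. {\<tau> x - \<rho><..<\<tau> x + \<rho>} \<subseteq> \<tau> ` (S \<inter> G)"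
proof -
  obtain B \<epsilon> \<sigma> where B: "box X G \<tau> x B \<epsilon> \<sigma>" "B \<subseteq> S"
    using box_exists[OF assms(1,4,2,3)] by blast
  have "{\<tau> x - \<epsilon><..<\<tau> x + \<epsilon>} \<subseteq> \<tau> ` (S \<inter> G)"
  proof
    fix t assume t: "t \<in> {\<tau> x - \<epsilon><..<\<tau> x + \<epsilon>}"
    then have "\<sigma> t \<in> S \<inter> G" "t = \<tau> (\<sigma> t)" using B unfolding box_def by auto
    then show "t \<in> \<tau> ` (S \<inter> G)" by blast
  qed
  then show ?thesis using B(1) unfolding box_def by blast
qed

lemma tch_image_open:
  assumes "tch G \<tau>" "openin X S" "S \<subseteq> G"
  shows "open (\<tau> ` S)"
  unfolding open_dist
proof
  fix t assume "t \<in> \<tau> ` S"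
  then obtain x where x: "x \<in> S" "t = \<tau> x" by blast
  then obtain \<rho> where \<rho>: "\<rho> > 0" "{\<tau> x - \<rho><..<\<tau> x + \<rho>} \<subseteq> \<tau> ` (S \<inter> G)"
    using tch_image_ball[OF assms(1,2)] assms(3) by blast
  have "S \<inter> G = S" using assms(3) by blast
  then show "\<exists>e>0. \<forall>s. dist s t < e \<longrightarrow> s \<in> \<tau> ` S"
    using \<rho> x(2) by (intro exI[of _ \<rho>]) (force simp: dist_real_def abs_less_iff)
qed

lemma normal_X: "normal_space X"
  using compact_X Hausdorff_X compact_Hausdorff_or_regular_imp_normal_space by blast

lemma closed_neighbourhood:
  assumes "closedin X K" "openin X V" "K \<subseteq> V"
  obtains P Q where "openin X P" "closedin X Q" "K \<subseteq> P" "P \<subseteq> Q" "Q \<subseteq> V"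
proof -
  have "closedin X (topspace X - V)" "disjnt K (topspace X - V)"
    using assms by (auto simp: disjnt_def)
  then obtain P E where *: "openin X P" "openin X E" "K \<subseteq> P" "topspace X - V \<subseteq> E" "disjnt P E"
    using normal_X assms(1) unfolding normal_space_def by meson
  show ?thesis
  proof (rule that[of P "topspace X - E"])
    show "P \<subseteq> topspace X - E" using * openin_subset unfolding disjnt_def by fast
  qed (use * in auto)
qed

lemma closedin_sing: "x \<in> topspace X \<Longrightarrow> closedin X {x}"
  using Hausdorff_X by (simp add: closedin_Hausdorff_singleton)

lemma closed_finite_subcover:
  assumes "closedin X K" "\<And>x. x \<in> K \<Longrightarrow> openin X (V x) \<and> x \<in> V x"
  obtains I where "finite I" "I \<subseteq> K" "K \<subseteq> (\<Union>i\<in>I. V i)"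
proof -
  have "compactin X K" using assms(1) compact_X closedin_compact_space by blast
  moreover have "\<forall>U\<in>V ` K. openin X U" "K \<subseteq> \<Union>(V ` K)" using assms(2) by auto
  ultimately obtain \<F> where "finite \<F>" "\<F> \<subseteq> V ` K" "K \<subseteq> \<Union>\<F>"
    unfolding compactin_def by meson
  moreover then obtain I where "I \<subseteq> K" "finite I" "\<F> = V ` I"
    using finite_subset_image by metis
  ultimately show ?thesis using that by blast
qed

text \<open>A section of a sheaf over a closed subset of a compact Hausdorff space extends to a
  neighbourhood. Finitely many charts suffice; the points where two of them are both available with
  different germs form a closed set that avoids \<open>K\<close>, and off these sets all available
  charts agree.\<close>

lemma glue_germs:
  assumes K: "closedin X K"
    and ch: "\<And>x. x \<in> K \<Longrightarrow> tch (G x) (\<tau> x) \<and> x \<in> G x"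
    and coh: "\<And>x. x \<in> K \<Longrightarrow> \<exists>T. openin X T \<and> x \<in> T \<and> (\<forall>y\<in>K \<inter> T. germ_eq X y (\<tau> x) (\<tau> y))"
  shows "\<exists>H \<mu>. tch H \<mu> \<and> K \<subseteq> H \<and> (\<forall>x\<in>K. germ_eq X x \<mu> (\<tau> x))"
proof -
  have "\<exists>V C. openin X V \<and> closedin X C \<and> x \<in> V \<and> V \<subseteq> C \<and> C \<subseteq> G x \<and>
      (\<forall>y\<in>K \<inter> C. germ_eq X y (\<tau> x) (\<tau> y))" if x: "x \<in> K" for x
  proof -
    obtain T where T: "openin X T" "x \<in> T" "\<forall>y\<in>K \<inter> T. germ_eq X y (\<tau> x) (\<tau> y)"
      using coh[OF x] by blast
    have TG: "openin X (T \<inter> G x)" "{x} \<subseteq> T \<inter> G x" using T(1,2) ch[OF x] tch_open[of "G x" "\<tau> x"] by auto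
    have cl: "closedin X {x}" using x closedin_subset[OF K] closedin_sing by blast
    obtain P Q where "openin X P" "closedin X Q" "{x} \<subseteq> P" "P \<subseteq> Q" "Q \<subseteq> T \<inter> G x"
      by (rule closed_neighbourhood[OF cl TG])
    then show ?thesis using T(3) by (intro exI[of _ P] exI[of _ Q]) auto
  qed
  then obtain V C where VC: "\<And>x. x \<in> K \<Longrightarrow> openin X (V x) \<and> closedin X (C x) \<and> x \<in> V x \<and>
      V x \<subseteq> C x \<and> C x \<subseteq> G x \<and> (\<forall>y\<in>K \<inter> C x. germ_eq X y (\<tau> x) (\<tau> y))" by metis
  obtain I where I: "finite I" "I \<subseteq> K" "K \<subseteq> (\<Union>i\<in>I. V i)"
    by (rule closed_finite_subcover[OF K, of V]) (use VC in auto)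
  \<comment> \<open>This set is open: outside the closed set \<open>C i \<inter> C j\<close> nothing
    is required, and equality of germs, unlike equality of values, is an open condition.\<close>
  define E where "E i j = (topspace X - (C i \<inter> C j)) \<union> {y. germ_eq X y (\<tau> i) (\<tau> j)}" for i j
  define H where "H = (\<Union>i\<in>I. V i) \<inter> (topspace X \<inter> (\<Inter>ij\<in>I \<times> I. E (fst ij) (snd ij)))"
  define \<mu> where "\<mu> y = \<tau> (SOME i. i \<in> I \<and> y \<in> C i) y" for y
  have "openin X H"
  proof -
    have "openin X (E i j)" if "i \<in> I" "j \<in> I" for i j
      unfolding E_def using that VC[of i] VC[of j] I(2)
      by (intro openin_Un openin_germ_eq openin_diff closedin_Int openin_topspace) auto
    then have "openin X (topspace X \<inter> (\<Inter>ij\<in>I \<times> I. E (fst ij) (snd ij)))"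
      by (intro openin_Int_Inter) (use I(1) in auto)
    then show ?thesis unfolding H_def using VC I(2) by blast
  qed
  have eqH: "\<tau> i y = \<tau> j y" if "y \<in> H" "i \<in> I" "j \<in> I" "y \<in> C i" "y \<in> C j" for i j y
  proof -
    have "y \<in> E i j" using that unfolding H_def by force
    then show ?thesis using that unfolding E_def by (auto dest: germ_eqD)
  qed
  have muV: "\<mu> y = \<tau> k y" if "y \<in> H" "k \<in> I" "y \<in> V k" for y k
  proof -
    have "y \<in> C k" using that VC[of k] I(2) by auto
    then have "(SOME i. i \<in> I \<and> y \<in> C i) \<in> I \<and> y \<in> C (SOME i. i \<in> I \<and> y \<in> C i)"
      using that(2) by (intro someI[of "\<lambda>i. i \<in> I \<and> y \<in> C i" k]) blast
    then show ?thesis unfolding \<mu>_def using eqH[OF that(1)] that(2) \<open>y \<in> C k\<close> by blast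
  qed
  have "tch H \<mu>"
  proof (rule tch_local[OF \<open>openin X H\<close>])
    fix x assume "x \<in> H"
    then obtain k where k: "k \<in> I" "x \<in> V k" unfolding H_def by blast
    then have "tch (G k) (\<tau> k)" "openin X (H \<inter> V k)" "H \<inter> V k \<subseteq> G k"
      using ch[of k] VC[of k] I(2) \<open>openin X H\<close> by auto
    then show "\<exists>H' \<nu> T. tch H' \<nu> \<and> openin X T \<and> x \<in> T \<and> T \<subseteq> H' \<and> (\<forall>y\<in>T. \<mu> y = \<nu> y)"
      using muV[OF _ k(1)] k \<open>x \<in> H\<close> by (intro exI[of _ "G k"] exI[of _ "\<tau> k"] exI[of _ "H \<inter> V k"]) auto
  qed
  moreover have "K \<subseteq> H"
  proof
    fix y assume y: "y \<in> K"
    have "y \<in> E i j" if ij: "i \<in> I" "j \<in> I" for i j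
    proof (cases "y \<in> C i \<inter> C j")
      case True
      then have "germ_eq X y (\<tau> i) (\<tau> y)" "germ_eq X y (\<tau> j) (\<tau> y)" using VC[of i] VC[of j] I(2) ij y True by auto
      then show ?thesis
        unfolding E_def using germ_eq_trans[of X y "\<tau> i" "\<tau> y" "\<tau> j"] germ_eq_sym[of X y] by simp
    next
      case False
      then show ?thesis unfolding E_def using y closedin_subset[OF K] by blast
    qed
    then show "y \<in> H" unfolding H_def using y I(3) closedin_subset[OF K] by auto
  qed
  moreover have "germ_eq X y \<mu> (\<tau> y)" if y: "y \<in> K" for y
  proof -
    obtain k where k: "k \<in> I" "y \<in> V k" using I(3) y by blast
    then have "germ_eq X y (\<tau> k) (\<tau> y)" using VC[of k] I(2) y by auto
    moreover have "openin X (H \<inter> V k)" "y \<in> H \<inter> V k" "\<forall>z\<in>H \<inter> V k. \<mu> z = \<tau> k z"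
      using muV[OF _ k(1)] k y VC[of k] I(2) \<open>openin X H\<close> \<open>K \<subseteq> H\<close> by auto
    then have "germ_eq X y \<mu> (\<tau> k)" unfolding germ_eq_def by metis
    ultimately show ?thesis using germ_eq_trans[of X y \<mu> "\<tau> k" "\<tau> y"] by simp
  qed
  ultimately show ?thesis by blast
qed

end

section \<open>Tubes and their stability\<close>

definition (in transverse_affine) tube :: "'m set \<Rightarrow> ('m \<Rightarrow> real) \<Rightarrow> bool" where
  "tube W u \<longleftrightarrow> tch W u \<and> connected (u ` W) \<and> (\<forall>c. connectedin X {y\<in>W. u y = c}) \<and>
     (\<forall>c d. {c..d} \<subseteq> u ` W \<longrightarrow> closedin X {y\<in>W. u y \<in> {c..d}})"

context transverse_affine
begin

lemma tubeD:
  assumes "tube W u"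
  shows "tch W u" "connected (u ` W)" "connectedin X {y\<in>W. u y = c}"
    "{c..d} \<subseteq> u ` W \<Longrightarrow> closedin X {y\<in>W. u y \<in> {c..d}}"
    "openin X W" "open (u ` W)"
  using assms tch_open tch_image_open[of W u W] unfolding tube_def by blast+

text \<open>Closedness of slabs is demanded only over closed intervals of attained values, so that a
  tube may be open at its two ends. The attained values form an interval, so attained end points
  suffice.\<close>

lemma tube_slab_closed:
  assumes "tube W u" "c \<in> u ` W" "d \<in> u ` W"
  shows "closedin X {y\<in>W. u y \<in> {c..d}}"
proof -
  have "{c..d} \<subseteq> u ` W"
    using tubeD(2)[OF assms(1)] assms(2,3) by (simp add: connected_contains_Icc)
  then show ?thesis using tubeD(4)[OF assms(1)] by blast
qed

lemma tube_level_closed: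
  assumes "tube W u" "c \<in> u ` W"
  shows "closedin X {y\<in>W. u y = c}"
  using tube_slab_closed[OF assms assms(2)] by (simp add: order_eq_iff conj_commute)

text \<open>Finitely many boxes cover the compact level \<open>K\<close>. Boxes that overlap on
  \<open>K\<close> overlap in every nearby level, and connectedness of \<open>K\<close> links all
  boxes by such overlaps, so nearby levels are connected. The closed neighbourhood \<open>Q\<close>
  keeps nearby levels from leaving the covered region.\<close>

lemma tube_around:
  assumes G: "tch G \<tau>" and V: "openin X V"
    and K: "K = {y\<in>G. \<tau> y = c}" "closedin X K" "connectedin X K" "K \<noteq> {}" "K \<subseteq> V"
  shows "\<exists>W \<delta>. 0 < \<delta> \<and> tube W \<tau> \<and> K \<subseteq> W \<and> W \<subseteq> G \<inter> V \<and> \<tau> ` W = {c - \<delta><..<c + \<delta>}"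
proof -
  have GV: "openin X (G \<inter> V)" "K \<subseteq> G \<inter> V" using tch_open[OF G] V K by auto
  obtain P Q where PQ: "openin X P" "closedin X Q" "K \<subseteq> P" "P \<subseteq> Q" "Q \<subseteq> G \<inter> V"
    by (rule closed_neighbourhood[OF K(2) GV])
  have "\<exists>B \<epsilon> \<sigma>. box X G \<tau> x B \<epsilon> \<sigma> \<and> B \<subseteq> P" if x: "x \<in> K" for x
    by (rule box_exists[OF G _ PQ(1)]) (use x K(1) PQ(3) in auto)
  then obtain B \<epsilon> \<sigma> where B: "\<And>x. x \<in> K \<Longrightarrow> box X G \<tau> x (B x) (\<epsilon> x) (\<sigma> x) \<and> B x \<subseteq> P"
    by metis
  have Bo: "openin X (B x)" "x \<in> B x" "B x \<subseteq> G" "B x \<subseteq> P" "connectedin X {y\<in>B x. \<tau> y = t}"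
    if "x \<in> K" for x t
    using B[OF that] unfolding box_def by simp_all
  obtain I where I: "finite I" "I \<subseteq> K" "K \<subseteq> (\<Union>i\<in>I. B i)"
    by (rule closed_finite_subcover[OF K(2), of B]) (use Bo in auto)
  define U where "U = (\<Union>i\<in>I. B i)"
  have IK: "i \<in> K" if "i \<in> I" for i using I(2) that by blast
  have U: "openin X U" "U \<subseteq> P" "K \<subseteq> U" "U \<subseteq> G"
    unfolding U_def using Bo[OF IK] I(3) by (auto simp: subset_iff)
  have UQ: "y \<in> Q" "y \<in> G" if "y \<in> U" for y using U(2,4) PQ(4) that by auto
  \<comment> \<open>Charts are open maps, so an overlap containing a point of \<open>K\<close> takes
    all values near \<open>c\<close>; finitely many pairs allow a common radius.\<close>
  have "\<exists>\<rho>>0. \<forall>i\<in>I. \<forall>j\<in>I. B i \<inter> B j \<inter> K \<noteq> {} \<longrightarrow> {c - \<rho><..<c + \<rho>} \<subseteq> \<tau> ` (B i \<inter> B j)"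
  proof -
    have "\<exists>\<rho>>0. B i \<inter> B j \<inter> K \<noteq> {} \<longrightarrow> {c - \<rho><..<c + \<rho>} \<subseteq> \<tau> ` (B i \<inter> B j)"
      if ij: "i \<in> I" "j \<in> I" for i j
    proof (cases "B i \<inter> B j \<inter> K = {}")
      case False
      then obtain x where x: "x \<in> B i \<inter> B j" "x \<in> K" by blast
      have "openin X (B i \<inter> B j)" using Bo(1)[OF IK] ij by blast
      moreover have "x \<in> G" "\<tau> x = c" using x(2) K(1) by auto
      ultimately obtain \<rho> where "\<rho> > 0" "{c - \<rho><..<c + \<rho>} \<subseteq> \<tau> ` (B i \<inter> B j \<inter> G)"
        using tch_image_ball[OF G _ x(1)] by metis
      then show ?thesis by blast
    qed (auto intro: exI[of _ 1])
    then obtain r where r: "\<And>i j. i \<in> I \<Longrightarrow> j \<in> I \<Longrightarrow> r i j > 0 \<and>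
        (B i \<inter> B j \<inter> K \<noteq> {} \<longrightarrow> {c - r i j<..<c + r i j} \<subseteq> \<tau> ` (B i \<inter> B j))" by metis
    define \<rho> where "\<rho> = Min (insert 1 ((\<lambda>(i, j). r i j) ` (I \<times> I)))"
    have fin: "finite (insert 1 ((\<lambda>(i, j). r i j) ` (I \<times> I)))" using I(1) by blast
    have "\<rho> > 0" unfolding \<rho>_def using fin r by (subst Min_gr_iff) auto
    moreover have "\<rho> \<le> r i j" if "i \<in> I" "j \<in> I" for i j
      unfolding \<rho>_def by (rule Min_le[OF fin]) (use that in auto)
    moreover have "{c - \<rho><..<c + \<rho>} \<subseteq> {c - s<..<c + s}" if "\<rho> \<le> s" for s using that by auto
    ultimately show ?thesis using r by (meson order_trans)
  qed
  then obtain \<rho> where \<rho>: "\<rho> > 0" "\<And>i j. i \<in> I \<Longrightarrow> j \<in> I \<Longrightarrow> B i \<inter> B j \<inter> K \<noteq> {} \<Longrightarrow>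
      {c - \<rho><..<c + \<rho>} \<subseteq> \<tau> ` (B i \<inter> B j)" by metis
  \<comment> \<open>On the compact part of \<open>Q\<close> missed by the boxes the chart stays away
    from \<open>c\<close>; hence a point of \<open>Q\<close> with value within \<eta> of
    \<open>c\<close> lies in a box.\<close>
  have "\<exists>\<eta>>0. \<forall>y\<in>Q - U. \<eta> \<le> \<bar>\<tau> y - c\<bar>"
  proof -
    have "closedin X (Q - U)" using PQ(2) U(1) by (rule closedin_diff)
    then have "compactin X (Q - U)" using closedin_compact_space[OF compact_X] by blast
    moreover have "Q - U \<subseteq> G" using PQ(5) by blast
    ultimately have "compactin (subtopology X G) (Q - U)" by (simp add: compactin_subtopology)
    then have "compact (\<tau> ` (Q - U))"
      using image_compactin[OF _ tch_continuous[OF G]] by simp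
    then have "closed (\<tau> ` (Q - U))" by (rule compact_imp_closed)
    moreover have "c \<notin> \<tau> ` (Q - U)" using K(1) U(3) PQ(5) by blast
    ultimately obtain \<eta> where "\<eta> > 0" "ball c \<eta> \<inter> \<tau> ` (Q - U) = {}"
      by (meson closed_def ComplI open_contains_ball disjoint_eq_subset_Compl)
    moreover have "\<tau> y \<in> ball c \<eta> \<longleftrightarrow> \<bar>\<tau> y - c\<bar> < \<eta>" for y
      by (simp add: dist_real_def abs_minus_commute)
    ultimately show ?thesis by (intro exI[of _ \<eta>]) (force simp: not_less[symmetric])
  qed
  then obtain \<eta> where \<eta>: "\<eta> > 0" "\<And>y. y \<in> Q \<Longrightarrow> y \<notin> U \<Longrightarrow> \<eta> \<le> \<bar>\<tau> y - c\<bar>" by blast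
  define \<delta> where "\<delta> = min \<rho> \<eta>"
  have \<delta>: "\<delta> > 0" "\<delta> \<le> \<rho>" "\<delta> \<le> \<eta>" unfolding \<delta>_def using \<rho>(1) \<eta>(1) by auto
  define W where "W = {y\<in>U. \<tau> y \<in> {c - \<delta><..<c + \<delta>}}"
  have "tch U \<tau>" by (rule tch_subset[OF G]) (use U in auto)
  then have "openin X W" unfolding W_def by (rule tch_preimage_open) simp
  then have W: "tch W \<tau>" by (rule tch_subset[OF G]) (use U(4) W_def in auto)
  have self: "B i \<inter> B i \<inter> K \<noteq> {}" if "i \<in> I" for i using Bo(2)[OF IK[OF that]] IK[OF that] by blast
  have KW: "K \<subseteq> W" using U(3) K(1) \<delta>(1) unfolding W_def by auto
  have img: "\<tau> ` W = {c - \<delta><..<c + \<delta>}"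
  proof
    show "{c - \<delta><..<c + \<delta>} \<subseteq> \<tau> ` W"
    proof
      fix t assume t: "t \<in> {c - \<delta><..<c + \<delta>}"
      obtain i where i: "i \<in> I" using K(4) I(3) by blast
      have "t \<in> \<tau> ` (B i \<inter> B i)" using \<rho>(2)[OF i i self[OF i]] t \<delta>(2) by auto
      then obtain y where "y \<in> B i" "t = \<tau> y" by blast
      then show "t \<in> \<tau> ` W" using t i unfolding W_def U_def by blast
    qed
  qed (auto simp: W_def)
  have con: "connectedin X {y\<in>W. \<tau> y = t}" for t
  proof (cases "t \<in> {c - \<delta><..<c + \<delta>}")
    case True
    have tim: "t \<in> \<tau> ` (B i \<inter> B j)" if "i \<in> I" "j \<in> I" "B i \<inter> B j \<inter> K \<noteq> {}" for i j
      using \<rho>(2)[OF that] True \<delta>(2) by auto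
    have "{y\<in>W. \<tau> y = t} = (\<Union>i\<in>I. {y\<in>B i. \<tau> y = t})" unfolding W_def U_def using True by auto
    moreover have "connectedin X (\<Union>i\<in>I. {y\<in>B i. \<tau> y = t})"
    proof (rule connectedin_UN_chain)
      show "connectedin X {y\<in>B i. \<tau> y = t}" if "i \<in> I" for i by (rule Bo(5)[OF IK[OF that]])
      show "{y\<in>B i. \<tau> y = t} \<noteq> {}" if "i \<in> I" for i using tim[OF that that self[OF that]] by blast
      fix J assume J: "J \<subseteq> I" "J \<noteq> {}" "J \<noteq> I"
      \<comment> \<open>A set of indices and its complement give two open sets that cover the
        connected set \<open>K\<close> and both meet it, so they overlap on \<open>K\<close>: this
        is the cut condition.\<close>
      define E1 E2 where "E1 = (\<Union>i\<in>J. B i)" and "E2 = (\<Union>i\<in>I - J. B i)"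
      have "openin X E1" "openin X E2" unfolding E1_def E2_def using Bo(1) IK J(1) by blast+
      moreover have "K \<subseteq> E1 \<union> E2" using I(3) J(1) unfolding E1_def E2_def by blast
      moreover obtain i j where "i \<in> J" "j \<in> I - J" using J by blast
      then have "i \<in> E1 \<inter> K" "j \<in> E2 \<inter> K" unfolding E1_def E2_def using Bo(2)[OF IK] IK J(1) by blast+
      then have "E1 \<inter> K \<noteq> {}" "E2 \<inter> K \<noteq> {}" by blast+
      ultimately have "E1 \<inter> E2 \<inter> K \<noteq> {}" using K(3) unfolding connectedin by blast
      then obtain i j where ij: "i \<in> J" "j \<in> I - J" "B i \<inter> B j \<inter> K \<noteq> {}"
        unfolding E1_def E2_def by blast
      then have "t \<in> \<tau> ` (B i \<inter> B j)" using tim J(1) by blast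
      then show "\<exists>i\<in>J. \<exists>j\<in>I - J. {y\<in>B i. \<tau> y = t} \<inter> {y\<in>B j. \<tau> y = t} \<noteq> {}" using ij by blast
    qed
    ultimately show ?thesis by simp
  next
    case False
    then have none: "{y\<in>W. \<tau> y = t} = {}" unfolding W_def by auto
    show ?thesis unfolding none by (rule connectedin_empty)
  qed
  have slab: "closedin X {y\<in>W. \<tau> y \<in> {a..b}}" if ab: "{a..b} \<subseteq> \<tau> ` W" for a b
  proof -
    have sub: "{a..b} \<subseteq> {c - \<delta><..<c + \<delta>}" using ab img by simp
    \<comment> \<open>Within the bound \<delta> the slab can be computed in the closed set
      \<open>Q\<close> instead of the open set \<open>W\<close>, which makes it closed.\<close>
    have "{y\<in>W. \<tau> y \<in> {a..b}} = {y\<in>Q. \<tau> y \<in> {a..b}}"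
    proof (intro set_eqI iffI)
      fix y assume y: "y \<in> {y\<in>Q. \<tau> y \<in> {a..b}}"
      then have "\<tau> y \<in> {c - \<delta><..<c + \<delta>}" using sub by blast
      moreover then have "y \<in> U" using \<eta>(2)[of y] y \<delta>(3) by fastforce
      ultimately show "y \<in> {y\<in>W. \<tau> y \<in> {a..b}}" using y unfolding W_def by blast
    qed (use UQ(1) in \<open>auto simp: W_def\<close>)
    moreover have "closedin X {y\<in>Q. \<tau> y \<in> {a..b}}"
      by (rule tch_preimage_closed[OF G PQ(2)]) (use PQ(5) in auto)
    ultimately show ?thesis by simp
  qed
  have "tube W \<tau>" unfolding tube_def using W con slab img by simp
  moreover have "W \<subseteq> G \<inter> V" using UQ(1) PQ(5) unfolding W_def by blast
  ultimately show ?thesis using \<delta>(1) KW img by metis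
qed

text \<open>An open map with connected fibres pulls connected sets of values back to connected sets:
  a separation would map to disjoint open sets, since no level can meet both halves.\<close>

lemma tube_above_connected:
  assumes "tube W u"
  shows "connectedin X {y\<in>W. c < u y}"
  unfolding connectedin
proof (intro conjI notI)
  let ?S = "{y\<in>W. c < u y}"
  show "?S \<subseteq> topspace X" using openin_subset[OF tubeD(5)[OF assms]] by blast
  assume "\<exists>E1 E2. openin X E1 \<and> openin X E2 \<and> ?S \<subseteq> E1 \<union> E2 \<and> E1 \<inter> E2 \<inter> ?S = {} \<and>
      E1 \<inter> ?S \<noteq> {} \<and> E2 \<inter> ?S \<noteq> {}"
  then obtain E1 E2 where E: "openin X E1" "openin X E2" "?S \<subseteq> E1 \<union> E2" "E1 \<inter> E2 \<inter> ?S = {}"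
      "E1 \<inter> ?S \<noteq> {}" "E2 \<inter> ?S \<noteq> {}" by (elim exE conjE)
  have S: "openin X ?S"
    using tch_preimage_open[OF tubeD(1)[OF assms], of "{c<..}"] by simp
  have op: "open (u ` (E1 \<inter> ?S))" "open (u ` (E2 \<inter> ?S))"
    by (rule tch_image_open[OF tubeD(1)[OF assms] openin_Int[OF E(1) S]]
        tch_image_open[OF tubeD(1)[OF assms] openin_Int[OF E(2) S]], blast)+
  have "{c<..} \<inter> u ` W = u ` ?S" by auto
  moreover have "is_interval ({c<..} \<inter> u ` W)"
    using tubeD(2)[OF assms] is_interval_oi[of c]
    by (intro is_interval_Int) (simp_all only: is_interval_connected_1)
  then have "connected ({c<..} \<inter> u ` W)" by (simp only: is_interval_connected_1)
  ultimately have conn: "connected (u ` ?S)" by simp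
  have "u ` (E1 \<inter> ?S) \<inter> u ` (E2 \<inter> ?S) = {}"
  proof (rule ccontr)
    assume "u ` (E1 \<inter> ?S) \<inter> u ` (E2 \<inter> ?S) \<noteq> {}"
    then obtain x y where xy: "x \<in> E1" "y \<in> E2" "x \<in> ?S" "y \<in> ?S" "u x = u y" by auto
    let ?L = "{z\<in>W. u z = u x}"
    have "connectedin X ?L" by (rule tubeD(3)[OF assms])
    moreover have "?L \<subseteq> ?S" using xy(3) by auto
    then have "?L \<subseteq> E1 \<union> E2" "E1 \<inter> E2 \<inter> ?L = {}" using E(3,4) by blast+
    moreover have "E1 \<inter> ?L \<noteq> {}" "E2 \<inter> ?L \<noteq> {}" using xy by auto
    ultimately show False using E(1,2) unfolding connectedin by blast
  qed
  moreover have "u ` ?S \<subseteq> u ` (E1 \<inter> ?S) \<union> u ` (E2 \<inter> ?S)" using E(3) by blast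
  moreover have "u ` (E1 \<inter> ?S) \<inter> u ` ?S \<noteq> {}" "u ` (E2 \<inter> ?S) \<inter> u ` ?S \<noteq> {}"
    using E(5,6) by blast+
  ultimately show False using conn op connectedD[OF conn op] by blast
qed

text \<open>The level of the smaller tube is closed, and open inside the level of the larger one
  because the smaller tube is open; the larger level is connected. So levels do not grow when a tube
  does.\<close>

lemma tube_sub_level:
  assumes "tube W u" "tube W' u'" "W \<subseteq> W'" "\<And>y. y \<in> W \<Longrightarrow> u' y = u y" "c \<in> u ` W"
  shows "{y\<in>W'. u' y = c} = {y\<in>W. u y = c}"
proof
  have "{y\<in>W'. u' y = c} \<subseteq> {y\<in>W. u y = c}"
  proof (rule connectedin_subset_closedin[OF tubeD(3)[OF assms(2)] tube_level_closed[OF assms(1,5)]])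
    show "{y \<in> W'. u' y = c} \<inter> {y \<in> W. u y = c} \<noteq> {}" using assms(3,4,5) by fastforce
    fix x assume "x \<in> {y \<in> W'. u' y = c} \<inter> {y \<in> W. u y = c}"
    then show "\<exists>T. openin X T \<and> x \<in> T \<and> {y \<in> W'. u' y = c} \<inter> T \<subseteq> {y \<in> W. u y = c}"
      using tubeD(5)[OF assms(1)] assms(4) by (intro exI[of _ W]) auto
  qed
  then show "{y\<in>W'. u' y = c} \<subseteq> {y\<in>W. u y = c}" .
qed (use assms(3,4) in auto)

section \<open>Transversals that enter and leave a tube\<close>

lemma plaque_in_tube:
  assumes W: "tube W u" and H: "tch H \<tau>" "connectedin X {y\<in>G. \<tau> y = t}" "G \<subseteq> H"
    and y: "y \<in> G" "\<tau> y = t" "y \<in> W" and z: "z \<in> G" "\<tau> z = t"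
  shows "z \<in> W \<and> u z = u y"
proof -
  let ?P = "{y\<in>G. \<tau> y = t}" and ?L = "{w\<in>W. u w = u y}"
  \<comment> \<open>Tubes are saturated: along the plaque \<open>u\<close> is locally an affine
    function of \<tau>, hence locally constant, and the level of \<open>u\<close> is closed.\<close>
  have "?P \<subseteq> ?L"
  proof (rule connectedin_subset_closedin[OF H(2) tube_level_closed[OF W]])
    show "u y \<in> u ` W" using y by blast
    show "?P \<inter> ?L \<noteq> {}" using y by blast
    fix x assume x: "x \<in> ?P \<inter> ?L"
    then obtain T \<alpha> \<beta> where "openin X T" "x \<in> T" "T \<subseteq> H \<inter> W" "\<forall>y\<in>T. u y = \<alpha> * \<tau> y + \<beta>"
      using tch_transition[OF H(1) tubeD(1)[OF W], of x] H(3) by blast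
    moreover then have "u x = \<alpha> * t + \<beta>" using x by auto
    ultimately show "\<exists>T. openin X T \<and> x \<in> T \<and> ?P \<inter> T \<subseteq> ?L" using x by (intro exI[of _ T]) auto
  qed
  then show ?thesis using z by blast
qed

text \<open>Along the transversal \<open>u\<close> is locally affine in the parameter, hence affine
  on the interval; saturation of \<open>W\<close> spreads the formula from the transversal to all
  plaques over the interval.\<close>

lemma trace_affine:
  assumes W: "tube W u" and H: "tch H \<tau>" and B: "box X H \<tau> x G \<epsilon> \<sigma>"
    and ab: "a < b" "{a<..<b} \<subseteq> {\<tau> x - \<epsilon><..<\<tau> x + \<epsilon>}" and inW: "\<And>t. t \<in> {a<..<b} \<Longrightarrow> \<sigma> t \<in> W"
  shows "\<exists>\<alpha>>0. \<exists>\<beta>. \<forall>y\<in>G. \<tau> y \<in> {a<..<b} \<longrightarrow> y \<in> W \<and> u y = \<alpha> * \<tau> y + \<beta>"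
proof -
  have \<sigma>: "\<sigma> t \<in> G" "\<tau> (\<sigma> t) = t" "G \<subseteq> H" "connectedin X {y\<in>G. \<tau> y = t}" if "t \<in> {a<..<b}" for t
    using B ab(2) that unfolding box_def by auto
  have "\<exists>\<delta>>0. \<exists>\<alpha>>0. \<exists>\<beta>. \<forall>s. \<bar>s - t\<bar> < \<delta> \<longrightarrow> u (\<sigma> s) = \<alpha> * s + \<beta>" if t: "t \<in> {a<..<b}" for t
  proof -
    have "\<sigma> t \<in> H" "\<sigma> t \<in> W" using \<sigma>[OF t] inW[OF t] by auto
    then obtain T \<alpha> \<beta> where T: "openin X T" "\<sigma> t \<in> T" "0 < \<alpha>" "\<forall>y\<in>T. u y = \<alpha> * \<tau> y + \<beta>"
      using tch_transition[OF H tubeD(1)[OF W]] by metis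
    let ?O = "{s \<in> {\<tau> x - \<epsilon><..<\<tau> x + \<epsilon>}. \<sigma> s \<in> T} \<inter> {a<..<b}"
    have "open ?O" by (intro open_Int open_greaterThanLessThan box_transversal_open[OF B T(1)])
    moreover have "t \<in> ?O" using t ab(2) T(2) by blast
    ultimately obtain \<delta> where \<delta>: "\<delta> > 0" "\<forall>s. \<bar>s - t\<bar> < \<delta> \<longrightarrow> s \<in> ?O"
      unfolding open_dist dist_real_def by blast
    have "u (\<sigma> s) = \<alpha> * s + \<beta>" if "\<bar>s - t\<bar> < \<delta>" for s
    proof -
      have "s \<in> {a<..<b}" "\<sigma> s \<in> T" using \<delta>(2) that by blast+
      then show ?thesis using T(4) \<sigma>(2)[of s] by simp
    qed
    then show ?thesis using \<delta>(1) T(3) by blast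
  qed
  then obtain \<alpha> \<beta> where \<alpha>: "\<alpha> > 0" "\<forall>t\<in>{a<..<b}. u (\<sigma> t) = \<alpha> * t + \<beta>"
    using locally_affine_imp_affine[OF ab(1), of "\<lambda>t. u (\<sigma> t)"] by metis
  have "y \<in> W \<and> u y = \<alpha> * \<tau> y + \<beta>" if y: "y \<in> G" "\<tau> y \<in> {a<..<b}" for y
    using plaque_in_tube[OF W H \<sigma>(4)[OF y(2)] \<sigma>(3)[OF y(2)] \<sigma>(1,2)[OF y(2)] inW[OF y(2)] y(1) refl] \<alpha>(2) y(2)
    by simp
  then show ?thesis using \<alpha>(1) by blast
qed

text \<open>If the boundary value were attained, the slab between it and the value at an interior
  parameter would be closed and would contain the limit point of the transversal, which lies outside
  \<open>W\<close>. So a transversal leaves a tube only where \<open>u\<close> leaves its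
  range.\<close>

lemma trace_end:
  assumes W: "tube W u" and B: "box X H \<tau> x G \<epsilon> \<sigma>"
    and ab: "a < b" "{a<..<b} \<subseteq> {\<tau> x - \<epsilon><..<\<tau> x + \<epsilon>}"
    and u: "0 < \<alpha>" "\<forall>y\<in>G. \<tau> y \<in> {a<..<b} \<longrightarrow> y \<in> W \<and> u y = \<alpha> * \<tau> y + \<beta>"
    and q: "q = a \<or> q = b" "q \<in> {\<tau> x - \<epsilon><..<\<tau> x + \<epsilon>}" "\<sigma> q \<notin> W"
  shows "\<alpha> * q + \<beta> \<notin> u ` W"
proof
  assume J: "\<alpha> * q + \<beta> \<in> u ` W"
  have \<sigma>: "\<sigma> t \<in> W" "u (\<sigma> t) = \<alpha> * t + \<beta>" if "t \<in> {a<..<b}" for t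
  proof -
    have "\<sigma> t \<in> G" "\<tau> (\<sigma> t) = t" using B ab(2) that unfolding box_def by auto
    then show "\<sigma> t \<in> W" "u (\<sigma> t) = \<alpha> * t + \<beta>" using u(2) that by auto
  qed
  define m where "m = (a + b) / 2"
  have m: "m \<in> {a<..<b}" using ab(1) unfolding m_def by auto
  have mJ: "\<alpha> * m + \<beta> \<in> u ` W" using \<sigma>[OF m] by force
  have mono: "\<alpha> * s + \<beta> \<le> \<alpha> * t + \<beta>" if "s \<le> t" for s t using u(1) that by simp
  have "\<sigma> q \<in> W"
  proof (cases "q = b")
    case True
    have "\<sigma> q \<in> {y\<in>W. u y \<in> {\<alpha> * m + \<beta>..\<alpha> * q + \<beta>}}"
    proof (rule box_transversal_limit[OF B tube_slab_closed[OF W mJ J] q(2)])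
      fix \<delta> :: real assume "\<delta> > 0"
      then have "max m (b - \<delta>) < b" using m by auto
      then obtain t where t: "max m (b - \<delta>) < t" "t < b" using dense by blast
      then have tab: "t \<in> {a<..<b}" using m by auto
      then have "\<sigma> t \<in> {y\<in>W. u y \<in> {\<alpha> * m + \<beta>..\<alpha> * q + \<beta>}}"
        using \<sigma>[OF tab] t True mono[of m t] mono[of t q] by auto
      then show "\<exists>t\<in>{\<tau> x - \<epsilon><..<\<tau> x + \<epsilon>}. \<bar>t - q\<bar> < \<delta> \<and> \<sigma> t \<in> {y\<in>W. u y \<in> {\<alpha> * m + \<beta>..\<alpha> * q + \<beta>}}"
        using tab ab(2) t True by (intro bexI[of _ t]) auto
    qed
    then show ?thesis by blast
  next
    case False
    then have qa: "q = a" using q(1) by blast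
    have "\<sigma> q \<in> {y\<in>W. u y \<in> {\<alpha> * q + \<beta>..\<alpha> * m + \<beta>}}"
    proof (rule box_transversal_limit[OF B tube_slab_closed[OF W J mJ] q(2)])
      fix \<delta> :: real assume "\<delta> > 0"
      then have "a < min m (a + \<delta>)" using m by auto
      then obtain t where t: "a < t" "t < min m (a + \<delta>)" using dense by blast
      then have tab: "t \<in> {a<..<b}" using m by auto
      then have "\<sigma> t \<in> {y\<in>W. u y \<in> {\<alpha> * q + \<beta>..\<alpha> * m + \<beta>}}"
        using \<sigma>[OF tab] t qa mono[of q t] mono[of t m] by auto
      then show "\<exists>t\<in>{\<tau> x - \<epsilon><..<\<tau> x + \<epsilon>}. \<bar>t - q\<bar> < \<delta> \<and> \<sigma> t \<in> {y\<in>W. u y \<in> {\<alpha> * q + \<beta>..\<alpha> * m + \<beta>}}"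
        using tab ab(2) t qa by (intro bexI[of _ t]) auto
    qed
    then show ?thesis by blast
  qed
  then show False using q(3) by blast
qed

text \<open>Over a maximal interval inside \<open>W\<close> the function \<open>u\<close> is affine
  and neither of its end values is attained, while the attained values form an interval; the passage
  therefore covers the entire range of \<open>u\<close>.\<close>

lemma trace_gap:
  assumes W: "tube W u" and H: "tch H \<tau>" and B: "box X H \<tau> x G \<epsilon> \<sigma>"
    and s: "s \<in> {\<tau> x - \<epsilon><..<\<tau> x + \<epsilon>}" "s' \<in> {\<tau> x - \<epsilon><..<\<tau> x + \<epsilon>}" "s < t" "t < s'"
    and out: "\<sigma> s \<notin> W" "\<sigma> t \<in> W" "\<sigma> s' \<notin> W" and c: "c \<in> u ` W"
  shows "\<exists>r\<in>{s<..<s'}. \<sigma> r \<in> W \<and> u (\<sigma> r) = c"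
proof -
  let ?O = "{t \<in> {\<tau> x - \<epsilon><..<\<tau> x + \<epsilon>}. \<sigma> t \<in> W}"
  have op: "open ?O" by (rule box_transversal_open[OF B tubeD(5)[OF W]])
  have "compact ({s..t} - ?O)" "compact ({t..s'} - ?O)" using op by (auto intro: compact_diff)
  moreover have "s \<in> {s..t} - ?O" "s' \<in> {t..s'} - ?O" using s out by auto
  \<comment> \<open>\<open>p\<close> is the last parameter outside \<open>W\<close> before
    \<open>t\<close> and \<open>q\<close> the first one after it; both exist because the parameters
    outside \<open>W\<close> form a closed set.\<close>
  ultimately obtain p q where p: "p \<in> {s..t} - ?O" "\<forall>y\<in>{s..t} - ?O. y \<le> p"
      and q: "q \<in> {t..s'} - ?O" "\<forall>y\<in>{t..s'} - ?O. q \<le> y"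
    using compact_attains_sup[of "{s..t} - ?O"] compact_attains_inf[of "{t..s'} - ?O"] by blast
  have I: "r \<in> {\<tau> x - \<epsilon><..<\<tau> x + \<epsilon>}" if "r \<in> {s..s'}" for r using that s by auto
  have pq: "\<sigma> p \<notin> W" "\<sigma> q \<notin> W" "p < t" "t < q" "s \<le> p" "q \<le> s'"
  proof -
    show *: "\<sigma> p \<notin> W" "\<sigma> q \<notin> W" using p(1) q(1) s I[of p] I[of q] by auto
    have "p \<le> t" "t \<le> q" "p \<noteq> t" "q \<noteq> t" using p(1) q(1) out * by auto
    then show "p < t" "t < q" by auto
    show "s \<le> p" "q \<le> s'" using p(1) q(1) by auto
  qed
  have ab: "p < q" "{p<..<q} \<subseteq> {\<tau> x - \<epsilon><..<\<tau> x + \<epsilon>}" using pq s by auto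
  have inW: "\<sigma> r \<in> W" if r: "r \<in> {p<..<q}" for r
  proof (rule ccontr)
    assume "\<sigma> r \<notin> W"
    then have "r \<in> {s..t} - ?O \<or> r \<in> {t..s'} - ?O" using r pq by auto
    then have "r \<le> p \<or> q \<le> r" using p(2) q(2) by blast
    then show False using r by auto
  qed
  obtain \<alpha> \<beta> where \<alpha>: "\<alpha> > 0" "\<forall>y\<in>G. \<tau> y \<in> {p<..<q} \<longrightarrow> y \<in> W \<and> u y = \<alpha> * \<tau> y + \<beta>"
    using trace_affine[OF W H B ab inW] by blast
  have val: "u (\<sigma> r) = \<alpha> * r + \<beta>" if "r \<in> {p<..<q}" for r
  proof -
    have "\<sigma> r \<in> G" "\<tau> (\<sigma> r) = r" using B ab(2) that unfolding box_def by auto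
    then show ?thesis using \<alpha>(2) that by auto
  qed
  have tJ: "\<alpha> * t + \<beta> \<in> u ` W" using val[of t] out(2) pq by force
  have notJ: "\<alpha> * p + \<beta> \<notin> u ` W" "\<alpha> * q + \<beta> \<notin> u ` W"
    using trace_end[OF W B ab \<alpha>, of p] trace_end[OF W B ab \<alpha>, of q] I[of p] I[of q] pq s by auto
  have Icc: "z \<in> u ` W" if "y \<in> u ` W" "y' \<in> u ` W" "y \<le> z" "z \<le> y'" for y y' z
    using tubeD(2)[OF W] that connected_contains_Icc[of "u ` W" y y'] by auto
  have lt: "\<alpha> * p + \<beta> < \<alpha> * t + \<beta>" "\<alpha> * t + \<beta> < \<alpha> * q + \<beta>" using \<alpha>(1) pq by auto
  have "\<alpha> * p + \<beta> < c" using Icc[OF c tJ, of "\<alpha> * p + \<beta>"] notJ lt by linarith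
  moreover have "c < \<alpha> * q + \<beta>" using Icc[OF tJ c, of "\<alpha> * q + \<beta>"] notJ lt by linarith
  ultimately have r: "(c - \<beta>) / \<alpha> \<in> {p<..<q}" using \<alpha>(1) by (auto simp: field_simps)
  then have "u (\<sigma> ((c - \<beta>) / \<alpha>)) = c" using val \<alpha>(1) by simp
  then show ?thesis using r inW pq by (intro bexI[of _ "(c - \<beta>) / \<alpha>"]) auto
qed

text \<open>The sign \<open>e\<close> treats both sides of \<open>x\<close> at once; distances are
  measured from \<open>x\<close>, so that entering and leaving \<open>W\<close> read the same on
  either side.\<close>

lemma side_dichotomy:
  assumes W: "tube W u" and H: "tch H \<tau>" and B: "box X H \<tau> x G \<epsilon> \<sigma>" and x: "x \<notin> W"
    and e: "e = 1 \<or> e = -1"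
  shows "\<exists>\<delta>>0. \<delta> \<le> \<epsilon> \<and>
    ((\<forall>r\<in>{0<..<\<delta>}. \<sigma> (\<tau> x + e * r) \<in> W) \<or> (\<forall>r\<in>{0<..<\<delta>}. \<sigma> (\<tau> x + e * r) \<notin> W))"
proof (rule ccontr)
  assume neg: "\<not> ?thesis"
  have \<epsilon>: "\<epsilon> > 0" using B unfolding box_def by blast
  have inW: "\<exists>r\<in>{0<..<\<delta>}. \<sigma> (\<tau> x + e * r) \<in> W" and notW: "\<exists>r\<in>{0<..<\<delta>}. \<sigma> (\<tau> x + e * r) \<notin> W"
    if "0 < \<delta>" "\<delta> \<le> \<epsilon>" for \<delta>
    using neg that by blast+
  have I: "\<tau> x + e * r \<in> {\<tau> x - \<epsilon><..<\<tau> x + \<epsilon>}" if "0 < r" "r < \<epsilon>" for r using e that by auto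
  obtain c where c: "c \<in> u ` W" using inW[OF \<epsilon>] by blast
  have "\<sigma> (\<tau> x) \<in> {y\<in>W. u y = c}"
  proof (rule box_transversal_limit[OF B tube_level_closed[OF W c]])
    show "\<tau> x \<in> {\<tau> x - \<epsilon><..<\<tau> x + \<epsilon>}" using \<epsilon> by auto
    fix \<delta> :: real assume "\<delta> > 0"
    then have "0 < min \<delta> \<epsilon>" "min \<delta> \<epsilon> \<le> \<epsilon>" using \<epsilon> by auto
    \<comment> \<open>Three radii below the prescribed bound with the pattern outside, inside,
      outside enclose a complete passage through \<open>W\<close>.\<close>
    then obtain r2 where r2: "0 < r2" "r2 < min \<delta> \<epsilon>" "\<sigma> (\<tau> x + e * r2) \<notin> W"
      using notW[of "min \<delta> \<epsilon>"] by auto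
    then obtain r1 where r1: "0 < r1" "r1 < r2" "\<sigma> (\<tau> x + e * r1) \<in> W" using inW[of r2] by auto
    then obtain r0 where r0: "0 < r0" "r0 < r1" "\<sigma> (\<tau> x + e * r0) \<notin> W"
      using notW[of r1] r2 by auto
    have "\<exists>r. 0 < r \<and> r < r2 \<and> \<sigma> (\<tau> x + e * r) \<in> W \<and> u (\<sigma> (\<tau> x + e * r)) = c"
    proof (cases "e = 1")
      case True
      then obtain r where "r \<in> {\<tau> x + r0<..<\<tau> x + r2}" "\<sigma> r \<in> W \<and> u (\<sigma> r) = c"
        using trace_gap[OF W H B, of "\<tau> x + r0" "\<tau> x + r2" "\<tau> x + r1" c] r0 r1 r2 I[of r0] I[of r2] c by auto
      then show ?thesis using True r0 by (intro exI[of _ "r - \<tau> x"]) auto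
    next
      case False
      then have "e = -1" using e by blast
      then obtain r where "r \<in> {\<tau> x - r2<..<\<tau> x - r0}" "\<sigma> r \<in> W \<and> u (\<sigma> r) = c"
        using trace_gap[OF W H B, of "\<tau> x - r2" "\<tau> x - r0" "\<tau> x - r1" c] r0 r1 r2 I[of r0] I[of r2] c by auto
      then show ?thesis using \<open>e = -1\<close> r0 by (intro exI[of _ "\<tau> x - r"]) auto
    qed
    then obtain r where r: "0 < r" "r < r2" "\<sigma> (\<tau> x + e * r) \<in> {y\<in>W. u y = c}" by blast
    moreover have "\<bar>\<tau> x + e * r - \<tau> x\<bar> < \<delta>" using e r r2 by auto
    ultimately show "\<exists>t\<in>{\<tau> x - \<epsilon><..<\<tau> x + \<epsilon>}. \<bar>t - \<tau> x\<bar> < \<delta> \<and> \<sigma> t \<in> {y\<in>W. u y = c}"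
      using I[of r] r2 by (intro bexI[of _ "\<tau> x + e * r"]) auto
  qed
  then show False using B x unfolding box_def by auto
qed

text \<open>The box is shrunk until both one-sided dichotomies hold for the transversal. A plaque
  lies in \<open>W\<close> as soon as it meets \<open>W\<close>, so each alternative extends from
  the transversal to a whole side of the box.\<close>

lemma boundary_box:
  assumes W: "tube W u" and H: "tch H \<tau>" and x: "x \<in> H" "x \<notin> W" and V: "openin X V" "x \<in> V"
  shows "\<exists>G \<epsilon> \<sigma>. box X H \<tau> x G \<epsilon> \<sigma> \<and> G \<subseteq> V \<and> (\<forall>y\<in>G. \<tau> y = \<tau> x \<longrightarrow> y \<notin> W) \<and>
    ((\<forall>y\<in>G. \<tau> y < \<tau> x \<longrightarrow> y \<in> W) \<or> (\<forall>y\<in>G. \<tau> y < \<tau> x \<longrightarrow> y \<notin> W)) \<and>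
    ((\<forall>y\<in>G. \<tau> x < \<tau> y \<longrightarrow> y \<in> W) \<or> (\<forall>y\<in>G. \<tau> x < \<tau> y \<longrightarrow> y \<notin> W))"
proof -
  obtain G \<epsilon> \<sigma> where B: "box X H \<tau> x G \<epsilon> \<sigma>" and GV: "G \<subseteq> V"
    using box_exists[OF H x(1) V] by metis
  obtain \<delta>1 where d1: "\<delta>1 > 0" "\<delta>1 \<le> \<epsilon>" "(\<forall>r\<in>{0<..<\<delta>1}. \<sigma> (\<tau> x + 1 * r) \<in> W) \<or> (\<forall>r\<in>{0<..<\<delta>1}. \<sigma> (\<tau> x + 1 * r) \<notin> W)"
    using side_dichotomy[OF W H B x(2), of 1] by blast
  obtain \<delta>2 where d2: "\<delta>2 > 0" "\<delta>2 \<le> \<epsilon>" "(\<forall>r\<in>{0<..<\<delta>2}. \<sigma> (\<tau> x + -1 * r) \<in> W) \<or> (\<forall>r\<in>{0<..<\<delta>2}. \<sigma> (\<tau> x + -1 * r) \<notin> W)"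
    using side_dichotomy[OF W H B x(2), of "-1"] by blast
  define \<delta> where "\<delta> = min \<delta>1 \<delta>2"
  have \<delta>: "\<delta> > 0" "\<delta> \<le> \<epsilon>" "\<delta> \<le> \<delta>1" "\<delta> \<le> \<delta>2" using d1 d2 unfolding \<delta>_def by auto
  define G' where "G' = {y\<in>G. \<bar>\<tau> y - \<tau> x\<bar> < \<delta>}"
  have B': "box X H \<tau> x G' \<delta> \<sigma>"
    unfolding G'_def using box_shrink[OF B \<delta>(1,2) tch_continuous[OF H] tch_open[OF H]] .
  have iff: "y \<in> W \<longleftrightarrow> \<sigma> (\<tau> y) \<in> W" if y: "y \<in> G'" for y
  proof -
    have *: "y \<in> G" "\<sigma> (\<tau> y) \<in> G" "\<tau> (\<sigma> (\<tau> y)) = \<tau> y" "connectedin X {z\<in>G. \<tau> z = \<tau> y}" "G \<subseteq> H"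
      using B y unfolding box_def G'_def by auto
    show ?thesis
      using plaque_in_tube[OF W H *(4,5,1) refl _ *(2,3)] plaque_in_tube[OF W H *(4,5,2,3) _ *(1) refl] by blast
  qed
  have rng1: "\<tau> y - \<tau> x \<in> {0<..<\<delta>1}" if "y \<in> G'" "\<tau> x < \<tau> y" for y
    using that \<delta>(3) unfolding G'_def by auto
  have iff1: "y \<in> W \<longleftrightarrow> \<sigma> (\<tau> x + 1 * (\<tau> y - \<tau> x)) \<in> W" if "y \<in> G'" for y
    using iff[OF that] by simp
  have up: "(\<forall>y\<in>G'. \<tau> x < \<tau> y \<longrightarrow> y \<in> W) \<or> (\<forall>y\<in>G'. \<tau> x < \<tau> y \<longrightarrow> y \<notin> W)"
    using d1(3) rng1 iff1 by meson
  have rng2: "\<tau> x - \<tau> y \<in> {0<..<\<delta>2}" if "y \<in> G'" "\<tau> y < \<tau> x" for y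
    using that \<delta>(4) unfolding G'_def by auto
  have iff2: "y \<in> W \<longleftrightarrow> \<sigma> (\<tau> x + -1 * (\<tau> x - \<tau> y)) \<in> W" if "y \<in> G'" for y
    using iff[OF that] by simp
  have low: "(\<forall>y\<in>G'. \<tau> y < \<tau> x \<longrightarrow> y \<in> W) \<or> (\<forall>y\<in>G'. \<tau> y < \<tau> x \<longrightarrow> y \<notin> W)"
    using d2(3) rng2 iff2 by meson
  have "\<forall>y\<in>G'. \<tau> y = \<tau> x \<longrightarrow> y \<notin> W" using iff x(2) B unfolding box_def by auto
  moreover have "G' \<subseteq> V" using GV unfolding G'_def by blast
  ultimately show ?thesis
    using B' up low by (intro exI[of _ G'] exI[of _ \<delta>] exI[of _ \<sigma>] conjI)
qed

text \<open>The value at \<open>x\<close> predicted by the affine formula is not attained, yet lies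
  above attained ones; as the attained values form an interval, it bounds them all. This is the
  source of the boundedness of \<open>u\<close>.\<close>

lemma lower_side_affine:
  assumes W: "tube W u" and H: "tch H \<tau>" and B: "box X H \<tau> x G \<epsilon> \<sigma>" and x: "x \<notin> W"
    and low: "\<forall>y\<in>G. \<tau> y < \<tau> x \<longrightarrow> y \<in> W"
  shows "\<exists>\<alpha>>0. \<exists>\<beta>. (\<forall>y\<in>G. \<tau> y < \<tau> x \<longrightarrow> u y = \<alpha> * \<tau> y + \<beta>) \<and> (\<forall>c\<in>u ` W. c < \<alpha> * \<tau> x + \<beta>)"
proof -
  have \<epsilon>: "\<epsilon> > 0" using B unfolding box_def by blast
  have ab: "\<tau> x - \<epsilon> < \<tau> x" "{\<tau> x - \<epsilon><..<\<tau> x} \<subseteq> {\<tau> x - \<epsilon><..<\<tau> x + \<epsilon>}" using \<epsilon> by auto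
  have \<sigma>: "\<sigma> t \<in> G" "\<tau> (\<sigma> t) = t" if "t \<in> {\<tau> x - \<epsilon><..<\<tau> x}" for t using B that unfolding box_def by auto
  obtain \<alpha> \<beta> where \<alpha>: "\<alpha> > 0" "\<forall>y\<in>G. \<tau> y \<in> {\<tau> x - \<epsilon><..<\<tau> x} \<longrightarrow> y \<in> W \<and> u y = \<alpha> * \<tau> y + \<beta>"
    using trace_affine[OF W H B ab] \<sigma> low by (metis greaterThanLessThan_iff)
  have "\<sigma> (\<tau> x) \<notin> W" using B x unfolding box_def by simp
  then have notJ: "\<alpha> * \<tau> x + \<beta> \<notin> u ` W" using trace_end[OF W B ab \<alpha>, of "\<tau> x"] \<epsilon> by auto
  have m: "\<tau> x - \<epsilon> / 2 \<in> {\<tau> x - \<epsilon><..<\<tau> x}" using \<epsilon> by auto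
  have val: "\<sigma> (\<tau> x - \<epsilon> / 2) \<in> W" "u (\<sigma> (\<tau> x - \<epsilon> / 2)) = \<alpha> * (\<tau> x - \<epsilon> / 2) + \<beta>"
    using \<alpha>(2) \<sigma>[OF m] m by auto
  have mJ: "\<alpha> * (\<tau> x - \<epsilon> / 2) + \<beta> \<in> u ` W" using val by (metis imageI)
  have "\<alpha> * (\<tau> x - \<epsilon> / 2) + \<beta> < \<alpha> * \<tau> x + \<beta>" using \<alpha>(1) \<epsilon> by simp
  then have "c < \<alpha> * \<tau> x + \<beta>" if "c \<in> u ` W" for c
    using connected_contains_Icc[OF tubeD(2)[OF W] mJ that] notJ
    by (meson atLeastAtMost_iff less_imp_le not_le subsetD)
  moreover have "u y = \<alpha> * \<tau> y + \<beta>" if "y \<in> G" "\<tau> y < \<tau> x" for y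
    using \<alpha>(2) that B unfolding box_def by auto
  ultimately show ?thesis using \<alpha>(1) by blast
qed

lemma upper_side_affine:
  assumes W: "tube W u" and H: "tch H \<tau>" and B: "box X H \<tau> x G \<epsilon> \<sigma>" and x: "x \<notin> W"
    and up: "\<forall>y\<in>G. \<tau> x < \<tau> y \<longrightarrow> y \<in> W"
  shows "\<exists>\<alpha>>0. \<exists>\<beta>. (\<forall>y\<in>G. \<tau> x < \<tau> y \<longrightarrow> u y = \<alpha> * \<tau> y + \<beta>) \<and> (\<forall>c\<in>u ` W. \<alpha> * \<tau> x + \<beta> < c)"
proof -
  have \<epsilon>: "\<epsilon> > 0" using B unfolding box_def by blast
  have ab: "\<tau> x < \<tau> x + \<epsilon>" "{\<tau> x<..<\<tau> x + \<epsilon>} \<subseteq> {\<tau> x - \<epsilon><..<\<tau> x + \<epsilon>}" using \<epsilon> by auto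
  have \<sigma>: "\<sigma> t \<in> G" "\<tau> (\<sigma> t) = t" if "t \<in> {\<tau> x<..<\<tau> x + \<epsilon>}" for t using B that unfolding box_def by auto
  obtain \<alpha> \<beta> where \<alpha>: "\<alpha> > 0" "\<forall>y\<in>G. \<tau> y \<in> {\<tau> x<..<\<tau> x + \<epsilon>} \<longrightarrow> y \<in> W \<and> u y = \<alpha> * \<tau> y + \<beta>"
    using trace_affine[OF W H B ab] \<sigma> up by (metis greaterThanLessThan_iff)
  have "\<sigma> (\<tau> x) \<notin> W" using B x unfolding box_def by simp
  then have notJ: "\<alpha> * \<tau> x + \<beta> \<notin> u ` W" using trace_end[OF W B ab \<alpha>, of "\<tau> x"] \<epsilon> by auto
  have m: "\<tau> x + \<epsilon> / 2 \<in> {\<tau> x<..<\<tau> x + \<epsilon>}" using \<epsilon> by auto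
  have val: "\<sigma> (\<tau> x + \<epsilon> / 2) \<in> W" "u (\<sigma> (\<tau> x + \<epsilon> / 2)) = \<alpha> * (\<tau> x + \<epsilon> / 2) + \<beta>"
    using \<alpha>(2) \<sigma>[OF m] m by auto
  have mJ: "\<alpha> * (\<tau> x + \<epsilon> / 2) + \<beta> \<in> u ` W" using val by (metis imageI)
  have "\<alpha> * \<tau> x + \<beta> < \<alpha> * (\<tau> x + \<epsilon> / 2) + \<beta>" using \<alpha>(1) \<epsilon> by simp
  then have "\<alpha> * \<tau> x + \<beta> < c" if "c \<in> u ` W" for c
    using connected_contains_Icc[OF tubeD(2)[OF W] that mJ] notJ
    by (meson atLeastAtMost_iff less_imp_le not_le subsetD)
  moreover have "u y = \<alpha> * \<tau> y + \<beta>" if "y \<in> G" "\<tau> x < \<tau> y" for y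
    using \<alpha>(2) that B unfolding box_def by auto
  ultimately show ?thesis using \<alpha>(1) by blast
qed

end

section \<open>The upper end of a tube\<close>

definition (in transverse_affine) top_end :: "'m set \<Rightarrow> 'm set" where
  "top_end W = {x \<in> topspace X - W. \<exists>H \<tau>. tch H \<tau> \<and> x \<in> H \<and> (\<forall>y\<in>H. \<tau> y < \<tau> x \<longrightarrow> y \<in> W)}"

context transverse_affine
begin

lemma top_endD: "x \<in> top_end W \<Longrightarrow> x \<in> topspace X" "x \<in> top_end W \<Longrightarrow> x \<notin> W"
  unfolding top_end_def by auto

lemma top_endI:
  assumes "tch H \<tau>" "openin X T" "x \<in> T" "T \<subseteq> H" "x \<notin> W" "\<forall>y\<in>T. \<tau> y < \<tau> x \<longrightarrow> y \<in> W"
  shows "x \<in> top_end W"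
proof -
  have "tch T \<tau>" by (rule tch_subset[OF assms(1,2,4)])
  moreover have "x \<in> topspace X" using assms(2,3) openin_subset by blast
  ultimately show ?thesis unfolding top_end_def using assms(3,5,6) by blast
qed

text \<open>The definition of \<open>top_end\<close> names one chart, but increasing affine changes
  preserve which side is below, so any chart will do. Only the lower side is tested: a frontier
  point with \<open>W\<close> solely above it is not in \<open>top_end\<close>, and at a point of
  \<open>top_end\<close> the tube may lie above as well.\<close>

lemma top_end_lower:
  assumes "x \<in> top_end W" "tch H \<tau>" "x \<in> H"
  shows "\<exists>T. openin X T \<and> x \<in> T \<and> T \<subseteq> H \<and> (\<forall>y\<in>T. \<tau> y < \<tau> x \<longrightarrow> y \<in> W)"
proof -
  obtain H' \<mu> where H': "tch H' \<mu>" "x \<in> H'" "\<forall>y\<in>H'. \<mu> y < \<mu> x \<longrightarrow> y \<in> W"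
    using assms(1) unfolding top_end_def by blast
  obtain T \<alpha> \<beta> where T: "openin X T" "x \<in> T" "T \<subseteq> H \<inter> H'" "0 < \<alpha>" "\<forall>y\<in>T. \<mu> y = \<alpha> * \<tau> y + \<beta>"
    using tch_transition[OF assms(2) H'(1) assms(3) H'(2)] by (elim exE conjE)
  have "\<mu> y < \<mu> x" if "y \<in> T" "\<tau> y < \<tau> x" for y using that T by simp
  then show ?thesis using T(1-3) H'(3) by (intro exI[of _ T]) blast
qed

lemma tch_value_near:
  assumes "tch H \<tau>" "openin X T" "y \<in> T" "T \<subseteq> H" "a < \<tau> y"
  shows "\<exists>z\<in>T. a < \<tau> z \<and> \<tau> z < \<tau> y"
proof -
  obtain \<rho> where \<rho>: "\<rho> > 0" "{\<tau> y - \<rho><..<\<tau> y + \<rho>} \<subseteq> \<tau> ` (T \<inter> H)"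
    using tch_image_ball[OF assms(1,2,3)] assms(3,4) by blast
  have "max a (\<tau> y - \<rho>) < \<tau> y" using assms(5) \<rho>(1) by auto
  then obtain t where t: "max a (\<tau> y - \<rho>) < t" "t < \<tau> y" using dense by blast
  then have "t \<in> {\<tau> y - \<rho><..<\<tau> y + \<rho>}" using \<rho>(1) by auto
  then obtain z where "z \<in> T" "t = \<tau> z" using \<rho>(2) by blast
  then show ?thesis using t by (intro bexI[of _ z]) auto
qed

text \<open>A point off the middle plaque cannot be in the upper end: points just below it lie on
  the same side of the box and so share its membership in \<open>W\<close>. Thus the box meets the
  upper end in its middle plaque or not at all.\<close>

lemma boundary_box_top_end:
  assumes W: "tube W u" and H: "tch H \<tau>" and B: "box X H \<tau> x G \<epsilon> \<sigma>"
    and lev: "\<forall>y\<in>G. \<tau> y = \<tau> x \<longrightarrow> y \<notin> W"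
    and low: "(\<forall>y\<in>G. \<tau> y < \<tau> x \<longrightarrow> y \<in> W) \<or> (\<forall>y\<in>G. \<tau> y < \<tau> x \<longrightarrow> y \<notin> W)"
    and up: "(\<forall>y\<in>G. \<tau> x < \<tau> y \<longrightarrow> y \<in> W) \<or> (\<forall>y\<in>G. \<tau> x < \<tau> y \<longrightarrow> y \<notin> W)"
    and y: "y \<in> G"
  shows "y \<in> top_end W \<longleftrightarrow> \<tau> y = \<tau> x \<and> (\<forall>z\<in>G. \<tau> z < \<tau> x \<longrightarrow> z \<in> W)"
proof
  have G: "openin X G" "G \<subseteq> H" using B unfolding box_def by auto
  assume top: "y \<in> top_end W"
  have yW: "y \<notin> W" using top top_endD by blast
  have G': "tch G \<tau>" by (rule tch_subset[OF H G])
  obtain T where T: "openin X T" "y \<in> T" "T \<subseteq> G" "\<forall>z\<in>T. \<tau> z < \<tau> y \<longrightarrow> z \<in> W"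
    using top_end_lower[OF top G' y] by (elim exE conjE)
  have near: "\<exists>z\<in>G. a < \<tau> z \<and> \<tau> z < \<tau> y \<and> z \<in> W" if "a < \<tau> y" for a
    using tch_value_near[OF G' T(1,2,3) that] T(3,4) by blast
  have "\<not> \<tau> x < \<tau> y"
  proof
    assume "\<tau> x < \<tau> y"
    then show False using near[of "\<tau> x"] up y yW by auto
  qed
  moreover have below: "\<tau> y \<le> \<tau> x \<Longrightarrow> \<forall>z\<in>G. \<tau> z < \<tau> x \<longrightarrow> z \<in> W"
  proof -
    assume "\<tau> y \<le> \<tau> x"
    moreover obtain z where "z \<in> G" "\<tau> z < \<tau> y" "z \<in> W" using near[of "\<tau> y - 1"] by auto
    ultimately show ?thesis using low by fastforce
  qed
  ultimately show "\<tau> y = \<tau> x \<and> (\<forall>z\<in>G. \<tau> z < \<tau> x \<longrightarrow> z \<in> W)" using y yW by force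
next
  assume "\<tau> y = \<tau> x \<and> (\<forall>z\<in>G. \<tau> z < \<tau> x \<longrightarrow> z \<in> W)"
  then show "y \<in> top_end W"
    using B lev y unfolding box_def by (intro top_endI[OF H, of G]) auto
qed

lemma top_end_closed:
  assumes W: "tube W u"
  shows "closedin X (top_end W)"
proof -
  have "openin X (topspace X - top_end W)"
  proof (subst openin_subopen, intro ballI)
    fix x assume x: "x \<in> topspace X - top_end W"
    show "\<exists>T. openin X T \<and> x \<in> T \<and> T \<subseteq> topspace X - top_end W"
    proof (cases "x \<in> W")
      case True
      then show ?thesis using tubeD(5)[OF W] openin_subset[of X W] top_endD(2) by (intro exI[of _ W]) auto
    next
      case False
      obtain H \<tau> where H: "tch H \<tau>" "x \<in> H" using tch_exists x by blast
      obtain G \<epsilon> \<sigma> where B: "box X H \<tau> x G \<epsilon> \<sigma>"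
        and 1: "\<forall>y\<in>G. \<tau> y = \<tau> x \<longrightarrow> y \<notin> W"
          "(\<forall>y\<in>G. \<tau> y < \<tau> x \<longrightarrow> y \<in> W) \<or> (\<forall>y\<in>G. \<tau> y < \<tau> x \<longrightarrow> y \<notin> W)"
          "(\<forall>y\<in>G. \<tau> x < \<tau> y \<longrightarrow> y \<in> W) \<or> (\<forall>y\<in>G. \<tau> x < \<tau> y \<longrightarrow> y \<notin> W)"
        using boundary_box[OF W H False tch_open[OF H(1)] H(2)] by (elim exE conjE)
      have "x \<in> G" "openin X G" using B unfolding box_def by auto
      moreover have "y \<notin> top_end W" if "y \<in> G" for y
        using boundary_box_top_end[OF W H(1) B 1] that \<open>x \<in> G\<close> x by blast
      ultimately show ?thesis using openin_subset[of X G] by (intro exI[of _ G]) auto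
    qed
  qed
  moreover have "top_end W \<subseteq> topspace X" using top_endD(1) by blast
  ultimately show ?thesis by (simp add: closedin_def)
qed

text \<open>Each point of the compact complement of \<open>V\<close> has a neighbourhood on which
  \<open>u\<close> stays below some attained value, and the largest of finitely many such values
  works. In this sense high levels of a tube converge to its upper end.\<close>

lemma near_top_end:
  assumes W: "tube W u" "W \<noteq> {}" and V: "openin X V" "top_end W \<subseteq> V"
  shows "\<exists>c\<in>u ` W. \<forall>y\<in>W. c \<le> u y \<longrightarrow> y \<in> V"
proof -
  have cl: "closedin X (topspace X - V)" using V(1) by blast
  have "\<exists>T c. openin X T \<and> x \<in> T \<and> c \<in> u ` W \<and> (\<forall>y\<in>T \<inter> W. u y < c)"
    if x: "x \<in> topspace X - V" for x
  proof (cases "x \<in> W")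
    case True
    obtain e where e: "e > 0" "ball (u x) e \<subseteq> u ` W"
      using tubeD(6)[OF W(1)] True open_contains_ball[of "u ` W"] by blast
    then have "u x + e / 2 \<in> u ` W" by (auto simp: subset_iff dist_real_def)
    moreover have "openin X {y\<in>W. u y \<in> {..<u x + e / 2}}"
      by (rule tch_preimage_open[OF tubeD(1)[OF W(1)]]) simp
    ultimately show ?thesis
      using True e(1) by (intro exI[of _ "{y\<in>W. u y \<in> {..<u x + e / 2}}"] exI[of _ "u x + e / 2"]) auto
  next
    case False
    obtain H \<tau> where H: "tch H \<tau>" "x \<in> H" using tch_exists x by blast
    obtain G \<epsilon> \<sigma> where B: "box X H \<tau> x G \<epsilon> \<sigma>"
      and 1: "\<forall>y\<in>G. \<tau> y = \<tau> x \<longrightarrow> y \<notin> W"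
        "(\<forall>y\<in>G. \<tau> y < \<tau> x \<longrightarrow> y \<in> W) \<or> (\<forall>y\<in>G. \<tau> y < \<tau> x \<longrightarrow> y \<notin> W)"
        "(\<forall>y\<in>G. \<tau> x < \<tau> y \<longrightarrow> y \<in> W) \<or> (\<forall>y\<in>G. \<tau> x < \<tau> y \<longrightarrow> y \<notin> W)"
      using boundary_box[OF W(1) H False tch_open[OF H(1)] H(2)] by (elim exE conjE)
    have G: "x \<in> G" "openin X G" "G \<subseteq> H" using B unfolding box_def by auto
    have "x \<notin> top_end W" using x V(2) by blast
    then have "\<not> (\<forall>y\<in>G. \<tau> y < \<tau> x \<longrightarrow> y \<in> W)"
      using boundary_box_top_end[OF W(1) H(1) B 1 G(1)] by blast
    then have low: "y \<notin> W" if "y \<in> G" "\<tau> y < \<tau> x" for y using 1(2) that by blast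
    show ?thesis
    proof (cases "\<forall>y\<in>G. \<tau> x < \<tau> y \<longrightarrow> y \<in> W")
      case True
      \<comment> \<open>If \<open>W\<close> lies only above \<open>x\<close>, then near
        \<open>x\<close> the values of \<open>u\<close> are close to a strict lower bound of its
        range, so any attained value \<open>c\<close> exceeds them after shrinking.\<close>
      obtain \<alpha> \<beta> where \<alpha>: "\<alpha> > 0" "\<forall>y\<in>G. \<tau> x < \<tau> y \<longrightarrow> u y = \<alpha> * \<tau> y + \<beta>"
          "\<forall>c\<in>u ` W. \<alpha> * \<tau> x + \<beta> < c"
        using upper_side_affine[OF W(1) H(1) B False True] by (elim exE conjE)
      obtain c where c: "c \<in> u ` W" using W(2) by blast
      define T where "T = {y\<in>G. \<tau> y \<in> {..<(c - \<beta>) / \<alpha>}}"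
      have "openin X T" unfolding T_def
        by (rule tch_preimage_open[OF tch_subset[OF H(1) G(2,3)]]) simp
      moreover have "x \<in> T" using \<alpha>(1) \<alpha>(3)[rule_format, OF c] G(1) unfolding T_def by (simp add: field_simps)
      moreover have "u y < c" if y: "y \<in> T \<inter> W" for y
      proof -
        have "y \<in> G" "\<tau> y \<noteq> \<tau> x" "\<not> \<tau> y < \<tau> x" using y 1(1) low unfolding T_def by auto
        then have "u y = \<alpha> * \<tau> y + \<beta>" using \<alpha>(2) by auto
        moreover have "\<tau> y < (c - \<beta>) / \<alpha>" using y unfolding T_def by auto
        then have "\<alpha> * \<tau> y + \<beta> < c" using \<alpha>(1) by (simp add: field_simps)
        ultimately show ?thesis by simp
      qed
      ultimately show ?thesis using c by blast
    next
      case False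
      then have "y \<notin> W" if "y \<in> G" for y using that low[OF that] 1(1,3) by (meson linorder_neqE_linordered_idom)
      moreover obtain c where "c \<in> u ` W" using W(2) by blast
      ultimately show ?thesis using G(1,2) by (intro exI[of _ G] exI[of _ c]) auto
    qed
  qed
  then obtain T c where Tc: "\<And>x. x \<in> topspace X - V \<Longrightarrow>
      openin X (T x) \<and> x \<in> T x \<and> c x \<in> u ` W \<and> (\<forall>y\<in>T x \<inter> W. u y < c x)" by metis
  obtain I where I: "finite I" "I \<subseteq> topspace X - V" "topspace X - V \<subseteq> (\<Union>i\<in>I. T i)"
    by (rule closed_finite_subcover[OF cl, of T]) (use Tc in auto)
  obtain c0 where c0: "c0 \<in> u ` W" using W(2) by blast
  define C where "C = Max (insert c0 (c ` I))"
  have fin: "finite (insert c0 (c ` I))" using I(1) by blast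
  have "C \<in> insert c0 (c ` I)" unfolding C_def by (rule Max_in) (use fin in auto)
  then have "C \<in> u ` W" using c0 Tc I(2) by auto
  moreover have "y \<in> V" if y: "y \<in> W" "C \<le> u y" for y
  proof (rule ccontr)
    assume "y \<notin> V"
    then have "y \<in> topspace X - V" using y(1) openin_subset[OF tubeD(5)[OF W(1)]] by blast
    then obtain i where i: "i \<in> I" "y \<in> T i" using I(3) by blast
    then have "u y < c i" using Tc[of i] I(2) y(1) by blast
    moreover have "c i \<le> C" unfolding C_def by (rule Max_ge[OF fin]) (use i in auto)
    ultimately show False using y(2) by simp
  qed
  ultimately show ?thesis by blast
qed

text \<open>With \<open>V\<close> empty, the preceding lemma would produce an attained value whose
  level is empty.\<close>

lemma top_end_nonempty:
  assumes "tube W u" "W \<noteq> {}"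
  shows "top_end W \<noteq> {}"
proof
  assume "top_end W = {}"
  then obtain c where "c \<in> u ` W" "\<forall>y\<in>W. c \<le> u y \<longrightarrow> y \<in> {}"
    using near_top_end[OF assms, of "{}"] by auto
  then show False by blast
qed

text \<open>The chart at an end point is rescaled by the affine formula for \<open>u\<close>, so
  that it continues \<open>u\<close>; its value at the end is then the supremum, whatever the point.
  The clause on points above keeps the dichotomy for the upper side, which decides later whether
  \<open>W\<close> also arrives from above.\<close>

lemma top_chart:
  assumes W: "tube W u" and x: "x \<in> top_end W"
  shows "\<exists>H \<tau>. tch H \<tau> \<and> x \<in> H \<and> \<tau> x = Sup (u ` W) \<and>
    (\<forall>y\<in>H. \<tau> y < Sup (u ` W) \<longrightarrow> y \<in> W \<and> u y = \<tau> y) \<and>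
    (\<forall>y\<in>H. y \<in> top_end W \<longleftrightarrow> \<tau> y = Sup (u ` W)) \<and>
    (\<forall>y\<in>H. Sup (u ` W) < \<tau> y \<longrightarrow> y \<in> W \<longrightarrow> (\<forall>z\<in>H. Sup (u ` W) < \<tau> z \<longrightarrow> z \<in> W)) \<and>
    (\<forall>c\<in>u ` W. c < Sup (u ` W))"
proof -
  have xW: "x \<notin> W" "x \<in> topspace X" using x top_endD by auto
  obtain H \<tau> where H: "tch H \<tau>" "x \<in> H" using tch_exists xW(2) by blast
  obtain G \<epsilon> \<sigma> where B: "box X H \<tau> x G \<epsilon> \<sigma>"
    and 1: "\<forall>y\<in>G. \<tau> y = \<tau> x \<longrightarrow> y \<notin> W"
      "(\<forall>y\<in>G. \<tau> y < \<tau> x \<longrightarrow> y \<in> W) \<or> (\<forall>y\<in>G. \<tau> y < \<tau> x \<longrightarrow> y \<notin> W)"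
      "(\<forall>y\<in>G. \<tau> x < \<tau> y \<longrightarrow> y \<in> W) \<or> (\<forall>y\<in>G. \<tau> x < \<tau> y \<longrightarrow> y \<notin> W)"
    using boundary_box[OF W H xW(1) tch_open[OF H(1)] H(2)] by (elim exE conjE)
  have G: "x \<in> G" "openin X G" "G \<subseteq> H" using B unfolding box_def by auto
  have G': "tch G \<tau>" by (rule tch_subset[OF H(1) G(2,3)])
  have low: "\<forall>y\<in>G. \<tau> y < \<tau> x \<longrightarrow> y \<in> W"
    using boundary_box_top_end[OF W H(1) B 1 G(1)] x by blast
  obtain \<alpha> \<beta> where \<alpha>: "\<alpha> > 0" "\<forall>y\<in>G. \<tau> y < \<tau> x \<longrightarrow> u y = \<alpha> * \<tau> y + \<beta>"
      "\<forall>c\<in>u ` W. c < \<alpha> * \<tau> x + \<beta>"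
    using lower_side_affine[OF W H(1) B xW(1) low] by (elim exE conjE)
  \<comment> \<open>The predicted end value bounds all values, and nothing smaller does, since the
    chart takes values arbitrarily close to it at points of \<open>W\<close> below the end.\<close>
  have sup: "Sup (u ` W) = \<alpha> * \<tau> x + \<beta>"
  proof (rule cSup_eq)
    show "c \<le> \<alpha> * \<tau> x + \<beta>" if "c \<in> u ` W" for c using \<alpha>(3) that by force
    fix v assume v: "\<And>c. c \<in> u ` W \<Longrightarrow> c \<le> v"
    show "\<alpha> * \<tau> x + \<beta> \<le> v"
    proof (rule ccontr)
      assume "\<not> ?thesis"
      then have "(v - \<beta>) / \<alpha> < \<tau> x" using \<alpha>(1) by (simp add: field_simps)
      then obtain z where z: "z \<in> G" "(v - \<beta>) / \<alpha> < \<tau> z" "\<tau> z < \<tau> x"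
        using tch_value_near[OF G' G(2,1) order_refl] by blast
      then have "z \<in> W" "u z = \<alpha> * \<tau> z + \<beta>" using low \<alpha>(2) by auto
      moreover have "v < \<alpha> * \<tau> z + \<beta>" using z(2) \<alpha>(1) by (simp add: field_simps)
      ultimately show False using v[of "u z"] by force
    qed
  qed
  have cmp: "\<alpha> * \<tau> y + \<beta> < \<alpha> * \<tau> x + \<beta> \<longleftrightarrow> \<tau> y < \<tau> x" "\<alpha> * \<tau> y + \<beta> = \<alpha> * \<tau> x + \<beta> \<longleftrightarrow> \<tau> y = \<tau> x"
      "\<alpha> * \<tau> x + \<beta> < \<alpha> * \<tau> y + \<beta> \<longleftrightarrow> \<tau> x < \<tau> y" for y
    using \<alpha>(1) by auto
  have "tch G (\<lambda>y. \<alpha> * \<tau> y + \<beta>)" by (rule tch_affine[OF G' \<alpha>(1)])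
  moreover have "\<forall>y\<in>G. y \<in> top_end W \<longleftrightarrow> \<tau> y = \<tau> x"
    using boundary_box_top_end[OF W H(1) B 1] low by blast
  ultimately show ?thesis
    unfolding sup using G(1) low \<alpha>(2,3) 1(3) cmp
    by (intro exI[of _ G] exI[of _ "\<lambda>y. \<alpha> * \<tau> y + \<beta>"]) (simp only:, blast)
qed

text \<open>Two separated pieces of the end would have disjoint open neighbourhoods; the high part
  of \<open>W\<close> lies in their union, meets both, and is connected.\<close>

lemma top_end_connected:
  assumes W: "tube W u" "W \<noteq> {}"
  shows "connectedin X (top_end W)"
proof (rule ccontr)
  assume "\<not> connectedin X (top_end W)"
  moreover have "top_end W \<subseteq> topspace X" using top_endD(1) by blast
  ultimately have "\<exists>E1 E2. closedin X E1 \<and> closedin X E2 \<and> top_end W \<subseteq> E1 \<union> E2 \<and>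
      E1 \<inter> E2 \<inter> top_end W = {} \<and> E1 \<inter> top_end W \<noteq> {} \<and> E2 \<inter> top_end W \<noteq> {}"
    unfolding connectedin_closedin by (simp only: simp_thms)
  then obtain E1 E2 where E: "closedin X E1" "closedin X E2" "top_end W \<subseteq> E1 \<union> E2"
      "E1 \<inter> E2 \<inter> top_end W = {}" "E1 \<inter> top_end W \<noteq> {}" "E2 \<inter> top_end W \<noteq> {}"
    by (elim exE conjE)
  have "closedin X (E1 \<inter> top_end W)" "closedin X (E2 \<inter> top_end W)"
    using E(1,2) top_end_closed[OF W(1)] by (simp_all add: closedin_Int)
  moreover have "disjnt (E1 \<inter> top_end W) (E2 \<inter> top_end W)" using E(4) by (auto simp: disjnt_def)
  ultimately have "\<exists>U1 U2. openin X U1 \<and> openin X U2 \<and> E1 \<inter> top_end W \<subseteq> U1 \<and>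
      E2 \<inter> top_end W \<subseteq> U2 \<and> disjnt U1 U2"
    using normal_X unfolding normal_space_def by simp
  then obtain U1 U2 where U: "openin X U1" "openin X U2" "E1 \<inter> top_end W \<subseteq> U1"
      "E2 \<inter> top_end W \<subseteq> U2" "disjnt U1 U2" by (elim exE conjE)
  have "top_end W \<subseteq> U1 \<union> U2" using E(3) U(3,4) by blast
  then obtain c where c: "c \<in> u ` W" "\<forall>y\<in>W. c \<le> u y \<longrightarrow> y \<in> U1 \<union> U2"
    using near_top_end[OF W openin_Un[OF U(1,2)]] by blast
  let ?S = "{y\<in>W. c < u y}"
  have meet: "U \<inter> ?S \<noteq> {}" if Ux: "openin X U" "x \<in> U" "x \<in> top_end W" for U x
  proof -
    obtain H \<tau> where H: "tch H \<tau>" "x \<in> H" "\<tau> x = Sup (u ` W)"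
        "\<forall>y\<in>H. \<tau> y < Sup (u ` W) \<longrightarrow> y \<in> W \<and> u y = \<tau> y" "\<forall>c\<in>u ` W. c < Sup (u ` W)"
      using top_chart[OF W(1) Ux(3)] by (elim exE conjE)
    have "openin X (U \<inter> H)" using Ux(1) tch_open[OF H(1)] by blast
    then obtain z where "z \<in> U \<inter> H" "c < \<tau> z" "\<tau> z < \<tau> x"
      using tch_value_near[OF H(1), of "U \<inter> H" x c] Ux(2) H c(1) by auto
    then show ?thesis using H(3,4) by auto
  qed
  have "U1 \<inter> ?S \<noteq> {}" "U2 \<inter> ?S \<noteq> {}" using meet U E(5,6) by blast+
  moreover have "?S \<subseteq> U1 \<union> U2" using c(2) by auto
  moreover have "U1 \<inter> U2 \<inter> ?S = {}" using U(5) by (auto simp: disjnt_def)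
  ultimately show False using tube_above_connected[OF W(1), of c] U(1,2) unfolding connectedin by blast
qed

text \<open>Two rescaled charts agree at the end and agree with \<open>u\<close> below it, so their
  affine transition fixes two distinct values and is the identity; the germs cohere and glue. The
  last clause leaves open that \<open>W\<close> also arrives from above, and ties this to a point of
  the end.\<close>

lemma top_collar:
  assumes W: "tube W u" "W \<noteq> {}"
  shows "\<exists>H v. tch H v \<and> top_end W \<subseteq> H \<and>
    (\<forall>y\<in>H. v y < Sup (u ` W) \<longrightarrow> y \<in> W \<and> u y = v y) \<and>
    (\<forall>y\<in>H. y \<in> top_end W \<longleftrightarrow> v y = Sup (u ` W)) \<and>
    (\<forall>y\<in>H. Sup (u ` W) < v y \<longrightarrow> y \<in> W \<longrightarrow>
       (\<exists>x\<in>top_end W. \<exists>G \<tau>. tch G \<tau> \<and> x \<in> G \<and> (\<forall>z\<in>G. \<tau> x < \<tau> z \<longrightarrow> z \<in> W)))"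
proof -
  let ?b = "Sup (u ` W)"
  define P where "P x H \<tau> \<longleftrightarrow> tch H \<tau> \<and> x \<in> H \<and> \<tau> x = ?b \<and>
    (\<forall>y\<in>H. \<tau> y < ?b \<longrightarrow> y \<in> W \<and> u y = \<tau> y) \<and> (\<forall>y\<in>H. y \<in> top_end W \<longleftrightarrow> \<tau> y = ?b) \<and>
    (\<forall>y\<in>H. ?b < \<tau> y \<longrightarrow> y \<in> W \<longrightarrow> (\<forall>z\<in>H. ?b < \<tau> z \<longrightarrow> z \<in> W)) \<and> (\<forall>c\<in>u ` W. c < ?b)"
    for x H \<tau>
  have "\<exists>H \<tau>. P x H \<tau>" if "x \<in> top_end W" for x
    unfolding P_def by (rule top_chart[OF W(1) that])
  then obtain H \<tau> where "\<And>x. x \<in> top_end W \<Longrightarrow> P x (H x) (\<tau> x)" by metis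
  then have ch: "tch (H x) (\<tau> x)" "x \<in> H x" "\<tau> x x = ?b"
      "y \<in> H x \<Longrightarrow> \<tau> x y < ?b \<Longrightarrow> y \<in> W \<and> u y = \<tau> x y"
      "y \<in> H x \<Longrightarrow> y \<in> top_end W \<longleftrightarrow> \<tau> x y = ?b"
      "y \<in> H x \<Longrightarrow> ?b < \<tau> x y \<Longrightarrow> y \<in> W \<Longrightarrow> z \<in> H x \<Longrightarrow> ?b < \<tau> x z \<Longrightarrow> z \<in> W"
    if "x \<in> top_end W" for x y z
    using that unfolding P_def by (meson that)+
  have germ: "germ_eq X y (\<tau> x) (\<tau> y)" if xy: "x \<in> top_end W" "y \<in> top_end W" "y \<in> H x" for x y
  proof -
    have b: "\<tau> x y = ?b" "\<tau> y y = ?b" "tch (H x) (\<tau> x)" "tch (H y) (\<tau> y)" "y \<in> H y"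
      using ch(1,2,3)[OF xy(1)] ch(1,2,3)[OF xy(2)] ch(5)[OF xy(1,3)] xy(2) by auto
    obtain T \<alpha> \<beta> where T: "openin X T" "y \<in> T" "T \<subseteq> H x \<inter> H y" "0 < \<alpha>" "\<forall>z\<in>T. \<tau> y z = \<alpha> * \<tau> x z + \<beta>"
      using tch_transition[OF b(3,4) xy(3) b(5)] by (elim exE conjE)
    have beq: "?b = \<alpha> * ?b + \<beta>" using T(5) b T(2) by force
    have "T \<subseteq> H x" using T(3) by blast
    then obtain z where z: "z \<in> T" "\<tau> x z < ?b"
      using tch_value_near[OF b(3) T(1,2), of "?b - 1"] b(1) by auto
    have "\<tau> y z = \<alpha> * \<tau> x z + \<beta>" using T(5) z(1) by blast
    moreover have "\<alpha> * \<tau> x z < \<alpha> * ?b" using z(2) T(4) by simp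
    ultimately have "\<tau> y z < ?b" using beq by linarith
    then have "u z = \<tau> y z" "u z = \<tau> x z"
      using ch(4)[OF xy(1), of z] ch(4)[OF xy(2), of z] z T(3) by auto
    then have "\<tau> x z = \<alpha> * \<tau> x z + \<beta>" using T(5) z(1) by force
    \<comment> \<open>The transition fixes the end value and the value at \<open>z\<close>;
      subtracting the two equations shows that this product vanishes, so the slope is 1.\<close>
    moreover have "(1 - \<alpha>) * (?b - \<tau> x z) = ?b - \<tau> x z - \<alpha> * ?b + \<alpha> * \<tau> x z"
      by (simp add: left_diff_distrib right_diff_distrib)
    ultimately have "(1 - \<alpha>) * (?b - \<tau> x z) = 0" using beq by linarith
    then have \<alpha>: "\<alpha> = 1" using z(2) by simp
    then have "\<beta> = 0" using beq[unfolded \<alpha>] by linarith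
    then have "\<forall>z\<in>T. \<tau> x z = \<tau> y z" using T(5) \<alpha> by simp
    then show ?thesis unfolding germ_eq_def using T(1,2) by (intro exI[of _ T]) simp
  qed
  have "\<exists>G v. tch G v \<and> top_end W \<subseteq> G \<and> (\<forall>x\<in>top_end W. germ_eq X x v (\<tau> x))"
  proof (rule glue_germs[OF top_end_closed[OF W(1)]])
    show "tch (H x) (\<tau> x) \<and> x \<in> H x" if "x \<in> top_end W" for x using ch(1,2)[OF that] by simp
    show "\<exists>T. openin X T \<and> x \<in> T \<and> (\<forall>y\<in>top_end W \<inter> T. germ_eq X y (\<tau> x) (\<tau> y))" if x: "x \<in> top_end W" for x
      using germ[OF x] ch(1,2)[OF x] tch_open[of "H x" "\<tau> x"] by (intro exI[of _ "H x"]) simp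
  qed
  then obtain G v where G: "tch G v" "top_end W \<subseteq> G" "\<And>x. x \<in> top_end W \<Longrightarrow> germ_eq X x v (\<tau> x)"
    by blast
  then obtain T where T: "\<And>x. x \<in> top_end W \<Longrightarrow> openin X (T x) \<and> x \<in> T x \<and> (\<forall>y\<in>T x. v y = \<tau> x y)"
    unfolding germ_eq_def by metis
  define K where "K = (\<Union>x\<in>top_end W. G \<inter> T x \<inter> H x)"
  have "openin X (G \<inter> T x \<inter> H x)" if "x \<in> top_end W" for x
    using T[OF that] ch(1)[OF that] tch_open[OF G(1)] tch_open[of "H x" "\<tau> x"] by (intro openin_Int) simp_all
  then have "openin X K" unfolding K_def by (intro openin_Union) auto
  then have K: "tch K v" using tch_subset[OF G(1)] unfolding K_def by blast
  have KE: "\<exists>x\<in>top_end W. y \<in> H x \<and> v y = \<tau> x y" if "y \<in> K" for y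
    using that T unfolding K_def by blast
  have "top_end W \<subseteq> K" using G(2) T ch(2) unfolding K_def by blast
  moreover have "y \<in> W \<and> u y = v y" if y: "y \<in> K" "v y < ?b" for y
  proof -
    obtain x where "x \<in> top_end W" "y \<in> H x" "v y = \<tau> x y" using KE[OF y(1)] by blast
    then show ?thesis using ch(4)[of x y] y(2) by simp
  qed
  moreover have "y \<in> top_end W \<longleftrightarrow> v y = ?b" if y: "y \<in> K" for y
  proof -
    obtain x where "x \<in> top_end W" "y \<in> H x" "v y = \<tau> x y" using KE[OF y] by blast
    then show ?thesis using ch(5)[of x y] by simp
  qed
  moreover have "\<exists>x\<in>top_end W. \<exists>G \<tau>. tch G \<tau> \<and> x \<in> G \<and> (\<forall>z\<in>G. \<tau> x < \<tau> z \<longrightarrow> z \<in> W)"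
    if y: "y \<in> K" "?b < v y" "y \<in> W" for y
  proof -
    obtain x where x: "x \<in> top_end W" "y \<in> H x" "v y = \<tau> x y" using KE[OF y(1)] by blast
    then have "\<forall>z\<in>H x. \<tau> x x < \<tau> x z \<longrightarrow> z \<in> W"
      using ch(3)[OF x(1)] ch(6)[OF x(1,2)] y(2,3) by simp
    then show ?thesis using x(1) ch(1,2)[OF x(1)] by blast
  qed
  ultimately show ?thesis using K by (intro exI[of _ K] exI[of _ v]) blast
qed

end

section \<open>Maximal tubes rising from a given level\<close>

definition (in transverse_affine) upper_tube ::
    "'m set \<Rightarrow> ('m \<Rightarrow> real) \<Rightarrow> 'm set \<Rightarrow> ('m \<Rightarrow> real) \<Rightarrow> bool" where
  "upper_tube W\<^sub>0 u\<^sub>0 W u \<longleftrightarrow> tube W u \<and> (\<forall>y\<in>W\<^sub>0. 0 < u\<^sub>0 y \<longrightarrow> y \<in> W \<and> u y = u\<^sub>0 y) \<and>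
     (\<forall>y\<in>W\<^sub>0. u\<^sub>0 y = 0 \<longrightarrow> y \<notin> W) \<and> (\<forall>y\<in>W. 0 < u y)"

context transverse_affine
begin

lemma tube_cong:
  assumes "tube W u" "\<And>y. y \<in> W \<Longrightarrow> u' y = u y"
  shows "tube W u'"
proof -
  have "tch W u'"
  proof (rule tch_local[OF tubeD(5)[OF assms(1)]])
    fix x assume "x \<in> W"
    then show "\<exists>H \<mu> T. tch H \<mu> \<and> openin X T \<and> x \<in> T \<and> T \<subseteq> H \<and> (\<forall>y\<in>T. u' y = \<mu> y)"
      using tubeD(1,5)[OF assms(1)] assms(2) by (intro exI[of _ W] exI[of _ u]) simp
  qed
  moreover have "u' ` W = u ` W" using assms(2) by force
  moreover have lev: "{y\<in>W. u' y = c} = {y\<in>W. u y = c}" for c using assms(2) by auto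
  moreover have slab: "{y\<in>W. u' y \<in> {c..d}} = {y\<in>W. u y \<in> {c..d}}" for c d using assms(2) by auto
  ultimately show ?thesis using assms(1) unfolding tube_def lev slab by simp
qed

lemma upper_tubeD:
  assumes "upper_tube W\<^sub>0 u\<^sub>0 W u"
  shows "tube W u" "\<And>y. y \<in> W\<^sub>0 \<Longrightarrow> 0 < u\<^sub>0 y \<Longrightarrow> y \<in> W" "\<And>y. y \<in> W\<^sub>0 \<Longrightarrow> 0 < u\<^sub>0 y \<Longrightarrow> u y = u\<^sub>0 y"
    "\<And>y. y \<in> W\<^sub>0 \<Longrightarrow> u\<^sub>0 y = 0 \<Longrightarrow> y \<notin> W" "\<And>y. y \<in> W \<Longrightarrow> 0 < u y"
  using assms unfolding upper_tube_def by auto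

lemma tube_positive_part:
  assumes W: "tube W u"
  shows "tube {y\<in>W. 0 < u y} u"
proof -
  let ?W = "{y\<in>W. 0 < u y}"
  have "openin X ?W" using tch_preimage_open[OF tubeD(1)[OF W], of "{0<..}"] by simp
  then have "tch ?W u" by (rule tch_subset[OF tubeD(1)[OF W]]) blast
  moreover have "connected (u ` ?W)"
  proof -
    have "u ` ?W = {0<..} \<inter> u ` W" by auto
    moreover have "is_interval ({0<..} \<inter> u ` W)"
      using tubeD(2)[OF W] is_interval_oi[of "0::real"]
      by (intro is_interval_Int) (simp_all only: is_interval_connected_1)
    ultimately show ?thesis by (simp only: is_interval_connected_1)
  qed
  moreover have "connectedin X {y\<in>?W. u y = c}" for c
  proof (cases "c > 0")
    case True
    then have eq: "{y\<in>?W. u y = c} = {y\<in>W. u y = c}" by auto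
    show ?thesis unfolding eq by (rule tubeD(3)[OF W])
  next
    case False
    then have none: "{y\<in>?W. u y = c} = {}" by auto
    show ?thesis unfolding none by (rule connectedin_empty)
  qed
  moreover have "closedin X {y\<in>?W. u y \<in> {c..d}}" if cd: "{c..d} \<subseteq> u ` ?W" for c d
  proof (cases "c \<le> d")
    case True
    then have "c \<in> u ` ?W" using cd by auto
    then have "c > 0" by auto
    then have eq: "{y\<in>?W. u y \<in> {c..d}} = {y\<in>W. u y \<in> {c..d}}" by auto
    show ?thesis unfolding eq by (rule tubeD(4)[OF W]) (use cd in auto)
  next
    case False
    then have none: "{y\<in>?W. u y \<in> {c..d}} = {}" by auto
    show ?thesis unfolding none by (rule closedin_empty)
  qed
  ultimately show ?thesis unfolding tube_def by blast
qed

text \<open>An \<open>upper_tube\<close> contains the base tube above level zero but omits level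
  zero itself, so that it can return to this level from below and still be a tube. The positive part
  of the base is the seed of the maximality argument.\<close>

lemma upper_tube_base: "tube W\<^sub>0 u\<^sub>0 \<Longrightarrow> upper_tube W\<^sub>0 u\<^sub>0 {y\<in>W\<^sub>0. 0 < u\<^sub>0 y} u\<^sub>0"
  unfolding upper_tube_def using tube_positive_part by auto

lemma tube_small_values:
  assumes "tube W\<^sub>0 u\<^sub>0" "0 \<in> u\<^sub>0 ` W\<^sub>0"
  obtains e where "0 < e" "{-e..e} \<subseteq> u\<^sub>0 ` W\<^sub>0"
proof -
  obtain e where "0 < e" "cball 0 e \<subseteq> u\<^sub>0 ` W\<^sub>0"
    using tubeD(6)[OF assms(1)] assms(2) open_contains_cball by blast
  then show ?thesis using that[of e] by (simp add: cball_eq_atLeastAtMost)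
qed

text \<open>A compact interval of attained values is already attained by one member of the chain,
  and levels do not grow with the tube, so levels and slabs of the union are those of a single
  member.\<close>

lemma upper_tube_Union:
  assumes W0: "tube W\<^sub>0 u\<^sub>0" "0 \<in> u\<^sub>0 ` W\<^sub>0" and ne: "\<W> \<noteq> {}"
    and chain: "\<And>V W. V \<in> \<W> \<Longrightarrow> W \<in> \<W> \<Longrightarrow> V \<subseteq> W \<or> W \<subseteq> V"
    and tub: "\<And>W. W \<in> \<W> \<Longrightarrow> upper_tube W\<^sub>0 u\<^sub>0 W u"
  shows "upper_tube W\<^sub>0 u\<^sub>0 (\<Union>\<W>) u"
proof -
  note T = upper_tubeD[OF tub]
  have "tch (\<Union>\<W>) u"
  proof (rule tch_local)
    show "openin X (\<Union>\<W>)" using tubeD(5)[OF T(1)] by (rule openin_Union)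
    fix x assume "x \<in> \<Union>\<W>"
    then obtain W where "W \<in> \<W>" "x \<in> W" by blast
    then show "\<exists>H \<mu> T. tch H \<mu> \<and> openin X T \<and> x \<in> T \<and> T \<subseteq> H \<and> (\<forall>y\<in>T. u y = \<mu> y)"
      using tubeD(1,5)[OF T(1)] by (intro exI[of _ W] exI[of _ u]) simp
  qed
  moreover have "connected (u ` \<Union>\<W>)"
  proof -
    \<comment> \<open>A small positive value of the base tube is attained by every member, which
      ties their images together.\<close>
    obtain e where e: "0 < e" "{-e..e} \<subseteq> u\<^sub>0 ` W\<^sub>0" by (rule tube_small_values[OF W0])
    then have "e \<in> u\<^sub>0 ` W\<^sub>0" by (simp add: subset_iff)
    then have "e \<in> u ` W" if "W \<in> \<W>" for W using T(2,3)[OF that] e(1) by force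
    then have "(\<Inter>W\<in>\<W>. u ` W) \<noteq> {}" by blast
    then have "connected (\<Union>W\<in>\<W>. u ` W)" using tubeD(2)[OF T(1)] by (intro connected_Union) blast+
    then show ?thesis by (simp add: image_Union)
  qed
  moreover have lev: "{y\<in>\<Union>\<W>. u y = c} = {y\<in>W. u y = c}" if W: "W \<in> \<W>" "c \<in> u ` W" for W c
  proof
    show "{y\<in>\<Union>\<W>. u y = c} \<subseteq> {y\<in>W. u y = c}"
    proof
      fix y assume "y \<in> {y\<in>\<Union>\<W>. u y = c}"
      then obtain V where V: "V \<in> \<W>" "y \<in> V" "u y = c" by blast
      show "y \<in> {y\<in>W. u y = c}"
      proof (cases "V \<subseteq> W")
        case False
        then have "W \<subseteq> V" using chain V(1) W(1) by blast
        then have "{y\<in>V. u y = c} = {y\<in>W. u y = c}"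
          using tube_sub_level[OF T(1)[OF W(1)] T(1)[OF V(1)] _ refl W(2)] by blast
        then show ?thesis using V by blast
      qed (use V in auto)
    qed
  qed (use W in auto)
  then have "connectedin X {y\<in>\<Union>\<W>. u y = c}" for c
  proof (cases "c \<in> u ` \<Union>\<W>")
    case True
    then obtain W where W: "W \<in> \<W>" "c \<in> u ` W" by blast
    show ?thesis unfolding lev[OF W] by (rule tubeD(3)[OF T(1)[OF W(1)]])
  next
    case False
    then have none: "{y\<in>\<Union>\<W>. u y = c} = {}" by blast
    show ?thesis unfolding none by (rule connectedin_empty)
  qed
  moreover have "closedin X {y\<in>\<Union>\<W>. u y \<in> {c..d}}" if cd: "{c..d} \<subseteq> u ` \<Union>\<W>" for c d
  proof (cases "c \<le> d")
    case True
    then have "c \<in> u ` \<Union>\<W>" "d \<in> u ` \<Union>\<W>" using cd by auto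
    then obtain V V' where V: "V \<in> \<W>" "c \<in> u ` V" "V' \<in> \<W>" "d \<in> u ` V'" by blast
    have "\<exists>W\<in>\<W>. c \<in> u ` W \<and> d \<in> u ` W" using chain[OF V(1,3)] V by blast
    then obtain W where W: "W \<in> \<W>" "c \<in> u ` W" "d \<in> u ` W" by blast
    have sub: "{c..d} \<subseteq> u ` W"
      using connected_contains_Icc[OF tubeD(2)[OF T(1)[OF W(1)]] W(2,3)] .
    have "{y\<in>\<Union>\<W>. u y \<in> {c..d}} = {y\<in>W. u y \<in> {c..d}}"
    proof (intro set_eqI iffI)
      fix y assume y: "y \<in> {y\<in>\<Union>\<W>. u y \<in> {c..d}}"
      then have "u y \<in> u ` W" using sub by blast
      then have "{z\<in>\<Union>\<W>. u z = u y} = {z\<in>W. u z = u y}" by (rule lev[OF W(1)])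
      then show "y \<in> {y\<in>W. u y \<in> {c..d}}" using y by blast
    qed (use W in auto)
    then show ?thesis using tube_slab_closed[OF T(1)[OF W(1)] W(2,3)] by simp
  next
    case False
    then have none: "{y\<in>\<Union>\<W>. u y \<in> {c..d}} = {}" by auto
    show ?thesis unfolding none by (rule closedin_empty)
  qed
  ultimately have "tube (\<Union>\<W>) u" unfolding tube_def by blast
  then show ?thesis unfolding upper_tube_def using T(2-5) ne by blast
qed

lemma upper_tube_cong:
  assumes "upper_tube W\<^sub>0 u\<^sub>0 W u" "\<And>y. y \<in> W \<Longrightarrow> u' y = u y"
  shows "upper_tube W\<^sub>0 u\<^sub>0 W u'"
proof -
  have "tube W u'" by (rule tube_cong[OF upper_tubeD(1)[OF assms(1)] assms(2)])
  then show ?thesis using assms unfolding upper_tube_def by auto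
qed

text \<open>Zorn's lemma is applied to graphs: inclusion of graphs says at once that the domain
  grows and that the function is kept.\<close>

lemma maximal_upper_tube:
  assumes W0: "tube W\<^sub>0 u\<^sub>0" "0 \<in> u\<^sub>0 ` W\<^sub>0"
  shows "\<exists>W u. upper_tube W\<^sub>0 u\<^sub>0 W u \<and>
    (\<forall>W' u'. upper_tube W\<^sub>0 u\<^sub>0 W' u' \<longrightarrow> W \<subseteq> W' \<longrightarrow> (\<forall>y\<in>W. u' y = u y) \<longrightarrow> W' = W)"
proof -
  define gr :: "'m set \<Rightarrow> ('m \<Rightarrow> real) \<Rightarrow> ('m \<times> real) set" where "gr W u = (\<lambda>y. (y, u y)) ` W" for W u
  define \<A> where "\<A> = {gr W u |W u. upper_tube W\<^sub>0 u\<^sub>0 W u}"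
  have gr_fst: "fst ` gr W u = W" for W u unfolding gr_def by force
  have "\<exists>M\<in>\<A>. \<forall>Y\<in>\<A>. M \<subseteq> Y \<longrightarrow> Y = M"
  proof (rule subset_Zorn_nonempty)
    show "\<A> \<noteq> {}" unfolding \<A>_def using upper_tube_base[OF W0(1)] by blast
    fix \<C> assume C: "\<C> \<noteq> {}" "subset.chain \<A> \<C>"
    have C\<A>: "\<exists>W u. upper_tube W\<^sub>0 u\<^sub>0 W u \<and> \<Gamma> = gr W u" if "\<Gamma> \<in> \<C>" for \<Gamma>
      using that C(2) unfolding subset.chain_def \<A>_def by blast
    have lin: "\<Gamma> \<subseteq> \<Delta> \<or> \<Delta> \<subseteq> \<Gamma>" if "\<Gamma> \<in> \<C>" "\<Delta> \<in> \<C>" for \<Gamma> \<Delta>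
      using that C(2) unfolding subset_chain_def by blast
    have single: "v = w" if vw: "(y, v) \<in> \<Union>\<C>" "(y, w) \<in> \<Union>\<C>" for y v w
    proof -
      obtain \<Gamma> \<Delta> where *: "\<Gamma> \<in> \<C>" "(y, v) \<in> \<Gamma>" "\<Delta> \<in> \<C>" "(y, w) \<in> \<Delta>" using vw by blast
      obtain \<Lambda> where "\<Lambda> \<in> \<C>" "(y, v) \<in> \<Lambda>" "(y, w) \<in> \<Lambda>" using lin[OF *(1,3)] * by blast
      then show ?thesis using C\<A>[of \<Lambda>] unfolding gr_def by blast
    qed
    \<comment> \<open>The union of a chain of graphs is single valued, so this choice recovers the
      function with that graph; its values elsewhere do not matter.\<close>
    define u where "u y = (SOME v. (y, v) \<in> \<Union>\<C>)" for y
    have u: "u y = v" if "(y, v) \<in> \<Union>\<C>" for y v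
      using single[OF _ that] someI[of "\<lambda>v. (y, v) \<in> \<Union>\<C>", OF that] unfolding u_def by blast
    have ut: "upper_tube W\<^sub>0 u\<^sub>0 (fst ` \<Gamma>) u" and gru: "gr (fst ` \<Gamma>) u = \<Gamma>" if \<Gamma>: "\<Gamma> \<in> \<C>" for \<Gamma>
    proof -
      obtain W w where W: "upper_tube W\<^sub>0 u\<^sub>0 W w" "\<Gamma> = gr W w" using C\<A>[OF \<Gamma>] by blast
      have eq: "u y = w y" if "y \<in> W" for y
        by (rule u) (use that W(2) \<Gamma> in \<open>auto simp: gr_def\<close>)
      show "upper_tube W\<^sub>0 u\<^sub>0 (fst ` \<Gamma>) u"
        unfolding W(2) gr_fst by (rule upper_tube_cong[OF W(1) eq])
      show "gr (fst ` \<Gamma>) u = \<Gamma>" unfolding W(2) gr_fst using eq unfolding gr_def by simp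
    qed
    have "upper_tube W\<^sub>0 u\<^sub>0 (\<Union>((`) fst ` \<C>)) u"
    proof (rule upper_tube_Union[OF W0])
      show "(`) fst ` \<C> \<noteq> {}" using C(1) by blast
      fix V W assume "V \<in> (`) fst ` \<C>" "W \<in> (`) fst ` \<C>"
      then obtain \<Gamma> \<Delta> where "\<Gamma> \<in> \<C>" "\<Delta> \<in> \<C>" "V = fst ` \<Gamma>" "W = fst ` \<Delta>" by blast
      then show "V \<subseteq> W \<or> W \<subseteq> V" using lin[of \<Gamma> \<Delta>] image_mono by blast
    qed (use ut in auto)
    moreover have "gr (\<Union>((`) fst ` \<C>)) u = \<Union>\<C>"
    proof -
      have "gr (\<Union>((`) fst ` \<C>)) u = (\<Union>\<Gamma>\<in>\<C>. gr (fst ` \<Gamma>) u)" unfolding gr_def by blast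
      then show ?thesis using gru by simp
    qed
    ultimately show "\<Union>\<C> \<in> \<A>" unfolding \<A>_def by blast
  qed
  then obtain W u where W: "upper_tube W\<^sub>0 u\<^sub>0 W u" "\<forall>Y\<in>\<A>. gr W u \<subseteq> Y \<longrightarrow> Y = gr W u"
    unfolding \<A>_def by blast
  have "W' = W" if W': "upper_tube W\<^sub>0 u\<^sub>0 W' u'" "W \<subseteq> W'" "\<forall>y\<in>W. u' y = u y" for W' u'
  proof -
    have "gr W' u' \<in> \<A>" unfolding \<A>_def using W'(1) by blast
    moreover have "gr W u \<subseteq> gr W' u'" unfolding gr_def using W'(2,3) by auto
    ultimately have "gr W' u' = gr W u" using W(2) by blast
    then have "fst ` gr W' u' = fst ` gr W u" by simp
    then show ?thesis unfolding gr_fst .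
  qed
  then show ?thesis using W(1) by blast
qed

text \<open>Just above \<open>x\<close> the function \<open>u\<close> takes values below a small
  level \<open>e\<close> of the base tube. Levels of \<open>W\<close> between 0 and \<open>e\<close>
  lie in the base tube, whose slab over \<open>{0..e}\<close> is closed and so contains
  \<open>x\<close>; a positive base value at \<open>x\<close> would put \<open>x\<close> into
  \<open>W\<close>.\<close>

lemma upper_tube_bottom:
  assumes W0: "tube W\<^sub>0 u\<^sub>0" "0 \<in> u\<^sub>0 ` W\<^sub>0" and W: "upper_tube W\<^sub>0 u\<^sub>0 W u"
    and H: "tch H \<tau>" "x \<in> H" "x \<notin> W" "\<forall>y\<in>H. \<tau> x < \<tau> y \<longrightarrow> y \<in> W"
  shows "x \<in> W\<^sub>0 \<and> u\<^sub>0 x = 0"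
proof -
  note T = upper_tubeD[OF W]
  obtain G \<epsilon> \<sigma> where B: "box X H \<tau> x G \<epsilon> \<sigma>"
    using box_exists[OF H(1,2) tch_open[OF H(1)] H(2)] by (elim exE conjE)
  have G: "G \<subseteq> H" "\<epsilon> > 0" "\<sigma> (\<tau> x) = x" using B unfolding box_def by auto
  then have up: "\<forall>y\<in>G. \<tau> x < \<tau> y \<longrightarrow> y \<in> W" using H(4) by blast
  obtain \<alpha> \<beta> where \<alpha>: "\<alpha> > 0" "\<forall>y\<in>G. \<tau> x < \<tau> y \<longrightarrow> u y = \<alpha> * \<tau> y + \<beta>"
      "\<forall>c\<in>u ` W. \<alpha> * \<tau> x + \<beta> < c"
    using upper_side_affine[OF T(1) H(1) B H(3) up] by (elim exE conjE)
  obtain e where e: "0 < e" "{-e..e} \<subseteq> u\<^sub>0 ` W\<^sub>0" by (rule tube_small_values[OF W0])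
  have e0: "e \<in> u\<^sub>0 ` W\<^sub>0" using e by (simp add: subset_iff)
  then have "e \<in> u ` W" using T(2,3) e(1) by force
  then have "\<alpha> * \<tau> x + \<beta> < e" using \<alpha>(3) by blast
  then have lt: "\<tau> x < (e - \<beta>) / \<alpha>" using \<alpha>(1) by (simp add: field_simps)
  have "\<sigma> (\<tau> x) \<in> {y\<in>W\<^sub>0. u\<^sub>0 y \<in> {0..e}}"
  proof (rule box_transversal_limit[OF B tube_slab_closed[OF W0(1,2) e0]])
    show "\<tau> x \<in> {\<tau> x - \<epsilon><..<\<tau> x + \<epsilon>}" using G(2) by auto
    fix \<delta> :: real assume "\<delta> > 0"
    then have "\<tau> x < min (min (\<tau> x + \<delta>) (\<tau> x + \<epsilon>)) ((e - \<beta>) / \<alpha>)" using lt G(2) by auto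
    then obtain t where "\<tau> x < t" "t < min (min (\<tau> x + \<delta>) (\<tau> x + \<epsilon>)) ((e - \<beta>) / \<alpha>)" using dense by blast
    then have t: "\<tau> x < t" "t < \<tau> x + \<delta>" "t < \<tau> x + \<epsilon>" "t < (e - \<beta>) / \<alpha>" by auto
    have \<sigma>: "\<sigma> t \<in> G" "\<tau> (\<sigma> t) = t" using B t(1,3) unfolding box_def by auto
    then have uW: "\<sigma> t \<in> W" "u (\<sigma> t) = \<alpha> * t + \<beta>" using up \<alpha>(2) t(1) by auto
    have "0 < u (\<sigma> t)" by (rule T(5)[OF uW(1)])
    moreover have "u (\<sigma> t) < e" unfolding uW(2) using t(4) \<alpha>(1) by (simp add: field_simps)
    ultimately have pos: "0 < u (\<sigma> t)" "u (\<sigma> t) < e" .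
    then have "u (\<sigma> t) \<in> {-e..e}" by auto
    then have img: "u (\<sigma> t) \<in> u\<^sub>0 ` {y\<in>W\<^sub>0. 0 < u\<^sub>0 y}" using e(2) pos(1) by (smt (verit) image_iff mem_Collect_eq subsetD)
    \<comment> \<open>A positive level of the base tube acquires no new points in \<open>W\<close>,
      so the point on the transversal lies in the base tube.\<close>
    have "{y\<in>W. u y = u (\<sigma> t)} = {y \<in> {y\<in>W\<^sub>0. 0 < u\<^sub>0 y}. u\<^sub>0 y = u (\<sigma> t)}"
      by (rule tube_sub_level[OF tube_positive_part[OF W0(1)] T(1) _ _ img]) (use T(2,3) in auto)
    then have "\<sigma> t \<in> {y \<in> {y\<in>W\<^sub>0. 0 < u\<^sub>0 y}. u\<^sub>0 y = u (\<sigma> t)}" using uW(1) by blast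
    then have "\<sigma> t \<in> {y\<in>W\<^sub>0. u\<^sub>0 y \<in> {0..e}}" using pos by auto
    then show "\<exists>t\<in>{\<tau> x - \<epsilon><..<\<tau> x + \<epsilon>}. \<bar>t - \<tau> x\<bar> < \<delta> \<and> \<sigma> t \<in> {y\<in>W\<^sub>0. u\<^sub>0 y \<in> {0..e}}"
      using t by (intro bexI[of _ t]) auto
  qed
  then have "x \<in> W\<^sub>0" "0 \<le> u\<^sub>0 x" unfolding G(3) by auto
  then show ?thesis using T(2)[of x] H(3) by force
qed

text \<open>A tube that ends away from the level it started from extends across its upper end.\<close>

lemma maximal_upper_tube_returns:
  assumes W0: "tube W\<^sub>0 u\<^sub>0" "0 \<in> u\<^sub>0 ` W\<^sub>0" and W: "upper_tube W\<^sub>0 u\<^sub>0 W u"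
    and max: "\<forall>W' u'. upper_tube W\<^sub>0 u\<^sub>0 W' u' \<longrightarrow> W \<subseteq> W' \<longrightarrow> (\<forall>y\<in>W. u' y = u y) \<longrightarrow> W' = W"
  shows "\<exists>x\<in>top_end W. x \<in> W\<^sub>0 \<and> u\<^sub>0 x = 0"
proof (rule ccontr)
  assume away: "\<not> ?thesis"
  note T = upper_tubeD[OF W]
  define b where "b = Sup (u ` W)"
  define K where "K = {y\<in>W\<^sub>0. u\<^sub>0 y = 0}"
  obtain e where e: "0 < e" "{-e..e} \<subseteq> u\<^sub>0 ` W\<^sub>0" by (rule tube_small_values[OF W0])
  have "e \<in> u\<^sub>0 ` W\<^sub>0" using e by (simp add: subset_iff)
  then have ne: "W \<noteq> {}" using T(2) e(1) by force
  obtain x where x: "x \<in> top_end W" using top_end_nonempty[OF T(1) ne] by blast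
  have ltb: "\<forall>c\<in>u ` W. c < b" using top_chart[OF T(1) x] unfolding b_def by (elim exE conjE)
  obtain H v where H: "tch H v" "top_end W \<subseteq> H" "\<forall>y\<in>H. v y < b \<longrightarrow> y \<in> W \<and> u y = v y"
      "\<forall>y\<in>H. y \<in> top_end W \<longleftrightarrow> v y = b"
      "\<forall>y\<in>H. b < v y \<longrightarrow> y \<in> W \<longrightarrow>
       (\<exists>x\<in>top_end W. \<exists>G \<tau>. tch G \<tau> \<and> x \<in> G \<and> (\<forall>z\<in>G. \<tau> x < \<tau> z \<longrightarrow> z \<in> W))"
    using top_collar[OF T(1) ne] unfolding b_def by (elim exE conjE)
  have "closedin X K" unfolding K_def by (rule tube_level_closed[OF W0])
  then have V: "openin X (topspace X - K)" by blast
  have eq: "top_end W = {y\<in>H. v y = b}" using H(2,4) by blast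
  have "top_end W \<subseteq> topspace X - K" using away top_endD(1) unfolding K_def by blast
  \<comment> \<open>The end is a compact connected level of \<open>v\<close>. The tube around it is
    kept off level zero of the base, so that the extension is again an upper tube.\<close>
  from tube_around[OF H(1) V eq top_end_closed[OF T(1)] top_end_connected[OF T(1) ne]
      top_end_nonempty[OF T(1) ne] this]
  obtain W' \<delta> where W': "0 < \<delta>" "tube W' v" "top_end W \<subseteq> W'" "W' \<subseteq> H \<inter> (topspace X - K)"
      "v ` W' = {b - \<delta><..<b + \<delta>}"
    by (elim exE conjE)
  have low: "y \<in> W" "u y = v y" if "y \<in> W'" "v y < b" for y using that W'(4) H(3) by auto
  \<comment> \<open>Points of \<open>W\<close> just above the end would give an end point with
    \<open>W\<close> above it; such a point lies on level zero of the base, which the end is assumed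
    to avoid.\<close>
  have high: "v y < b" "u y = v y" if y: "y \<in> W'" "y \<in> W" for y
  proof -
    have "v y \<noteq> b" using H(4) W'(4) y top_endD(2) by blast
    moreover have "\<not> b < v y"
    proof
      assume "b < v y"
      then obtain x G \<tau> where x: "x \<in> top_end W" "tch G \<tau>" "x \<in> G" "\<forall>z\<in>G. \<tau> x < \<tau> z \<longrightarrow> z \<in> W"
        using H(5) W'(4) y by blast
      then have "x \<in> W\<^sub>0 \<and> u\<^sub>0 x = 0" using upper_tube_bottom[OF W0 W x(2,3) _ x(4)] top_endD(2) by blast
      then show False using away x(1) by blast
    qed
    ultimately show "v y < b" by simp
    then show "u y = v y" using low y by blast
  qed
  define w where "w y = (if y \<in> W then u y else v y)" for y
  define Z where "Z = W \<union> W'"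
  have wW: "w y = u y" if "y \<in> W" for y using that unfolding w_def by simp
  have wW': "w y = v y" if "y \<in> W'" for y using that high unfolding w_def by simp
  have img: "w ` Z = u ` W \<union> {b - \<delta><..<b + \<delta>}"
    unfolding Z_def image_Un W'(5)[symmetric] using wW wW' by simp
  have below: "c \<in> u ` W" if c: "c \<in> w ` Z" "c < b" for c
  proof (cases "c \<in> u ` W")
    case False
    then have "c \<in> v ` W'" using c(1) img W'(5) by blast
    then obtain y where y: "y \<in> W'" "c = v y" by blast
    then have "y \<in> W" "u y = c" using low[of y] c(2) by auto
    then show ?thesis by blast
  qed
  have above: "c \<in> v ` W'" if "c \<in> w ` Z" "b \<le> c" for c
  proof -
    have "c \<notin> u ` W" using ltb that(2) by (meson not_le)
    then show ?thesis using that(1) img W'(5) by blast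
  qed
  have tchZ: "tch Z w"
  proof (rule tch_local)
    show "openin X Z" unfolding Z_def using tubeD(5)[OF T(1)] tubeD(5)[OF W'(2)] by (rule openin_Un)
    fix y assume "y \<in> Z"
    then consider "y \<in> W" | "y \<in> W'" unfolding Z_def by blast
    then show "\<exists>H \<mu> T. tch H \<mu> \<and> openin X T \<and> y \<in> T \<and> T \<subseteq> H \<and> (\<forall>y\<in>T. w y = \<mu> y)"
    proof cases
      case 1
      then show ?thesis using tubeD(1,5)[OF T(1)] wW by (intro exI[of _ W] exI[of _ u]) simp
    next
      case 2
      then show ?thesis using tubeD(1,5)[OF W'(2)] wW' by (intro exI[of _ W'] exI[of _ v]) simp
    qed
  qed
  have conn: "connected (w ` Z)"
  proof -
    have "b - \<delta> / 2 \<in> v ` W'" using W'(1,5) by auto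
    then obtain y where y: "y \<in> W'" "v y = b - \<delta> / 2" by auto
    then have "y \<in> W" "u y = b - \<delta> / 2" using low[of y] W'(1) by auto
    then have "b - \<delta> / 2 \<in> u ` W \<inter> {b - \<delta><..<b + \<delta>}" using W'(1) by force
    then show ?thesis unfolding img using tubeD(2)[OF T(1)] by (intro connected_Un) auto
  qed
  have lev: "connectedin X {y\<in>Z. w y = c}" for c
  proof (cases "c < b")
    case True
    have "{y\<in>Z. w y = c} = {y\<in>W. u y = c}"
      using low wW' wW True unfolding Z_def by auto
    then show ?thesis using tubeD(3)[OF T(1), of c] by simp
  next
    case False
    have "u y < b" if "y \<in> W" for y using ltb that by blast
    then have "{y\<in>Z. w y = c} = {y\<in>W'. v y = c}"
      using False wW' wW unfolding Z_def by fastforce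
    then show ?thesis using tubeD(3)[OF W'(2), of c] by simp
  qed
  have slab: "closedin X {y\<in>Z. w y \<in> {c..d}}" if cd: "{c..d} \<subseteq> w ` Z" for c d
  proof -
    consider "c > d" | "c \<le> d" "d < b" | "c \<le> d" "b \<le> d" by linarith
    then show ?thesis
    proof cases
      case 1
      then have none: "{y\<in>Z. w y \<in> {c..d}} = {}" by auto
      show ?thesis unfolding none by (rule closedin_empty)
    next
      case 2
      have "c \<in> u ` W" "d \<in> u ` W" by (rule below; use cd 2 in auto)+
      moreover have "{y\<in>Z. w y \<in> {c..d}} = {y\<in>W. u y \<in> {c..d}}"
        using low wW' wW 2(2) unfolding Z_def by auto
      ultimately show ?thesis using tube_slab_closed[OF T(1)] by simp
    next
      case 3
      have dW': "d \<in> v ` W'" by (rule above) (use cd 3 in auto)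
      \<comment> \<open>Beyond the value \<open>c0\<close> the tube \<open>W\<close> lies inside
        \<open>W'\<close>. A slab across the end can therefore be cut at a value \<open>r\<close>
        slightly below \<open>b\<close> into a closed slab of \<open>W\<close> and a closed slab of
        \<open>W'\<close>.\<close>
      obtain c0 where c0: "c0 \<in> u ` W" "\<forall>y\<in>W. c0 \<le> u y \<longrightarrow> y \<in> W'"
        using near_top_end[OF T(1) ne tubeD(5)[OF W'(2)] W'(3)] by blast
      have c1: "b - \<delta> / 2 \<in> u ` W" by (rule below) (use img W'(1) in auto)
      define r where "r = max c0 (b - \<delta> / 2)"
      have r: "r \<in> u ` W" "c0 \<le> r" "b - \<delta> < r" "r < b"
        using c0(1) c1 W'(1) ltb unfolding r_def by (auto simp: max_def)
      have eq: "{y\<in>Z. w y \<in> {c..d}} = {y\<in>W. u y \<in> {c..r}} \<union> {y\<in>W'. v y \<in> {max c r..d}}"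
      proof (intro set_eqI iffI)
        fix y assume y: "y \<in> {y\<in>Z. w y \<in> {c..d}}"
        show "y \<in> {y\<in>W. u y \<in> {c..r}} \<union> {y\<in>W'. v y \<in> {max c r..d}}"
        proof (cases "y \<in> W")
          case True
          show ?thesis
          proof (cases "u y \<le> r")
            case False
            then have "y \<in> W'" using c0(2) True r(2) by auto
            then show ?thesis using y False wW[OF True] wW'[of y] by auto
          qed (use y True wW in auto)
        next
          case False
          then have yW': "y \<in> W'" using y unfolding Z_def by blast
          then have "b \<le> v y" using low(1)[of y] False by force
          then show ?thesis using y yW' wW'[of y] r(4) by auto
        qed
      next
        fix y assume "y \<in> {y\<in>W. u y \<in> {c..r}} \<union> {y\<in>W'. v y \<in> {max c r..d}}"
        then show "y \<in> {y\<in>Z. w y \<in> {c..d}}" using wW wW' r(4) 3 unfolding Z_def by auto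
      qed
      have "closedin X {y\<in>W. u y \<in> {c..r}}"
      proof (cases "c \<le> r")
        case True
        have "c \<in> u ` W" by (rule below) (use cd 3 True r in auto)
        then show ?thesis using tube_slab_closed[OF T(1) _ r(1)] by blast
      next
        case False
        then have none: "{y\<in>W. u y \<in> {c..r}} = {}" by auto
        show ?thesis unfolding none by (rule closedin_empty)
      qed
      moreover have "max c r \<in> v ` W'"
        using r 3 dW' W'(5) by (auto simp: max_def)
      then have "closedin X {y\<in>W'. v y \<in> {max c r..d}}" using tube_slab_closed[OF W'(2) _ dW'] by blast
      ultimately show ?thesis unfolding eq by (rule closedin_Un)
    qed
  qed
  have "tube Z w" unfolding tube_def using tchZ conn lev slab by blast
  moreover have "0 < w y" if "y \<in> Z" for y
  proof (cases "y \<in> W")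
    case False
    then have "y \<in> W'" "b \<le> v y" using that low(1)[of y] unfolding Z_def by force+
    moreover obtain z where "z \<in> W" using ne by blast
    then have "0 < b" using T(5)[of z] ltb by force
    ultimately show ?thesis using wW' by simp
  qed (use wW T(5) in simp)
  moreover have "y \<notin> Z" if "y \<in> W\<^sub>0" "u\<^sub>0 y = 0" for y
    using that T(4) W'(4) unfolding Z_def K_def by blast
  ultimately have "upper_tube W\<^sub>0 u\<^sub>0 Z w"
    unfolding upper_tube_def using T(2,3) wW unfolding Z_def by simp
  moreover have "W \<subseteq> Z" "\<forall>y\<in>W. w y = u y" using wW unfolding Z_def by auto
  ultimately have "Z = W" using max by blast
  then have "top_end W \<subseteq> W" using W'(3) unfolding Z_def by blast
  then show False using x top_endD(2) by blast
qed

text \<open>The upper end meets level zero \<open>K\<close>, and near a common point both are the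
  middle plaque of one box, so the two closed connected sets coincide. Then \<open>W\<close> and
  \<open>K\<close> together are open, and any further point has a box missing them, so they form a
  clopen set. The number \<open>r\<close> is the slope at \<open>K\<close> of the chart continuing
  \<open>u\<close> relative to \<open>u\<^sub>0\<close>.\<close>

lemma tube_exhausts:
  assumes W0: "tube W\<^sub>0 u\<^sub>0" "0 \<in> u\<^sub>0 ` W\<^sub>0" and K: "K = {y\<in>W\<^sub>0. u\<^sub>0 y = 0}"
  shows "\<exists>W u b r. 0 < b \<and> 0 < r \<and> tube W u \<and> u ` W = {0<..<b} \<and> topspace X = W \<union> K \<and> W \<inter> K = {} \<and>
    (\<forall>y\<in>W\<^sub>0. 0 < u\<^sub>0 y \<longrightarrow> y \<in> W \<and> u y = u\<^sub>0 y) \<and>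
    (\<forall>x\<in>K. \<exists>T. openin X T \<and> x \<in> T \<and> T \<subseteq> W\<^sub>0 \<and> (\<forall>y\<in>T. u\<^sub>0 y < 0 \<longrightarrow> y \<in> W \<and> u y = r * u\<^sub>0 y + b))"
proof -
  obtain W u where W: "upper_tube W\<^sub>0 u\<^sub>0 W u"
    and max: "\<forall>W' u'. upper_tube W\<^sub>0 u\<^sub>0 W' u' \<longrightarrow> W \<subseteq> W' \<longrightarrow> (\<forall>y\<in>W. u' y = u y) \<longrightarrow> W' = W"
    using maximal_upper_tube[OF W0] by (elim exE conjE)
  note T = upper_tubeD[OF W]
  obtain x1 where x1: "x1 \<in> top_end W" "x1 \<in> K"
    using maximal_upper_tube_returns[OF W0 W max] K by blast
  obtain e where e: "0 < e" "{-e..e} \<subseteq> u\<^sub>0 ` W\<^sub>0" by (rule tube_small_values[OF W0])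
  have "e \<in> u\<^sub>0 ` W\<^sub>0" using e by (simp add: subset_iff)
  then have ne: "W \<noteq> {}" using T(2) e(1) by force
  note W0' = tubeD(1)[OF W0(1)]
  have Kcl: "closedin X K" "connectedin X K"
    unfolding K using tube_level_closed[OF W0] tubeD(3)[OF W0(1)] by auto
  have nbhd: "\<exists>G. openin X G \<and> x \<in> G \<and> G \<subseteq> W\<^sub>0 \<and> G \<inter> top_end W = G \<inter> K \<and> (\<forall>y\<in>G. u\<^sub>0 y < 0 \<longrightarrow> y \<in> W)"
    if x: "x \<in> top_end W" "x \<in> K" for x
  proof -
    have xW: "x \<in> W\<^sub>0" "u\<^sub>0 x = 0" "x \<notin> W" using x K top_endD(2) by auto
    obtain G \<epsilon> \<sigma> where B: "box X W\<^sub>0 u\<^sub>0 x G \<epsilon> \<sigma>"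
      and 1: "\<forall>y\<in>G. u\<^sub>0 y = u\<^sub>0 x \<longrightarrow> y \<notin> W"
        "(\<forall>y\<in>G. u\<^sub>0 y < u\<^sub>0 x \<longrightarrow> y \<in> W) \<or> (\<forall>y\<in>G. u\<^sub>0 y < u\<^sub>0 x \<longrightarrow> y \<notin> W)"
        "(\<forall>y\<in>G. u\<^sub>0 x < u\<^sub>0 y \<longrightarrow> y \<in> W) \<or> (\<forall>y\<in>G. u\<^sub>0 x < u\<^sub>0 y \<longrightarrow> y \<notin> W)"
      using boundary_box[OF T(1) W0' xW(1,3) tubeD(5)[OF W0(1)] xW(1)] by (elim exE conjE)
    have G: "openin X G" "x \<in> G" "G \<subseteq> W\<^sub>0" using B unfolding box_def by auto
    note iff = boundary_box_top_end[OF T(1) W0' B 1]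
    have low: "\<forall>y\<in>G. u\<^sub>0 y < u\<^sub>0 x \<longrightarrow> y \<in> W" using iff[OF G(2)] x(1) by blast
    have "G \<inter> top_end W = G \<inter> K" using iff low xW(2) G(3) unfolding K by auto
    then show ?thesis using G low xW(2) by (intro exI[of _ G]) simp
  qed
  have "top_end W \<subseteq> K"
  proof (rule connectedin_subset_closedin[OF top_end_connected[OF T(1) ne] Kcl(1)])
    show "top_end W \<inter> K \<noteq> {}" using x1 by blast
    fix x assume "x \<in> top_end W \<inter> K"
    then show "\<exists>T. openin X T \<and> x \<in> T \<and> top_end W \<inter> T \<subseteq> K" using nbhd[of x] by blast
  qed
  moreover have "K \<subseteq> top_end W"
  proof (rule connectedin_subset_closedin[OF Kcl(2) top_end_closed[OF T(1)]])
    show "K \<inter> top_end W \<noteq> {}" using x1 by blast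
    fix x assume "x \<in> K \<inter> top_end W"
    then show "\<exists>T. openin X T \<and> x \<in> T \<and> K \<inter> T \<subseteq> top_end W" using nbhd[of x] by blast
  qed
  ultimately have top: "top_end W = K" by blast
  have WK: "W \<inter> K = {}" using T(4) unfolding K by blast
  have all: "topspace X = W \<union> K"
  proof -
    have "openin X (W \<union> K)"
    proof (subst openin_subopen, intro ballI)
      fix x assume x: "x \<in> W \<union> K"
      show "\<exists>T. openin X T \<and> x \<in> T \<and> T \<subseteq> W \<union> K"
      proof (cases "x \<in> W")
        case False
        then obtain G where G: "openin X G" "x \<in> G" "G \<subseteq> W\<^sub>0" "\<forall>y\<in>G. u\<^sub>0 y < 0 \<longrightarrow> y \<in> W"
          using nbhd[of x] x top by blast
        have "y \<in> W \<union> K" if "y \<in> G" for y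
          using G(3,4) that T(2)[of y] unfolding K by (cases "u\<^sub>0 y" "0::real" rule: linorder_cases) auto
        then show ?thesis using G(1,2) by blast
      qed (use tubeD(5)[OF T(1)] in blast)
    qed
    moreover have "openin X (topspace X - (W \<union> K))"
    proof (subst openin_subopen, intro ballI)
      fix x assume x: "x \<in> topspace X - (W \<union> K)"
      then have xW: "x \<notin> W" by blast
      obtain H \<tau> where H: "tch H \<tau>" "x \<in> H" using tch_exists x by blast
      obtain G \<epsilon> \<sigma> where B: "box X H \<tau> x G \<epsilon> \<sigma>"
        and 1: "\<forall>y\<in>G. \<tau> y = \<tau> x \<longrightarrow> y \<notin> W"
          "(\<forall>y\<in>G. \<tau> y < \<tau> x \<longrightarrow> y \<in> W) \<or> (\<forall>y\<in>G. \<tau> y < \<tau> x \<longrightarrow> y \<notin> W)"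
          "(\<forall>y\<in>G. \<tau> x < \<tau> y \<longrightarrow> y \<in> W) \<or> (\<forall>y\<in>G. \<tau> x < \<tau> y \<longrightarrow> y \<notin> W)"
        using boundary_box[OF T(1) H(1,2) xW tch_open[OF H(1)] H(2)] by (elim exE conjE)
      have G: "openin X G" "x \<in> G" "G \<subseteq> H" using B unfolding box_def by auto
      \<comment> \<open>Neither side of the box lies in \<open>W\<close>: the lower side would put
        \<open>x\<close> into the upper end, the upper side would put it on level zero, and both of
        these are \<open>K\<close>.\<close>
      have "\<not> (\<forall>y\<in>G. \<tau> y < \<tau> x \<longrightarrow> y \<in> W)"
        using boundary_box_top_end[OF T(1) H(1) B 1 G(2)] top x by blast
      moreover have "\<not> (\<forall>y\<in>G. \<tau> x < \<tau> y \<longrightarrow> y \<in> W)"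
        using upper_tube_bottom[OF W0 W tch_subset[OF H(1) G(1,3)] G(2) xW] x K by blast
      ultimately have "y \<notin> W" if "y \<in> G" for y
        using 1 that by (cases "\<tau> y" "\<tau> x" rule: linorder_cases) blast+
      then show "\<exists>T. openin X T \<and> x \<in> T \<and> T \<subseteq> topspace X - (W \<union> K)"
        using G(1,2) x Kcl(1) openin_subset[OF G(1)] by (intro exI[of _ "G - K"] conjI openin_diff) auto
    qed
    moreover have "W \<union> K \<subseteq> topspace X"
      using openin_subset[OF tubeD(5)[OF T(1)]] closedin_subset[OF Kcl(1)] by blast
    ultimately have "closedin X (W \<union> K)" "openin X (W \<union> K)" by (auto simp: closedin_def)
    then have "W \<union> K = {} \<or> W \<union> K = topspace X" using connected_X connected_space_clopen_in by blast
    then show ?thesis using ne by blast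
  qed
  define b where "b = Sup (u ` W)"
  have ltb: "\<forall>c\<in>u ` W. c < b" using top_chart[OF T(1) x1(1)] unfolding b_def by (elim exE conjE)
  have b0: "0 < b" using ne T(5) ltb by force
  have img: "u ` W = {0<..<b}"
  proof
    show "{0<..<b} \<subseteq> u ` W"
    proof
      fix z assume z: "z \<in> {0<..<b}"
      obtain c where c: "c \<in> u ` W" "z < c" using less_cSupE[of z "u ` W"] z ne unfolding b_def by auto
      \<comment> \<open>Small positive values come from the base tube, so \<open>min e z\<close> is
        an attained value not exceeding \<open>z\<close>; with an attained value above
        \<open>z\<close> this yields \<open>z\<close> itself.\<close>
      have "min e z \<in> {-e..e}" "0 < min e z" using e(1) z by auto
      then obtain y where y: "y \<in> W\<^sub>0" "min e z = u\<^sub>0 y" using e(2) by (meson imageE subsetD)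
      then have "y \<in> W" "u y = min e z" using T(2,3)[of y] \<open>0 < min e z\<close> by simp_all
      then have "min e z \<in> u ` W" by (metis imageI)
      then show "z \<in> u ` W" using connected_contains_Icc[OF tubeD(2)[OF T(1)] _ c(1)] c(2) by force
    qed
  qed (use T(5) ltb in auto)
  obtain H v where H: "tch H v" "K \<subseteq> H" "\<forall>y\<in>H. v y < b \<longrightarrow> y \<in> W \<and> u y = v y"
      "\<forall>y\<in>H. y \<in> K \<longleftrightarrow> v y = b"
    using top_collar[OF T(1) ne] unfolding b_def top by (elim exE conjE)
  \<comment> \<open>At points of \<open>K\<close> the charts \<open>v\<close> and
    \<open>u\<^sub>0\<close> take the values \<open>b\<close> and 0, so their transition has
    constant term \<open>b\<close> and only the slope could vary. The sets for different slopes are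
    open and disjoint on \<open>K\<close>, and connectedness makes the slope constant.\<close>
  define E where "E r = {x. germ_eq X x v (\<lambda>y. r * u\<^sub>0 y + b)}" for r
  have loc: "\<exists>r>0. x \<in> E r" if x: "x \<in> K" for x
  proof -
    have xW: "x \<in> W\<^sub>0" "u\<^sub>0 x = 0" "x \<in> H" "v x = b" using x K H(2,4) by auto
    obtain N \<alpha> \<beta> where N: "openin X N" "x \<in> N" "N \<subseteq> W\<^sub>0 \<inter> H" "0 < \<alpha>" "\<forall>y\<in>N. v y = \<alpha> * u\<^sub>0 y + \<beta>"
      using tch_transition[OF W0' H(1) xW(1,3)] by (elim exE conjE)
    then have "\<beta> = b" using xW by force
    then show ?thesis using N unfolding E_def germ_eq_def by blast
  qed
  obtain r where r: "0 < r" "x1 \<in> E r" using loc[OF x1(2)] by blast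
  have uniq: "s = r" if s: "x \<in> K" "x \<in> E s" "x \<in> E r" for x s
  proof -
    obtain N N' where N: "openin X N" "x \<in> N" "\<forall>y\<in>N. v y = s * u\<^sub>0 y + b"
        "openin X N'" "x \<in> N'" "\<forall>y\<in>N'. v y = r * u\<^sub>0 y + b"
      using s(2,3) unfolding E_def germ_eq_def by blast
    have "x \<in> W\<^sub>0" "u\<^sub>0 x = 0" using s(1) K by auto
    then obtain z where z: "z \<in> N \<inter> N' \<inter> W\<^sub>0" "u\<^sub>0 z < 0"
      using tch_value_near[OF W0', of "N \<inter> N' \<inter> W\<^sub>0" x "-1"] N(1,2,4,5) tubeD(5)[OF W0(1)] by auto
    then have "s * u\<^sub>0 z + b = r * u\<^sub>0 z + b" using N(3,6) by (metis IntD1 IntD2)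
    then show ?thesis using z(2) by simp
  qed
  have KE: "K \<subseteq> E r"
  proof (rule ccontr)
    assume "\<not> K \<subseteq> E r"
    define E' where "E' = (\<Union>s\<in>-{r}. E s)"
    have "openin X (E s)" for s unfolding E_def by (rule openin_germ_eq)
    then have "openin X (E r)" "openin X E'" unfolding E'_def by blast+
    moreover have "K \<subseteq> E r \<union> E'" unfolding E'_def using loc by fast
    moreover have "E r \<inter> E' \<inter> K = {}" unfolding E'_def using uniq by blast
    moreover have "E r \<inter> K \<noteq> {}" using r(2) x1(2) by blast
    moreover have "E' \<inter> K \<noteq> {}" using \<open>\<not> K \<subseteq> E r\<close> \<open>K \<subseteq> E r \<union> E'\<close> by blast
    ultimately show False using Kcl(2) unfolding connectedin by blast
  qed
  have "\<exists>T. openin X T \<and> x \<in> T \<and> T \<subseteq> W\<^sub>0 \<and> (\<forall>y\<in>T. u\<^sub>0 y < 0 \<longrightarrow> y \<in> W \<and> u y = r * u\<^sub>0 y + b)"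
    if x: "x \<in> K" for x
  proof -
    obtain N where N: "openin X N" "x \<in> N" "\<forall>y\<in>N. v y = r * u\<^sub>0 y + b"
      using KE x unfolding E_def germ_eq_def by blast
    have "openin X (N \<inter> H \<inter> W\<^sub>0)" using N(1) tch_open[OF H(1)] tubeD(5)[OF W0(1)] by blast
    moreover have "y \<in> W \<and> u y = r * u\<^sub>0 y + b" if y: "y \<in> N \<inter> H \<inter> W\<^sub>0" "u\<^sub>0 y < 0" for y
    proof -
      have "r * u\<^sub>0 y < 0" using y(2) r(1) by (simp add: mult_pos_neg)
      then have "v y < b" "v y = r * u\<^sub>0 y + b" using N(3) y(1) by auto
      then show ?thesis using H(3) y(1) by auto
    qed
    ultimately show ?thesis using N(2) x H(2) K by (intro exI[of _ "N \<inter> H \<inter> W\<^sub>0"]) auto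
  qed
  then show ?thesis using b0 r(1) T(1-3) img all WK
    by (intro exI[of _ W] exI[of _ u] exI[of _ b] exI[of _ r]) simp
qed

end

section \<open>Affine structures on the circle\<close>

text \<open>The developing map of an affine circle: the holonomy of the generator is \<open>x \<mapsto> r x + b\<close>.\<close>

locale circle_development =
  fixes e :: "real \<Rightarrow> real" and P Q k R b r :: real
  assumes e: "e \<theta> = P + Q * exp (k * \<theta>) + R * \<theta>"
    and e_deriv_pos: "0 < Q * k * exp (k * \<theta>) + R"
    and e_zero: "e 0 = 0" and e_shift: "e (\<theta> + 2 * pi) = r * e \<theta> + b" and r_pos: "0 < r"

text \<open>In terms of an angle the holonomy has to become the shift by \<open>2 * pi\<close>. For
  \<open>r = 1\<close> it is a translation and a linear function serves. Otherwise it has the fixed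
  point \<open>- Q\<close>, and measured from there it is multiplication by \<open>r\<close>, whence
  the exponential with \<open>k = ln r / (2 * pi)\<close>; the amplitude \<open>Q\<close> is fixed
  by the value 0 at angle 0.\<close>

lemma circle_development_exists:
  assumes "0 < b" "0 < r"
  shows "\<exists>e P Q k R. circle_development e P Q k R b r"
proof (cases "r = 1")
  case True
  have "circle_development (\<lambda>\<theta>. b / (2 * pi) * \<theta>) 0 0 0 (b / (2 * pi)) b r"
    using assms True by unfold_locales (simp_all add: field_simps)
  then show ?thesis by blast
next
  case False
  define k where "k = ln r / (2 * pi)"
  define Q where "Q = b / (r - 1)"
  have ek: "exp (k * 2 * pi) = r" using assms(2) unfolding k_def by simp
  have "circle_development (\<lambda>\<theta>. - Q + Q * exp (k * \<theta>)) (- Q) Q k 0 b r"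
  proof
    fix \<theta>
    \<comment> \<open>\<open>Q\<close> and \<open>k\<close> both have the sign of
      \<open>r - 1\<close>, so the function increases in either case.\<close>
    have "0 < Q * k"
    proof (cases "1 < r")
      case True
      then show ?thesis using assms unfolding Q_def k_def by simp
    next
      case False
      then have "r < 1" using \<open>r \<noteq> 1\<close> by simp
      then have "Q < 0" "k < 0"
        using assms unfolding Q_def k_def by (simp_all add: divide_pos_neg divide_neg_pos)
      then show ?thesis by (rule mult_neg_neg)
    qed
    then show "0 < Q * k * exp (k * \<theta>) + 0" by simp
    have "exp (k * (\<theta> + 2 * pi)) = r * exp (k * \<theta>)"
      using ek by (simp add: distrib_left exp_add mult.assoc)
    moreover have "Q * (r - 1) = b" using False unfolding Q_def by simp
    then have "b = Q * r - Q" by (simp add: right_diff_distrib)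
    ultimately show "- Q + Q * exp (k * (\<theta> + 2 * pi)) = r * (- Q + Q * exp (k * \<theta>)) + b"
      by (simp add: algebra_simps)
  qed (use assms in simp_all)
  then show ?thesis by blast
qed

section \<open>Branches of the angle and smoothness in the angular coordinate\<close>

definition angle :: "real \<Rightarrow> complex \<Rightarrow> real" where
  "angle c z = c + Arg (z / cis c)"

definition slit_circle :: "real \<Rightarrow> complex set" where
  "slit_circle c = sphere 0 1 - {- cis c}"

lemma slit_circle_not_nonpos: "z \<in> slit_circle c \<Longrightarrow> z / cis c \<notin> \<real>\<^sub>\<le>\<^sub>0"
proof
  assume z: "z \<in> slit_circle c" and "z / cis c \<in> \<real>\<^sub>\<le>\<^sub>0"
  then obtain x where x: "z / cis c = of_real x" "x \<le> 0" by (auto simp: nonpos_Reals_def)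
  have "norm (z / cis c) = 1" using z unfolding slit_circle_def by (simp add: norm_divide)
  then have "x = -1" using x by simp
  then have "z = - cis c" using x(1) by (simp add: field_simps)
  then show False using z unfolding slit_circle_def by blast
qed

lemma angle:
  assumes "z \<in> slit_circle c"
  shows "cis (angle c z) = z" "angle c z \<in> {c - pi<..<c + pi}"
proof -
  have n: "norm (z / cis c) = 1" using assms unfolding slit_circle_def by (simp add: norm_divide)
  then have "z / cis c \<noteq> 0" by auto
  then have "cis (Arg (z / cis c)) = z / cis c" using n by (simp add: cis_Arg sgn_div_norm)
  then show "cis (angle c z) = z" unfolding angle_def by (simp add: cis_mult[symmetric])
  have "Arg (z / cis c) \<noteq> pi"
  proof
    assume "Arg (z / cis c) = pi"
    then have "z / cis c = -1" using \<open>cis (Arg (z / cis c)) = z / cis c\<close> by simp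
    moreover have "(-1 :: complex) \<in> \<real>\<^sub>\<le>\<^sub>0" by simp
    ultimately show False using slit_circle_not_nonpos[OF assms] by simp
  qed
  then show "angle c z \<in> {c - pi<..<c + pi}"
    unfolding angle_def using Arg_bounded[of "z / cis c"] by auto
qed

lemma angle_cis:
  assumes "\<theta> \<in> {c - pi<..<c + pi}"
  shows "cis \<theta> \<in> slit_circle c" "angle c (cis \<theta>) = \<theta>"
proof -
  have A: "Arg (cis \<theta> / cis c) = \<theta> - c" using assms by (simp add: cis_divide Arg_cis)
  then show "angle c (cis \<theta>) = \<theta>" unfolding angle_def by simp
  have "cis \<theta> \<noteq> - cis c"
  proof
    assume "cis \<theta> = - cis c"
    then have "cis \<theta> / cis c = cis pi" by simp
    then have "\<theta> - c = Arg (cis pi)" using A by simp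
    then show False using assms Arg_cis[of pi] by simp
  qed
  then show "cis \<theta> \<in> slit_circle c" unfolding slit_circle_def by simp
qed

lemma continuous_on_angle: "continuous_on (slit_circle c) (angle c)"
  unfolding angle_def using slit_circle_not_nonpos by (intro continuous_intros) auto

lemma cis_eq_iff: "cis \<theta> = cis \<theta>' \<longleftrightarrow> (\<exists>n::int. \<theta> = \<theta>' + 2 * pi * n)"
  using sin_cos_eq_iff[of \<theta> \<theta>'] by (auto simp: complex_eq_iff)

text \<open>A branch of the angle differs from a given lift by a multiple of \<open>2 * pi\<close>,
  and the multiple stays the same until the shifted lift leaves the window of length
  \<open>2 * pi\<close> centred at \<open>c\<close>.\<close>

lemma angle_locally:
  assumes "cis \<theta>\<^sub>0 \<in> slit_circle c"
  shows "\<exists>\<delta>>0. \<exists>n::int. \<forall>\<theta>. \<bar>\<theta> - \<theta>\<^sub>0\<bar> < \<delta> \<longrightarrow> cis \<theta> \<in> slit_circle c \<and> angle c (cis \<theta>) = \<theta> + 2 * pi * n"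
proof -
  obtain n :: int where n: "angle c (cis \<theta>\<^sub>0) = \<theta>\<^sub>0 + 2 * pi * n"
    using angle(1)[OF assms] cis_eq_iff by blast
  define \<delta> where "\<delta> = min (\<theta>\<^sub>0 + 2 * pi * n - (c - pi)) (c + pi - (\<theta>\<^sub>0 + 2 * pi * n))"
  have "\<delta> > 0" using angle(2)[OF assms] unfolding \<delta>_def n by auto
  moreover have "cis \<theta> \<in> slit_circle c \<and> angle c (cis \<theta>) = \<theta> + 2 * pi * n" if "\<bar>\<theta> - \<theta>\<^sub>0\<bar> < \<delta>" for \<theta>
  proof -
    have "\<theta> + 2 * pi * n \<in> {c - pi<..<c + pi}" using that unfolding \<delta>_def by auto
    moreover have "cis (\<theta> + 2 * pi * n) = cis \<theta>" using cis_eq_iff by blast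
    ultimately show ?thesis using angle_cis[of "\<theta> + 2 * pi * n" c] by simp
  qed
  ultimately show ?thesis by blast
qed

text \<open>A constant, one exponential and a linear term span a class stable under differentiation,
  which turns smoothness of all orders into one induction. The coefficients may vary from point to
  point, as a circle chart has different formulas on different arcs of lifts.\<close>

definition locally_exp :: "real \<Rightarrow> real set \<Rightarrow> (real \<Rightarrow> real) \<Rightarrow> bool" where
  "locally_exp k S f \<longleftrightarrow> (\<forall>t\<in>S. \<exists>P Q R. \<forall>\<^sub>F s in nhds t. f s = P + Q * exp (k * s) + R * s)"

lemma has_real_derivative_exp:
  assumes "\<forall>\<^sub>F s in nhds t. f s = P + Q * exp (k * s) + R * s"
  shows "(f has_real_derivative (Q * k * exp (k * t) + R)) (at t)"
proof -
  have "((\<lambda>s. P + Q * exp (k * s) + R * s) has_real_derivative (Q * k * exp (k * t) + R)) (at t)"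
    by (auto intro!: derivative_eq_intros)
  then show ?thesis using DERIV_cong_ev[OF refl assms refl] by simp
qed

lemma locally_exp_differentiable:
  assumes "locally_exp k S f" "t \<in> S"
  shows "f differentiable (at t)"
proof -
  obtain P Q R where "\<forall>\<^sub>F s in nhds t. f s = P + Q * exp (k * s) + R * s"
    using assms unfolding locally_exp_def by blast
  then have "(f has_real_derivative (Q * k * exp (k * t) + R)) (at t)" by (rule has_real_derivative_exp)
  then show ?thesis unfolding real_differentiable_def by blast
qed

lemma locally_exp_frechet_derivative:
  assumes "locally_exp k S f"
  shows "locally_exp k S (\<lambda>x. frechet_derivative f (at x) v)"
  unfolding locally_exp_def
proof
  fix t assume "t \<in> S"
  then obtain P Q R where ev: "\<forall>\<^sub>F s in nhds t. f s = P + Q * exp (k * s) + R * s"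
    using assms unfolding locally_exp_def by blast
  have "frechet_derivative f (at s) v = v * R + (v * Q * k) * exp (k * s) + 0 * s"
    if "\<forall>\<^sub>F r in nhds s. f r = P + Q * exp (k * r) + R * r" for s
  proof -
    have "(f has_derivative (*) (Q * k * exp (k * s) + R)) (at s)"
      using has_real_derivative_exp[OF that] by (simp add: has_field_derivative_def)
    then have "frechet_derivative f (at s) = (*) (Q * k * exp (k * s) + R)"
      using frechet_derivative_at by metis
    then show ?thesis by (simp add: algebra_simps)
  qed
  \<comment> \<open>Differentiating at nearby points requires the formula in a neighbourhood of each
    of them, not only at the points themselves.\<close>
  moreover have "\<forall>\<^sub>F s in nhds t. \<forall>\<^sub>F r in nhds s. f r = P + Q * exp (k * r) + R * r"
    using ev by (simp add: eventually_eventually)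
  ultimately have "\<forall>\<^sub>F s in nhds t. frechet_derivative f (at s) v = v * R + (v * Q * k) * exp (k * s) + 0 * s"
    by (rule eventually_mono[rotated])
  then show "\<exists>P Q R. \<forall>\<^sub>F s in nhds t. frechet_derivative f (at s) v = P + Q * exp (k * s) + R * s"
    by metis
qed

lemma Ck_on_locally_exp: "locally_exp k S f \<Longrightarrow> Ck_on m f S"
proof (induction m arbitrary: f)
  case 0
  then show ?case
    using locally_exp_differentiable[OF 0] differentiable_imp_continuous_within
    by (auto intro!: continuous_at_imp_continuous_on)
next
  case (Suc m)
  have "f differentiable_on S"
    using locally_exp_differentiable[OF Suc.prems] by (simp add: differentiable_at_imp_differentiable_on)
  then show ?case using Suc.IH locally_exp_frechet_derivative[OF Suc.prems] by simp
qed

section \<open>The affine structure on the circle given by a development\<close>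

context circle_development
begin

definition circle_atlas :: "(complex, real) chart set" where
  "circle_atlas = {(slit_circle c, e \<circ> angle c) |c. True}"

lemma e_deriv: "(e has_real_derivative (Q * k * exp (k * \<theta>) + R)) (at \<theta>)"
proof -
  have "e = (\<lambda>\<theta>. P + Q * exp (k * \<theta>) + R * \<theta>)" using e by blast
  then show ?thesis by (auto intro!: derivative_eq_intros)
qed

lemma e_strict_mono: "strict_mono e"
  by (intro strict_monoI DERIV_pos_imp_increasing[of _ _ e]) (use e_deriv e_deriv_pos in blast)+

lemma e_inj: "inj_on e S"
  using e_strict_mono strict_mono_imp_inj_on inj_on_subset by blast

lemma e_continuous: "continuous_on S e"
  using e_deriv DERIV_isCont continuous_at_imp_continuous_on by blast

lemma e_range_open: "open S \<Longrightarrow> open (e ` S)"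
  by (rule invariance_of_domain[OF e_continuous _ e_inj])

lemma e_inv [simp]: "inv e (e \<theta>) = \<theta>"
  using e_inj by (rule inv_f_f)

lemma e_inv_continuous: "continuous_on (range e) (inv e)"
  by (rule continuous_on_inverse_open[OF open_UNIV e_continuous]) simp_all

text \<open>The holonomy of one turn is iterated; negative turns use its inverse, which is affine
  and increasing because \<open>r\<close> is positive.\<close>

lemma e_shift_int: "\<exists>\<alpha>>0. \<exists>\<beta>. \<forall>\<theta>. e (\<theta> + 2 * pi * of_int n) = \<alpha> * e \<theta> + \<beta>"
proof (induction n rule: int_induct[of _ 0])
  case base
  show ?case by (intro exI[of _ 1] conjI exI[of _ 0]) auto
next
  case (step1 n)
  then obtain \<alpha> \<beta> where *: "\<alpha> > 0" "\<forall>\<theta>. e (\<theta> + 2 * pi * of_int n) = \<alpha> * e \<theta> + \<beta>" by blast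
  have "e (\<theta> + 2 * pi * of_int (n + 1)) = (r * \<alpha>) * e \<theta> + (r * \<beta> + b)" for \<theta>
    using e_shift[of "\<theta> + 2 * pi * of_int n"] *(2) by (simp add: algebra_simps)
  then show ?case using *(1) r_pos by (meson mult_pos_pos)
next
  case (step2 n)
  then obtain \<alpha> \<beta> where *: "\<alpha> > 0" "\<forall>\<theta>. e (\<theta> + 2 * pi * of_int n) = \<alpha> * e \<theta> + \<beta>" by blast
  have "e (\<theta> + 2 * pi * of_int (n - 1)) = (\<alpha> / r) * e \<theta> + (\<beta> - b) / r" for \<theta>
  proof -
    have "r * e (\<theta> + 2 * pi * of_int (n - 1)) + b = \<alpha> * e \<theta> + \<beta>"
      using e_shift[of "\<theta> + 2 * pi * of_int (n - 1)"] *(2) by (simp add: algebra_simps)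
    then have "e (\<theta> + 2 * pi * of_int (n - 1)) = (\<alpha> * e \<theta> + \<beta> - b) / r"
      using r_pos by (simp only: eq_divide_eq) (simp add: algebra_simps)
    then show ?thesis by (simp add: add_divide_distrib diff_divide_distrib)
  qed
  then show ?case using *(1) r_pos by (meson divide_pos_pos)
qed

text \<open>A full turn changes \<open>e\<close> by an increasing affine map, so the branch of the
  angle matters only up to such a map. Coordinate changes, smoothness, the nonvanishing derivative
  and affinity of maps into the circle are all read off from this.\<close>

lemma circle_chart_locally:
  assumes "cis \<theta>\<^sub>0 \<in> slit_circle c"
  shows "\<exists>\<delta>>0. \<exists>\<alpha>>0. \<exists>\<beta>. \<forall>\<theta>. \<bar>\<theta> - \<theta>\<^sub>0\<bar> < \<delta> \<longrightarrow>
    cis \<theta> \<in> slit_circle c \<and> (e \<circ> angle c) (cis \<theta>) = \<alpha> * e \<theta> + \<beta>"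
proof -
  obtain \<delta> and n :: int where n: "\<delta> > 0"
      "\<forall>\<theta>. \<bar>\<theta> - \<theta>\<^sub>0\<bar> < \<delta> \<longrightarrow> cis \<theta> \<in> slit_circle c \<and> angle c (cis \<theta>) = \<theta> + 2 * pi * n"
    using angle_locally[OF assms] by blast
  obtain \<alpha> \<beta> where "\<alpha> > 0" "\<forall>\<theta>. e (\<theta> + 2 * pi * n) = \<alpha> * e \<theta> + \<beta>" using e_shift_int[of n] by blast
  then have "\<forall>\<theta>. \<bar>\<theta> - \<theta>\<^sub>0\<bar> < \<delta> \<longrightarrow> cis \<theta> \<in> slit_circle c \<and> (e \<circ> angle c) (cis \<theta>) = \<alpha> * e \<theta> + \<beta>"
    using n(2) by simp
  then show ?thesis using n(1) \<open>\<alpha> > 0\<close> by blast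
qed

lemma affine_map_real: "affine_map (\<lambda>x::real. \<alpha> * x + \<beta>)"
  unfolding affine_map_def by (intro exI[of _ "(*) \<alpha>"] exI[of _ \<beta>]) (simp add: linear_times)

lemma openin_slit_circle: "openin (top_of_set (sphere 0 1)) (slit_circle c)"
proof -
  have "slit_circle c = sphere 0 1 \<inter> - {- cis c}" unfolding slit_circle_def by blast
  then show ?thesis by (metis openin_open_Int open_Compl closed_singleton)
qed

lemma slit_circle_homeomorphism:
  "\<exists>\<psi>. homeomorphism (slit_circle c) ((e \<circ> angle c) ` slit_circle c) (e \<circ> angle c) \<psi>"
  "open ((e \<circ> angle c) ` slit_circle c)"
proof -
  have "angle c ` slit_circle c = {c - pi<..<c + pi}"
    using angle(2) angle_cis by (metis image_eqI image_subsetI subsetI subset_antisym)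
  then have img: "(e \<circ> angle c) ` slit_circle c = e ` {c - pi<..<c + pi}" by (metis image_comp)
  then show "open ((e \<circ> angle c) ` slit_circle c)" using e_range_open by simp
  have "homeomorphism (slit_circle c) ((e \<circ> angle c) ` slit_circle c) (e \<circ> angle c) (cis \<circ> inv e)"
  proof (rule homeomorphismI)
    show "continuous_on (slit_circle c) (e \<circ> angle c)"
      by (rule continuous_on_compose[OF continuous_on_angle e_continuous])
    show "continuous_on ((e \<circ> angle c) ` slit_circle c) (cis \<circ> inv e)"
      by (rule continuous_on_compose[OF continuous_on_subset[OF e_inv_continuous]])
        (auto intro: continuous_intros)
    show "(cis \<circ> inv e) ` (e \<circ> angle c) ` slit_circle c \<subseteq> slit_circle c" using angle(1) by auto
  qed (use angle(1) in auto)
  then show "\<exists>\<psi>. homeomorphism (slit_circle c) ((e \<circ> angle c) ` slit_circle c) (e \<circ> angle c) \<psi>" by blast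
qed

lemma affine_structure_circle_atlas: "affine_structure_on_circle circle_atlas"
proof -
  have "second_countable (euclidean :: complex topology)"
  proof -
    obtain \<B> :: "complex set set" where \<B>: "countable \<B>" "\<And>C. C \<in> \<B> \<Longrightarrow> open C"
        "\<And>S. open S \<Longrightarrow> \<exists>U. U \<subseteq> \<B> \<and> S = \<Union>U"
      using univ_second_countable by blast
    have "\<exists>V\<in>\<B>. x \<in> V \<and> V \<subseteq> U" if U: "open U" "x \<in> U" for U x
    proof -
      obtain \<U> where "\<U> \<subseteq> \<B>" "U = \<Union>\<U>" using \<B>(3)[OF U(1)] by blast
      then show ?thesis using U(2) by blast
    qed
    then show ?thesis
      unfolding second_countable_def open_openin[symmetric] using \<B>(1,2) by (intro exI[of _ \<B>]) simp
  qed
  then have sc: "second_countable (top_of_set (sphere (0::complex) 1))"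
    by (rule second_countable_subtopology)
  have cover: "\<Union>(fst ` circle_atlas) = sphere 0 1"
  proof
    show "sphere 0 1 \<subseteq> \<Union>(fst ` circle_atlas)"
    proof
      fix z :: complex assume z: "z \<in> sphere 0 1"
      have "cis (Arg z) \<in> slit_circle (Arg z)" by (rule angle_cis) simp
      moreover have "cis (Arg z) = z" using z by (subst cis_Arg) (auto simp: sgn_div_norm)
      ultimately show "z \<in> \<Union>(fst ` circle_atlas)" unfolding circle_atlas_def by force
    qed
  qed (auto simp: circle_atlas_def slit_circle_def)
  have trans: "\<exists>T a. openin (top_of_set (sphere 0 1)) T \<and> x \<in> T \<and> T \<subseteq> slit_circle c \<inter> slit_circle d \<and>
      affine_map a \<and> bij a \<and> (\<forall>y\<in>T. (e \<circ> angle d) y = a ((e \<circ> angle c) y))"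
    if x: "x \<in> slit_circle c" "x \<in> slit_circle d" for c d x
  proof -
    have xd: "cis (angle c x) \<in> slit_circle d" using x angle(1) by simp
    obtain \<delta> \<alpha> \<beta> where *: "\<delta> > 0" "\<alpha> > 0" "\<forall>\<theta>. \<bar>\<theta> - angle c x\<bar> < \<delta> \<longrightarrow>
        cis \<theta> \<in> slit_circle d \<and> (e \<circ> angle d) (cis \<theta>) = \<alpha> * e \<theta> + \<beta>"
      using circle_chart_locally[OF xd] by (elim exE conjE)
    define T where "T = slit_circle c \<inter> angle c -` {angle c x - \<delta><..<angle c x + \<delta>}"
    have "openin (top_of_set (slit_circle c)) T" unfolding T_def
      by (rule continuous_openin_preimage_gen[OF continuous_on_angle]) simp
    then have "openin (top_of_set (sphere 0 1)) T" using openin_slit_circle openin_trans by blast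
    moreover have near: "\<bar>angle c y - angle c x\<bar> < \<delta>" "cis (angle c y) = y" if "y \<in> T" for y
      using that angle(1) unfolding T_def by auto
    have "y \<in> slit_circle d \<and> (e \<circ> angle d) y = \<alpha> * (e \<circ> angle c) y + \<beta>" if "y \<in> T" for y
      using *(3)[rule_format, OF near(1)[OF that]] near(2)[OF that] by simp
    moreover have "bij (\<lambda>x. \<alpha> * x + \<beta>)"
      by (rule o_bij[of "\<lambda>x. (x - \<beta>) / \<alpha>"]) (use *(2) in \<open>auto simp: fun_eq_iff\<close>)
    ultimately show ?thesis using x(1) *(1) affine_map_real[of \<alpha> \<beta>]
      by (intro exI[of _ T] exI[of _ "\<lambda>x. \<alpha> * x + \<beta>"]) (auto simp: T_def)
  qed
  have "affine_atlas (sphere 0 1) circle_atlas"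
    unfolding affine_atlas_def cover
    using openin_slit_circle slit_circle_homeomorphism trans
    by (auto simp: circle_atlas_def)
  moreover have "connected (sphere (0::complex) 1)" by (rule connected_sphere) simp
  moreover have "(1::complex) \<in> sphere 0 1" by simp
  then have "sphere (0::complex) 1 \<noteq> {}" by blast
  ultimately have "affine_manifold (sphere 0 1) circle_atlas"
    unfolding affine_manifold_def using sc by (simp add: Hausdorff_space_subtopology)
  moreover have "smooth_on (cis -` V) (\<psi> \<circ> cis) \<and> (\<forall>t\<in>cis -` V. deriv (\<psi> \<circ> cis) t \<noteq> 0)"
    if V: "(V, \<psi>) \<in> circle_atlas" for V \<psi>
  proof -
    obtain c where c: "V = slit_circle c" "\<psi> = e \<circ> angle c" using V unfolding circle_atlas_def by blast
    have loc: "\<exists>\<alpha>>0. \<exists>\<beta>. \<forall>\<^sub>F s in nhds t. (\<psi> \<circ> cis) s = \<alpha> * e s + \<beta>" if "t \<in> cis -` V" for t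
    proof -
      have tc: "cis t \<in> slit_circle c" using that c by simp
      obtain \<delta> \<alpha> \<beta> where *: "\<delta> > 0" "\<alpha> > 0" "\<forall>\<theta>. \<bar>\<theta> - t\<bar> < \<delta> \<longrightarrow>
          cis \<theta> \<in> slit_circle c \<and> (e \<circ> angle c) (cis \<theta>) = \<alpha> * e \<theta> + \<beta>"
        using circle_chart_locally[OF tc] by (elim exE conjE)
      then have "\<forall>\<^sub>F s in nhds t. (\<psi> \<circ> cis) s = \<alpha> * e s + \<beta>"
        unfolding eventually_nhds_metric dist_real_def c by (intro exI[of _ \<delta>]) simp
      then show ?thesis using *(2) by blast
    qed
    have "smooth_on (cis -` V) (\<psi> \<circ> cis)"
      unfolding smooth_on_def
    proof (intro allI Ck_on_locally_exp[where k = k], unfold locally_exp_def, intro ballI)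
      fix t assume "t \<in> cis -` V"
      then obtain \<alpha> \<beta> where "\<forall>\<^sub>F s in nhds t. (\<psi> \<circ> cis) s = \<alpha> * e s + \<beta>" using loc by blast
      then have "\<forall>\<^sub>F s in nhds t. (\<psi> \<circ> cis) s = (\<alpha> * P + \<beta>) + (\<alpha> * Q) * exp (k * s) + (\<alpha> * R) * s"
        by eventually_elim (simp add: e algebra_simps)
      then show "\<exists>P Q R. \<forall>\<^sub>F s in nhds t. (\<psi> \<circ> cis) s = P + Q * exp (k * s) + R * s" by blast
    qed
    moreover have "deriv (\<psi> \<circ> cis) t \<noteq> 0" if t: "t \<in> cis -` V" for t
    proof -
      obtain \<alpha> \<beta> where *: "\<alpha> > 0" "\<forall>\<^sub>F s in nhds t. (\<psi> \<circ> cis) s = \<alpha> * e s + \<beta>" using loc[OF t] by blast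
      have "((\<lambda>s. \<alpha> * e s + \<beta>) has_real_derivative \<alpha> * (Q * k * exp (k * t) + R)) (at t)"
        using e_deriv[of t] by (auto intro!: derivative_eq_intros)
      moreover have "deriv (\<psi> \<circ> cis) t = deriv (\<lambda>s. \<alpha> * e s + \<beta>) t"
        by (rule deriv_cong_ev[OF *(2) refl])
      ultimately have "deriv (\<psi> \<circ> cis) t = \<alpha> * (Q * k * exp (k * t) + R)"
        by (simp add: DERIV_imp_deriv)
      then show ?thesis using *(1) e_deriv_pos[of t] by simp
    qed
    ultimately show ?thesis by blast
  qed
  ultimately show ?thesis unfolding affine_structure_on_circle_def by blast
qed

end

section \<open>The fibration over the affine circle\<close>

lemma (in circle_development) e_two_pi: "e (2 * pi) = b"
  using e_shift[of 0] e_zero by simp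

lemma (in circle_development) fundamental_interval:
  assumes "x \<in> {0<..<b}"
  shows "\<exists>\<phi>\<in>{0<..<2 * pi}. x = e \<phi>"
proof -
  have "\<exists>\<phi>\<ge>0. \<phi> \<le> 2 * pi \<and> e \<phi> = x"
    by (rule IVT') (use assms e_zero e_two_pi e_continuous in auto)
  then obtain \<phi> where \<phi>: "0 \<le> \<phi>" "\<phi> \<le> 2 * pi" "e \<phi> = x" by blast
  then have "\<phi> \<noteq> 0" "\<phi> \<noteq> 2 * pi" using assms e_zero e_two_pi by auto
  then show ?thesis using \<phi> by (intro bexI[of _ \<phi>]) auto
qed

lemma cis_inj_fundamental:
  assumes "cis \<phi> = cis \<theta>" "\<phi> \<in> {0..<2 * pi}" "\<theta> \<in> {0..<2 * pi}"
  shows "\<phi> = \<theta>"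
proof -
  obtain n :: int where n: "\<phi> = \<theta> + 2 * pi * n" using assms(1) cis_eq_iff by blast
  then have "2 * pi * \<bar>real_of_int n\<bar> = \<bar>\<phi> - \<theta>\<bar>" by (simp add: abs_mult)
  also have "\<dots> < 2 * pi * 1" using assms(2,3) by auto
  finally have "\<bar>real_of_int n\<bar> < 1" by simp
  then have "n = 0" by linarith
  then show ?thesis using n by simp
qed

text \<open>The map is \<open>cis\<close> of the angle developed by \<open>u\<close> on
  \<open>W\<close>, and 1 on \<open>K\<close>. Across \<open>K\<close> it is described by
  \<open>u\<^sub>0\<close> itself: just below \<open>K\<close> one has
  \<open>u = r * u\<^sub>0 + b\<close>, which is the same point of the development one turn further,
  and \<open>cis\<close> does not see the turn.\<close>

lemma (in transverse_affine) fibration_over_circle: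
  assumes W0: "tube W\<^sub>0 u\<^sub>0" "0 \<in> u\<^sub>0 ` W\<^sub>0"
  shows "\<exists>e P Q k R b r g. circle_development e P Q k R b r \<and> g ` topspace X \<subseteq> sphere 0 1 \<and>
    (\<forall>y\<in>topspace X. \<exists>T \<tau>. tch T \<tau> \<and> y \<in> T \<and> (\<forall>z\<in>T. \<tau> z \<in> range e \<and> g z = cis (inv e (\<tau> z)))) \<and>
    (\<forall>z\<in>sphere 0 1. \<exists>T \<tau> c. tch T \<tau> \<and> {y\<in>topspace X. g y = z} = {y\<in>T. \<tau> y = c} \<and>
       connectedin X {y\<in>T. \<tau> y = c} \<and> closedin X {y\<in>T. \<tau> y = c} \<and> {y\<in>T. \<tau> y = c} \<noteq> {})"
proof -
  define K where "K = {y\<in>W\<^sub>0. u\<^sub>0 y = 0}"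
  obtain W u b r where b: "0 < b" "0 < r" and W: "tube W u" "u ` W = {0<..<b}"
    and X: "topspace X = W \<union> K" "W \<inter> K = {}" and up: "\<forall>y\<in>W\<^sub>0. 0 < u\<^sub>0 y \<longrightarrow> y \<in> W \<and> u y = u\<^sub>0 y"
    and low: "\<forall>x\<in>K. \<exists>T. openin X T \<and> x \<in> T \<and> T \<subseteq> W\<^sub>0 \<and> (\<forall>y\<in>T. u\<^sub>0 y < 0 \<longrightarrow> y \<in> W \<and> u y = r * u\<^sub>0 y + b)"
    using tube_exhausts[OF W0 K_def] by (elim exE conjE)
  obtain e P Q k R where dev: "circle_development e P Q k R b r"
    using circle_development_exists[OF b] by (elim exE)
  interpret D: circle_development e P Q k R b r by (rule dev)
  define g where "g y = (if y \<in> W then cis (inv e (u y)) else 1)" for y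
  have gW: "\<exists>\<phi>\<in>{0<..<2 * pi}. u y = e \<phi> \<and> g y = cis \<phi>" if y: "y \<in> W" for y
  proof -
    have "u y \<in> {0<..<b}" using W(2) y by blast
    then obtain \<phi> where "\<phi> \<in> {0<..<2 * pi}" "u y = e \<phi>" using D.fundamental_interval by blast
    then show ?thesis using y unfolding g_def by auto
  qed
  have rng: "g ` topspace X \<subseteq> sphere 0 1" unfolding g_def by auto
  have loc: "\<exists>T \<tau>. tch T \<tau> \<and> y \<in> T \<and> (\<forall>z\<in>T. \<tau> z \<in> range e \<and> g z = cis (inv e (\<tau> z)))"
    if y: "y \<in> topspace X" for y
  proof (cases "y \<in> W")
    case True
    have "\<forall>z\<in>W. u z \<in> range e \<and> g z = cis (inv e (u z))" using gW unfolding g_def by auto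
    then show ?thesis using True tubeD(1)[OF W(1)] by (intro exI[of _ W] exI[of _ u]) simp
  next
    case False
    then have yK: "y \<in> K" using y X by blast
    then obtain T where T: "openin X T" "y \<in> T" "T \<subseteq> W\<^sub>0" "\<forall>z\<in>T. u\<^sub>0 z < 0 \<longrightarrow> z \<in> W \<and> u z = r * u\<^sub>0 z + b"
      using low by blast
    \<comment> \<open>An exponential developing map is not onto the line, so the chart is cut down
      to values in its open range.\<close>
    define S where "S = {z\<in>T. u\<^sub>0 z \<in> range e}"
    have TT: "tch T u\<^sub>0" by (rule tch_subset[OF tubeD(1)[OF W0(1)] T(1,3)])
    then have "openin X S" unfolding S_def by (rule tch_preimage_open) (rule D.e_range_open[OF open_UNIV])
    then have "tch S u\<^sub>0" by (rule tch_subset[OF TT]) (auto simp: S_def)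
    moreover have "0 \<in> range e" using D.e_zero by (metis rangeI)
    then have "y \<in> S" using T(2) yK unfolding S_def K_def by simp
    moreover have "u\<^sub>0 z \<in> range e \<and> g z = cis (inv e (u\<^sub>0 z))" if z: "z \<in> S" for z
    proof -
      have zT: "z \<in> T" "z \<in> W\<^sub>0" using z T(3) unfolding S_def by auto
      obtain \<theta> where \<theta>: "u\<^sub>0 z = e \<theta>" using z unfolding S_def by blast
      consider "u\<^sub>0 z < 0" | "u\<^sub>0 z = 0" | "0 < u\<^sub>0 z" by linarith
      then have "g z = cis \<theta>"
      proof cases
        case 1
        then have "z \<in> W" "u z = r * e \<theta> + b" using T(4) zT(1) \<theta> by auto
        then have "z \<in> W" "u z = e (\<theta> + 2 * pi)" using D.e_shift by simp_all
        then have "g z = cis (\<theta> + 2 * pi)" unfolding g_def by simp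
        then show ?thesis by (simp add: cis_mult[symmetric])
      next
        case 2
        then have "z \<in> K" using zT(2) unfolding K_def by blast
        then have "g z = 1" using X(2) unfolding g_def by auto
        moreover have "\<theta> = inv e 0" using \<theta> 2 D.e_inv[of \<theta>] by simp
        then have "\<theta> = 0" using D.e_inv[of 0] D.e_zero by simp
        ultimately show ?thesis by simp
      next
        case 3
        then have "z \<in> W" "u z = e \<theta>" using up zT(2) \<theta> by auto
        then show ?thesis unfolding g_def by simp
      qed
      then show ?thesis using \<theta> by simp
    qed
    ultimately show ?thesis by (intro exI[of _ S] exI[of _ u\<^sub>0]) simp
  qed
  have fib: "\<exists>T \<tau> c. tch T \<tau> \<and> {y\<in>topspace X. g y = z} = {y\<in>T. \<tau> y = c} \<and>
      connectedin X {y\<in>T. \<tau> y = c} \<and> closedin X {y\<in>T. \<tau> y = c} \<and> {y\<in>T. \<tau> y = c} \<noteq> {}"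
    if z: "z \<in> sphere 0 1" for z
  proof -
    \<comment> \<open>With the angle in the half-open interval from 0 to \<open>2 * pi\<close>, the
      angle 0 singles out the fibre \<open>K\<close> and every other angle belongs to a level of
      \<open>u\<close>.\<close>
    define \<theta> where "\<theta> = Arg2pi z"
    have \<theta>: "\<theta> \<in> {0..<2 * pi}" "z = cis \<theta>"
      using z Arg2pi_lt_2pi Arg2pi_ge_0 Arg2pi_eq[of z] unfolding \<theta>_def
      by (auto simp: cis_conv_exp simp del: Arg2pi_eq)
    show ?thesis
    proof (cases "\<theta> = 0")
      case True
      have "g y \<noteq> z" if y: "y \<in> W" for y
      proof
        assume "g y = z"
        moreover obtain \<phi> where "\<phi> \<in> {0<..<2 * pi}" "g y = cis \<phi>" using gW[OF y] by blast
        ultimately show False using cis_inj_fundamental[of \<phi> 0] \<theta>(2) True by auto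
      qed
      moreover have "g y = z" if "y \<in> K" for y using that X(2) \<theta>(2) True unfolding g_def by auto
      ultimately have "{y\<in>topspace X. g y = z} = {y\<in>W\<^sub>0. u\<^sub>0 y = 0}" using X(1) K_def by auto
      then show ?thesis
        using tubeD(1,3)[OF W0(1)] tube_level_closed[OF W0] W0(2)
        by (intro exI[of _ W\<^sub>0] exI[of _ u\<^sub>0] exI[of _ 0]) auto
    next
      case False
      have "g y \<noteq> z" if "y \<in> K" for y
      proof
        assume "g y = z"
        moreover have "y \<notin> W" using that X(2) by blast
        ultimately have "cis \<theta> = cis 0" using \<theta>(2) unfolding g_def by auto
        then show False using cis_inj_fundamental[of \<theta> 0] \<theta>(1) False by auto
      qed
      moreover have "g y = z \<longleftrightarrow> u y = e \<theta>" if y: "y \<in> W" for y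
      proof -
        obtain \<phi> where \<phi>: "\<phi> \<in> {0<..<2 * pi}" "g y = cis \<phi>" "u y = e \<phi>" using gW[OF y] by blast
        have "g y = z \<longleftrightarrow> \<phi> = \<theta>"
          unfolding \<theta>(2) \<phi>(2) using cis_inj_fundamental[of \<phi> \<theta>] \<phi>(1) \<theta>(1) by auto
        also have "\<dots> \<longleftrightarrow> u y = e \<theta>" unfolding \<phi>(3) using D.e_inv by metis
        finally show ?thesis .
      qed
      ultimately have eq: "{y\<in>topspace X. g y = z} = {y\<in>W. u y = e \<theta>}" using X(1) by auto
      have "e 0 < e \<theta>" "e \<theta> < e (2 * pi)"
        using \<theta>(1) False strict_monoD[OF D.e_strict_mono] by auto
      then have img: "e \<theta> \<in> u ` W" unfolding W(2) using D.e_zero D.e_two_pi by simp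
      then show ?thesis
        unfolding eq using tubeD(1,3)[OF W(1)] tube_level_closed[OF W(1) img]
        by (intro exI[of _ W] exI[of _ u] exI[of _ "e \<theta>"]) auto
    qed
  qed
  have "\<forall>y\<in>topspace X. \<exists>T \<tau>. tch T \<tau> \<and> y \<in> T \<and> (\<forall>z\<in>T. \<tau> z \<in> range e \<and> g z = cis (inv e (\<tau> z)))"
    using loc by (rule ballI)
  moreover have "\<forall>z\<in>sphere 0 1. \<exists>T \<tau> c. tch T \<tau> \<and> {y\<in>topspace X. g y = z} = {y\<in>T. \<tau> y = c} \<and>
      connectedin X {y\<in>T. \<tau> y = c} \<and> closedin X {y\<in>T. \<tau> y = c} \<and> {y\<in>T. \<tau> y = c} \<noteq> {}"
    using fib by (rule ballI)
  ultimately show ?thesis using dev rng by (intro exI conjI)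
qed

section \<open>Transverse charts of a foliated affine manifold\<close>

text \<open>Comparing a base point with its translates shows that both functionals are positive on
  the same vectors, hence have the same kernel; the factor is read off at a vector where
  \<open>l\<close> is 1.\<close>

lemma proportional_functionals:
  fixes l l' :: "'e::euclidean_space \<Rightarrow> real"
  assumes l: "linear l" "l w \<noteq> 0" and l': "linear l'" and S: "open S" "p \<in> S"
    and eq: "\<And>y z. y \<in> S \<Longrightarrow> z \<in> S \<Longrightarrow> l y < l z \<longleftrightarrow> l' y < l' z"
  shows "\<exists>\<alpha>>0. \<forall>v. l' v = \<alpha> * l v"
proof -
  obtain \<rho> where \<rho>: "\<rho> > 0" "ball p \<rho> \<subseteq> S" using S open_contains_ball by blast
  have sign: "0 < l v \<longleftrightarrow> 0 < l' v" for v
  proof -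
    \<comment> \<open>Scaling by \<open>s\<close> keeps the translate of \<open>p\<close> along
      \<open>v\<close> in the ball; the added 1 takes care of \<open>v = 0\<close>.\<close>
    define s where "s = \<rho> / (2 * (norm v + 1))"
    have s: "s > 0" "s * norm v < \<rho>"
    proof -
      show "s > 0" unfolding s_def using \<rho>(1) by (intro divide_pos_pos) (auto intro: add_nonneg_pos)
      have "s * norm v \<le> s * (norm v + 1)" using \<open>s > 0\<close> by simp
      also have "\<dots> = \<rho> / 2"
        unfolding s_def using add_nonneg_pos[of "norm v" 1] by (simp add: field_simps)
      finally show "s * norm v < \<rho>" using \<rho>(1) by simp
    qed
    have "p + s *\<^sub>R v \<in> S" using \<rho>(2) s by (auto simp: dist_norm subset_iff)
    then have "l p < l (p + s *\<^sub>R v) \<longleftrightarrow> l' p < l' (p + s *\<^sub>R v)" using eq S(2) by blast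
    then show ?thesis
      using s(1) by (simp add: linear_add[OF l(1)] linear_add[OF l'] linear_scale[OF l(1)] linear_scale[OF l']
          zero_less_mult_iff)
  qed
  define u where "u = (1 / l w) *\<^sub>R w"
  have lu: "l u = 1" unfolding u_def using l by (simp add: linear_scale)
  have "0 < l' u" using sign[of u] lu by simp
  moreover have "l' v = l' u * l v" for v
  proof -
    define z where "z = v - l v *\<^sub>R u"
    have lz: "l z = 0" unfolding z_def using lu by (simp add: linear_diff[OF l(1)] linear_scale[OF l(1)])
    \<comment> \<open>\<open>l\<close> vanishes at \<open>z\<close> and at its negative, which bars
      a positive value of \<open>l'\<close> at either.\<close>
    have "\<not> 0 < l' z" "\<not> 0 < l' (- z)" using sign[of z] sign[of "- z"] lz by (auto simp: linear_neg[OF l(1)])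
    then have "l' z = 0" by (simp add: linear_neg[OF l'])
    then show ?thesis unfolding z_def by (simp add: linear_diff[OF l'] linear_scale[OF l'])
  qed
  ultimately show ?thesis by blast
qed

lemma continuous_on_locally_openin:
  fixes f :: "'a::topological_space \<Rightarrow> 'b::topological_space"
  assumes "\<And>x. x \<in> G \<Longrightarrow> \<exists>T. openin (top_of_set G) T \<and> x \<in> T \<and> continuous_on T f"
  shows "continuous_on G f"
proof (rule continuous_openin_preimage_eq[THEN iffD2], intro allI impI)
  fix S :: "'b set" assume S: "open S"
  show "openin (top_of_set G) (G \<inter> f -` S)"
  proof (rule openin_subopen[THEN iffD2], rule ballI)
    fix x assume x: "x \<in> G \<inter> f -` S"
    then obtain T where T: "openin (top_of_set G) T" "x \<in> T" "continuous_on T f" using assms by blast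
    have "openin (top_of_set T) (T \<inter> f -` S)" by (rule continuous_openin_preimage_gen[OF T(3) S])
    then have "openin (top_of_set G) (T \<inter> f -` S)" using T(1) by (rule openin_trans)
    moreover have "T \<subseteq> G" using openin_subset[OF T(1)] by simp
    ultimately show "\<exists>N. openin (top_of_set G) N \<and> x \<in> N \<and> N \<subseteq> G \<inter> f -` S"
      using T(2) x by (intro exI[of _ "T \<inter> f -` S"]) auto
  qed
qed

text \<open>The functions that are affine and not constant in affine charts, and increasing functions of the
  oriented distinguished maps.\<close>

definition tchart ::
    "'m::topological_space set \<Rightarrow> ('m, 'e::euclidean_space) chart set \<Rightarrow> ('m, real) chart set \<Rightarrow>
     'm set \<Rightarrow> ('m \<Rightarrow> real) \<Rightarrow> bool" where
  "tchart M A F G \<tau> \<longleftrightarrow> openin (top_of_set M) G \<and> (\<forall>x\<in>G.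
     (\<exists>V \<phi> T l w b. (V, \<phi>) \<in> A \<and> openin (top_of_set M) T \<and> x \<in> T \<and> T \<subseteq> G \<inter> V \<and>
        linear l \<and> l w \<noteq> 0 \<and> (\<forall>y\<in>T. \<tau> y = l (\<phi> y) + b)) \<and>
     (\<forall>W f. (W, f) \<in> F \<longrightarrow> x \<in> W \<longrightarrow> (\<exists>T. openin (top_of_set M) T \<and> x \<in> T \<and> T \<subseteq> G \<inter> W \<and>
        (\<forall>y\<in>T. \<forall>z\<in>T. f y < f z \<longleftrightarrow> \<tau> y < \<tau> z))))"

locale foliated_affine_manifold =
  fixes M :: "'m::topological_space set" and A :: "('m, 'e::euclidean_space) chart set"
    and F :: "('m, real) chart set"
  assumes affine_manifold: "affine_manifold M A" and compact_M: "compact M"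
    and foliation: "foliation M A F"
begin

abbreviation X :: "'m topology" where "X \<equiv> top_of_set M"

lemma atlas: "affine_atlas M A"
  using affine_manifold unfolding affine_manifold_def by blast

lemma affine_chart:
  assumes "(V, \<phi>) \<in> A"
  shows "openin X V" "open (\<phi> ` V)" "\<exists>\<psi>. homeomorphism V (\<phi> ` V) \<phi> \<psi>"
  using atlas assms unfolding affine_atlas_def by auto

lemma affine_chart_at:
  assumes "x \<in> M"
  shows "\<exists>V \<phi>. (V, \<phi>) \<in> A \<and> x \<in> V"
proof -
  have "x \<in> \<Union>(fst ` A)" using atlas assms unfolding affine_atlas_def by simp
  then show ?thesis by force
qed

lemma affine_transition:
  assumes "(V, \<phi>) \<in> A" "(W, \<psi>) \<in> A" "x \<in> V" "x \<in> W"
  shows "\<exists>T a. openin X T \<and> x \<in> T \<and> T \<subseteq> V \<inter> W \<and> affine_map a \<and> bij a \<and> (\<forall>y\<in>T. \<psi> y = a (\<phi> y))"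
proof -
  have "\<forall>(V, \<phi>)\<in>A. \<forall>(W, \<psi>)\<in>A. \<forall>x\<in>V \<inter> W.
        \<exists>T a. openin X T \<and> x \<in> T \<and> T \<subseteq> V \<inter> W \<and> affine_map a \<and> bij a \<and> (\<forall>y\<in>T. \<psi> y = a (\<phi> y))"
    using atlas unfolding affine_atlas_def by (elim conjE)
  from bspec[OF this assms(1), unfolded prod.case, THEN bspec[OF _ assms(2)], unfolded prod.case]
  show ?thesis using assms(3,4) by blast
qed

lemma affine_chart_image_open:
  assumes "(V, \<phi>) \<in> A" "openin X T" "T \<subseteq> V"
  shows "open (\<phi> ` T)"
proof -
  obtain \<psi> where h: "homeomorphism V (\<phi> ` V) \<phi> \<psi>" using affine_chart(3)[OF assms(1)] by blast
  have "V \<subseteq> M" using openin_subset[OF affine_chart(1)[OF assms(1)]] by simp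
  then have "openin (top_of_set V) T" using openin_subset_trans assms(2,3) by blast
  then have "openin (top_of_set (\<phi> ` V)) (\<phi> ` T)" by (rule homeomorphism_imp_open_map[OF h])
  then show ?thesis using affine_chart(2)[OF assms(1)] openin_open_trans by blast
qed

lemma F_open: "(W, f) \<in> F \<Longrightarrow> openin X W"
  using foliation unfolding foliation_def by fast

lemma F_cover: "x \<in> M \<Longrightarrow> \<exists>W f. (W, f) \<in> F \<and> x \<in> W"
  using foliation unfolding foliation_def by fastforce

lemma F_transition:
  assumes "c \<in> F" "c' \<in> F" "x \<in> fst c" "x \<in> fst c'"
  shows "\<exists>h. transition_germ M c c' x h"
proof -
  have "\<forall>c\<in>F. \<forall>c'\<in>F. \<forall>x\<in>fst c \<inter> fst c'. \<exists>h. transition_germ M c c' x h"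
    using foliation unfolding foliation_def by (elim conjE)
  then show ?thesis using assms by blast
qed

lemma F_preimage_open:
  assumes "(W, f) \<in> F" "open S"
  shows "openin X {y\<in>W. f y \<in> S}"
proof (rule openin_subopen[THEN iffD2], rule ballI)
  fix x assume x: "x \<in> {y\<in>W. f y \<in> S}"
  then have xM: "x \<in> M" using openin_subset[OF F_open[OF assms(1)]] by auto
  obtain V \<phi> where V: "(V, \<phi>) \<in> A" "x \<in> V" using affine_chart_at[OF xM] by blast
  have "\<forall>(W, f)\<in>F. openin X W \<and> (\<forall>(V, \<phi>)\<in>A. \<forall>x\<in>V \<inter> W.
           \<exists>T g. openin X T \<and> x \<in> T \<and> T \<subseteq> V \<inter> W \<and> submersion_at g (\<phi> x) \<and> (\<forall>y\<in>T. f y = g (\<phi> y)))"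
    using foliation unfolding foliation_def by (elim conjE)
  from bspec[OF this assms(1), unfolded prod.case, THEN conjunct2, THEN bspec[OF _ V(1)], unfolded prod.case]
  have "\<exists>T g. openin X T \<and> x \<in> T \<and> T \<subseteq> V \<inter> W \<and> submersion_at g (\<phi> x) \<and> (\<forall>y\<in>T. f y = g (\<phi> y))"
    using V(2) x by simp
  then obtain T g where T: "openin X T" "x \<in> T" "T \<subseteq> V \<inter> W" "submersion_at g (\<phi> x)" "\<forall>y\<in>T. f y = g (\<phi> y)"
    by (elim exE conjE)
  obtain S' where S': "open S'" "\<phi> x \<in> S'" "smooth_on S' g" using T(4) unfolding submersion_at_def by blast
  have "Ck_on 0 g S'" using S'(3) unfolding smooth_on_def by blast
  then have "continuous_on S' g" by simp
  then have O: "open (S' \<inter> g -` S)" using S'(1) assms(2) by (rule continuous_open_preimage)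
  obtain \<psi> where hom: "homeomorphism V (\<phi> ` V) \<phi> \<psi>" using affine_chart(3)[OF V(1)] by blast
  have "openin (top_of_set V) (V \<inter> \<phi> -` (S' \<inter> g -` S))"
    by (rule continuous_openin_preimage_gen[OF homeomorphism_cont1[OF hom] O])
  then have "openin X (V \<inter> \<phi> -` (S' \<inter> g -` S))" using affine_chart(1)[OF V(1)] by (rule openin_trans)
  then have "openin X (T \<inter> (V \<inter> \<phi> -` (S' \<inter> g -` S)))" using T(1) by (rule openin_Int[rotated])
  moreover have "x \<in> T \<inter> (V \<inter> \<phi> -` (S' \<inter> g -` S))" using T(2,5) V(2) S'(2) x by auto
  moreover have "T \<inter> (V \<inter> \<phi> -` (S' \<inter> g -` S)) \<subseteq> {y\<in>W. f y \<in> S}" using T(3,5) by auto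
  ultimately show "\<exists>N. openin X N \<and> x \<in> N \<and> N \<subseteq> {y\<in>W. f y \<in> S}"
    by (intro exI[of _ "T \<inter> (V \<inter> \<phi> -` (S' \<inter> g -` S))"] conjI)
qed

lemma tchart_open: "tchart M A F G \<tau> \<Longrightarrow> openin X G"
  unfolding tchart_def by blast

lemma tchart_order:
  assumes "tchart M A F G \<tau>" "x \<in> G" "(W, f) \<in> F" "x \<in> W"
  shows "\<exists>T. openin X T \<and> x \<in> T \<and> T \<subseteq> G \<inter> W \<and> (\<forall>y\<in>T. \<forall>z\<in>T. f y < f z \<longleftrightarrow> \<tau> y < \<tau> z)"
  using assms unfolding tchart_def by blast

text \<open>The definition provides one affine chart at each point, and an affine coordinate change
  carries the formula to any other. The change is bijective, so its linear part is onto and the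
  functional does not become zero.\<close>

lemma tchart_affine_in_chart:
  assumes "tchart M A F G \<tau>" "x \<in> G" "(V, \<phi>) \<in> A" "x \<in> V"
  shows "\<exists>T l w b. openin X T \<and> x \<in> T \<and> T \<subseteq> G \<inter> V \<and> linear l \<and> l w \<noteq> 0 \<and> (\<forall>y\<in>T. \<tau> y = l (\<phi> y) + b)"
proof -
  obtain V' \<phi>' T l w b where *: "(V', \<phi>') \<in> A" "openin X T" "x \<in> T" "T \<subseteq> G \<inter> V'"
      "linear l" "l w \<noteq> 0" "\<forall>y\<in>T. \<tau> y = l (\<phi>' y) + b"
    using assms(1,2) unfolding tchart_def by (elim conjE) (drule (1) bspec, elim conjE exE, blast)
  have xV': "x \<in> V'" using *(3,4) by blast
  obtain S a where S: "openin X S" "x \<in> S" "S \<subseteq> V \<inter> V'" "affine_map a" "bij a" "\<forall>y\<in>S. \<phi>' y = a (\<phi> y)"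
    using affine_transition[OF assms(3) *(1) assms(4) xV'] by (elim exE conjE)
  obtain m d where m: "linear m" "a = (\<lambda>x. m x + d)" using S(4) unfolding affine_map_def by blast
  have "\<exists>v. w + d = m v + d" using S(5) unfolding m(2) bij_def surj_def by blast
  then obtain v where "m v = w" by auto
  then have "(l \<circ> m) v \<noteq> 0" "linear (l \<circ> m)" using *(5,6) m(1) linear_compose by auto
  moreover have "\<forall>y\<in>T \<inter> S. \<tau> y = (l \<circ> m) (\<phi> y) + (l d + b)"
    using *(7) S(6) m(2) by (simp add: linear_add[OF *(5)])
  ultimately show ?thesis
    using * S by (intro exI[of _ "T \<inter> S"] exI[of _ "l \<circ> m"] exI[of _ v] exI[of _ "l d + b"]) auto
qed

text \<open>Both functions are affine in a common affine chart and both are ordered like the same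
  distinguished map, so their linear parts are positive multiples of each other.\<close>

lemma tchart_transition:
  assumes "tchart M A F G \<tau>" "tchart M A F G' \<tau>'" "x \<in> G" "x \<in> G'"
  shows "\<exists>T \<alpha> \<beta>. openin X T \<and> x \<in> T \<and> T \<subseteq> G \<inter> G' \<and> 0 < \<alpha> \<and> (\<forall>y\<in>T. \<tau>' y = \<alpha> * \<tau> y + \<beta>)"
proof -
  have xM: "x \<in> M" using openin_subset[OF tchart_open[OF assms(1)]] assms(3) by auto
  then obtain V \<phi> where V: "(V, \<phi>) \<in> A" "x \<in> V" using affine_chart_at by blast
  obtain W f where W: "(W, f) \<in> F" "x \<in> W" using F_cover[OF xM] by blast
  obtain T l w b where T: "openin X T" "x \<in> T" "T \<subseteq> G \<inter> V" "linear l" "l w \<noteq> 0" "\<forall>y\<in>T. \<tau> y = l (\<phi> y) + b"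
    using tchart_affine_in_chart[OF assms(1,3) V] by (elim exE conjE)
  obtain T' l' w' b' where T': "openin X T'" "x \<in> T'" "T' \<subseteq> G' \<inter> V" "linear l'" "\<forall>y\<in>T'. \<tau>' y = l' (\<phi> y) + b'"
    using tchart_affine_in_chart[OF assms(2,4) V] by (elim exE conjE)
  obtain S where S: "openin X S" "x \<in> S" "\<forall>y\<in>S. \<forall>z\<in>S. f y < f z \<longleftrightarrow> \<tau> y < \<tau> z"
    using tchart_order[OF assms(1,3) W] by (elim exE conjE)
  obtain S' where S': "openin X S'" "x \<in> S'" "\<forall>y\<in>S'. \<forall>z\<in>S'. f y < f z \<longleftrightarrow> \<tau>' y < \<tau>' z"
    using tchart_order[OF assms(2,4) W] by (elim exE conjE)
  define N where "N = T \<inter> T' \<inter> S \<inter> S'"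
  have N: "openin X N" "x \<in> N" "N \<subseteq> V" unfolding N_def using T T' S S' by (auto intro!: openin_Int)
  have "\<exists>\<alpha>>0. \<forall>v. l' v = \<alpha> * l v"
  proof (rule proportional_functionals[OF T(4,5) T'(4) affine_chart_image_open[OF V(1) N(1,3)]])
    show "\<phi> x \<in> \<phi> ` N" using N(2) by blast
    fix p q assume "p \<in> \<phi> ` N" "q \<in> \<phi> ` N"
    then obtain y z where "y \<in> N" "p = \<phi> y" "z \<in> N" "q = \<phi> z" by blast
    moreover have "\<tau> y < \<tau> z \<longleftrightarrow> \<tau>' y < \<tau>' z" using S(3) S'(3) \<open>y \<in> N\<close> \<open>z \<in> N\<close> unfolding N_def by auto
    ultimately show "l p < l q \<longleftrightarrow> l' p < l' q" using T(6) T'(5) unfolding N_def by auto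
  qed
  then obtain \<alpha> where \<alpha>: "\<alpha> > 0" "\<forall>v. l' v = \<alpha> * l v" by blast
  have "\<forall>y\<in>N. \<tau>' y = \<alpha> * \<tau> y + (b' - \<alpha> * b)"
    using T(6) T'(5) \<alpha>(2) unfolding N_def by (simp add: algebra_simps)
  then show ?thesis
    using N(1,2) \<alpha>(1) T(3) T'(3)
    by (intro exI[of _ N] exI[of _ \<alpha>] exI[of _ "b' - \<alpha> * b"]) (auto simp: N_def)
qed

lemma tchart_local:
  assumes "openin X G"
    and loc: "\<And>x. x \<in> G \<Longrightarrow> \<exists>H \<mu> T. tchart M A F H \<mu> \<and> openin X T \<and> x \<in> T \<and> T \<subseteq> H \<and> (\<forall>y\<in>T. \<tau> y = \<mu> y)"
  shows "tchart M A F G \<tau>"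
  unfolding tchart_def
proof (intro conjI assms(1) ballI allI impI)
  fix x assume x: "x \<in> G"
  obtain H \<mu> T where H: "tchart M A F H \<mu>" "openin X T" "x \<in> T" "T \<subseteq> H" "\<forall>y\<in>T. \<tau> y = \<mu> y"
    using loc[OF x] by (elim exE conjE)
  have xM: "x \<in> M" using openin_subset[OF assms(1)] x by auto
  then obtain V \<phi> where V: "(V, \<phi>) \<in> A" "x \<in> V" using affine_chart_at by blast
  have xH: "x \<in> H" using H by blast
  obtain S l w b where S: "openin X S" "x \<in> S" "S \<subseteq> H \<inter> V" "linear l" "l w \<noteq> 0" "\<forall>y\<in>S. \<mu> y = l (\<phi> y) + b"
    using tchart_affine_in_chart[OF H(1) xH V] by (elim exE conjE)
  show "\<exists>V \<phi> T l w b. (V, \<phi>) \<in> A \<and> openin X T \<and> x \<in> T \<and> T \<subseteq> G \<inter> V \<and>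
        linear l \<and> l w \<noteq> 0 \<and> (\<forall>y\<in>T. \<tau> y = l (\<phi> y) + b)"
    using V(1) S H(2,3,5) x assms(1)
    by (intro exI[of _ V] exI[of _ \<phi>] exI[of _ "S \<inter> T \<inter> G"] exI[of _ l] exI[of _ w] exI[of _ b]) auto
  fix W f assume W: "(W, f) \<in> F" "x \<in> W"
  obtain S where S: "openin X S" "x \<in> S" "S \<subseteq> H \<inter> W" "\<forall>y\<in>S. \<forall>z\<in>S. f y < f z \<longleftrightarrow> \<mu> y < \<mu> z"
    using tchart_order[OF H(1) xH W] by (elim exE conjE)
  show "\<exists>T. openin X T \<and> x \<in> T \<and> T \<subseteq> G \<inter> W \<and> (\<forall>y\<in>T. \<forall>z\<in>T. f y < f z \<longleftrightarrow> \<tau> y < \<tau> z)"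
    using S H(2,3,5) x assms(1) by (intro exI[of _ "S \<inter> T \<inter> G"]) auto
qed

lemma tchart_affine:
  assumes "tchart M A F G \<tau>" "0 < \<alpha>"
  shows "tchart M A F G (\<lambda>y. \<alpha> * \<tau> y + \<beta>)"
  unfolding tchart_def
proof (intro conjI ballI allI impI)
  show "openin X G" by (rule tchart_open[OF assms(1)])
  fix x assume x: "x \<in> G"
  have xM: "x \<in> M" using openin_subset[OF tchart_open[OF assms(1)]] x by auto
  then obtain V \<phi> where V: "(V, \<phi>) \<in> A" "x \<in> V" using affine_chart_at by blast
  obtain S l w b where S: "openin X S" "x \<in> S" "S \<subseteq> G \<inter> V" "linear l" "l w \<noteq> 0" "\<forall>y\<in>S. \<tau> y = l (\<phi> y) + b"
    using tchart_affine_in_chart[OF assms(1) x V] by (elim exE conjE)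
  have "linear (\<lambda>v. \<alpha> * l v)" using linear_compose_scale_right[OF S(4), of \<alpha>] by simp
  then show "\<exists>V \<phi> T l w b. (V, \<phi>) \<in> A \<and> openin X T \<and> x \<in> T \<and> T \<subseteq> G \<inter> V \<and>
        linear l \<and> l w \<noteq> 0 \<and> (\<forall>y\<in>T. \<alpha> * \<tau> y + \<beta> = l (\<phi> y) + b)"
    using V(1) S assms(2)
    by (intro exI[of _ V] exI[of _ \<phi>] exI[of _ S] exI[of _ "\<lambda>v. \<alpha> * l v"] exI[of _ w]
        exI[of _ "\<alpha> * b + \<beta>"]) (simp add: algebra_simps)
  fix W f assume W: "(W, f) \<in> F" "x \<in> W"
  show "\<exists>T. openin X T \<and> x \<in> T \<and> T \<subseteq> G \<inter> W \<and>
      (\<forall>y\<in>T. \<forall>z\<in>T. f y < f z \<longleftrightarrow> \<alpha> * \<tau> y + \<beta> < \<alpha> * \<tau> z + \<beta>)"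
    using tchart_order[OF assms(1) x W] assms(2) by simp
qed

text \<open>In an affine chart the box is a ball cut by a slab between parallel hyperplanes: plaques
  are convex slices and the transversal is a straight segment. Paths inside plaques are part of the
  conclusion because holonomy is defined along paths in leaves.\<close>

lemma tchart_box:
  assumes H: "tchart M A F H \<tau>" "x \<in> H" and V: "openin X V" "x \<in> V"
  shows "\<exists>G \<epsilon> \<sigma>. box X H \<tau> x G \<epsilon> \<sigma> \<and> G \<subseteq> V \<and> (\<forall>y\<in>G. \<forall>z\<in>G. \<tau> y = \<tau> z \<longrightarrow>
    (\<exists>\<delta>. pathin X \<delta> \<and> \<delta> 0 = y \<and> \<delta> 1 = z \<and> \<delta> ` {0..1} \<subseteq> {w\<in>G. \<tau> w = \<tau> z}))"
proof -
  have xM: "x \<in> M" using openin_subset[OF tchart_open[OF H(1)]] H(2) by auto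
  then obtain C \<phi> where C: "(C, \<phi>) \<in> A" "x \<in> C" using affine_chart_at by blast
  obtain T l w b where T: "openin X T" "x \<in> T" "T \<subseteq> H \<inter> C" "linear l" "l w \<noteq> 0" "\<forall>y\<in>T. \<tau> y = l (\<phi> y) + b"
    using tchart_affine_in_chart[OF H C] by (elim exE conjE)
  obtain \<psi> where hom: "homeomorphism C (\<phi> ` C) \<phi> \<psi>" using affine_chart(3)[OF C(1)] by blast
  have CM: "C \<subseteq> M" using openin_subset[OF affine_chart(1)[OF C(1)]] by simp
  define u where "u = (1 / l w) *\<^sub>R w"
  have lu: "l u = 1" unfolding u_def using T(4,5) by (simp add: linear_scale)
  then have u0: "u \<noteq> 0" using linear_0[OF T(4)] by auto
  have "open (\<phi> ` (T \<inter> V))" by (rule affine_chart_image_open[OF C(1)]) (use T V in auto)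
  then obtain \<rho> where \<rho>: "\<rho> > 0" "ball (\<phi> x) \<rho> \<subseteq> \<phi> ` (T \<inter> V)"
    using T(2) V(2) open_contains_ball by blast
  \<comment> \<open>A displacement along \<open>u\<close> by a factor less than \<epsilon> has
    length less than \<rho>, so the transversal stays in the ball.\<close>
  define \<epsilon> where "\<epsilon> = \<rho> / norm u"
  have \<epsilon>: "\<epsilon> > 0" unfolding \<epsilon>_def using \<rho>(1) u0 by simp
  have lcont: "continuous_on UNIV l" using T(4) by (simp add: linear_continuous_on linear_conv_bounded_linear)
  have \<tau>x: "\<tau> x = l (\<phi> x) + b" using T(2,6) by blast
  define B where "B = ball (\<phi> x) \<rho> \<inter> l -` {\<tau> x - \<epsilon> - b<..<\<tau> x + \<epsilon> - b}"
  have Bo: "open B" unfolding B_def using lcont by (intro open_Int open_vimage) auto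
  have BTV: "B \<subseteq> \<phi> ` (T \<inter> V)" using \<rho>(2) unfolding B_def by blast
  have TC: "T \<subseteq> C" "T \<subseteq> H" using T(3) by auto
  have \<psi>: "\<psi> p \<in> T" "\<psi> p \<in> V" "\<phi> (\<psi> p) = p" "\<tau> (\<psi> p) = l p + b" if p: "p \<in> B" for p
  proof -
    obtain y where y: "y \<in> T" "y \<in> V" "p = \<phi> y" using BTV p by blast
    then have "\<psi> p = y" using homeomorphism_apply1[OF hom] TC(1) by blast
    then show "\<psi> p \<in> T" "\<psi> p \<in> V" "\<phi> (\<psi> p) = p" "\<tau> (\<psi> p) = l p + b" using y T(6) by auto
  qed
  have \<psi>cont: "continuous_map (top_of_set B) X \<psi>"
  proof -
    have "B \<subseteq> \<phi> ` C" using BTV TC(1) by blast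
    then have "continuous_on B \<psi>" using homeomorphism_cont2[OF hom] continuous_on_subset by blast
    then show ?thesis using \<psi>(1) TC(1) CM by auto
  qed
  define G where "G = {y \<in> T \<inter> V. \<phi> y \<in> B}"
  have G\<psi>: "G = \<psi> ` B"
  proof
    show "G \<subseteq> \<psi> ` B"
    proof
      fix y assume y: "y \<in> G"
      then have "\<psi> (\<phi> y) = y" "\<phi> y \<in> B" using homeomorphism_apply1[OF hom] TC(1) unfolding G_def by auto
      then show "y \<in> \<psi> ` B" by (metis imageI)
    qed
    show "\<psi> ` B \<subseteq> G" using \<psi> unfolding G_def by auto
  qed
  have Go: "openin X G"
  proof -
    have "openin (top_of_set C) (C \<inter> \<phi> -` B)"
      by (rule continuous_openin_preimage_gen[OF homeomorphism_cont1[OF hom] Bo])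
    then have "openin X (C \<inter> \<phi> -` B)" using affine_chart(1)[OF C(1)] openin_trans by blast
    moreover have "G = T \<inter> V \<inter> (C \<inter> \<phi> -` B)" using TC(1) unfolding G_def by blast
    ultimately show ?thesis using T(1) V(1) by (simp add: openin_Int)
  qed
  have xB: "\<phi> x \<in> B" unfolding B_def using \<rho>(1) \<epsilon> \<tau>x by auto
  have lev: "{y\<in>G. \<tau> y = t} = \<psi> ` (B \<inter> {p. l p = t - b})" for t
    unfolding G\<psi> using \<psi>(4) by force
  have cvx: "convex (B \<inter> {p. l p = t - b})" for t
  proof -
    have "B \<inter> {p. l p = t - b} = ball (\<phi> x) \<rho> \<inter> l -` ({\<tau> x - \<epsilon> - b<..<\<tau> x + \<epsilon> - b} \<inter> {t - b})"
      unfolding B_def by auto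
    moreover have "convex (l -` ({\<tau> x - \<epsilon> - b<..<\<tau> x + \<epsilon> - b} \<inter> {t - b}))"
      by (rule convex_linear_vimage[OF T(4)]) (auto intro: convex_Int)
    ultimately show ?thesis by (simp add: convex_Int)
  qed
  define \<sigma> where "\<sigma> t = \<psi> (\<phi> x + (t - \<tau> x) *\<^sub>R u)" for t
  have tB: "\<phi> x + (t - \<tau> x) *\<^sub>R u \<in> B" if t: "t \<in> {\<tau> x - \<epsilon><..<\<tau> x + \<epsilon>}" for t
  proof -
    have "\<bar>t - \<tau> x\<bar> < \<epsilon>" using t by auto
    then have "\<bar>t - \<tau> x\<bar> * norm u < \<rho>" unfolding \<epsilon>_def using u0 by (simp add: field_simps)
    moreover have "l (\<phi> x + (t - \<tau> x) *\<^sub>R u) = t - b"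
      using lu \<tau>x by (simp add: linear_add[OF T(4)] linear_scale[OF T(4)])
    ultimately show ?thesis unfolding B_def using t by (simp add: dist_norm)
  qed
  have "box X H \<tau> x G \<epsilon> \<sigma>"
    unfolding box_def
  proof (intro conjI allI ballI)
    show "openin X G" by (rule Go)
    show "x \<in> G" using T(2) V(2) xB unfolding G_def by blast
    show "G \<subseteq> H" using TC(2) unfolding G_def by blast
    show "0 < \<epsilon>" by (rule \<epsilon>)
    show "\<tau> ` G \<subseteq> {\<tau> x - \<epsilon><..<\<tau> x + \<epsilon>}" unfolding G\<psi> using \<psi>(4) by (auto simp: B_def)
    show "connectedin X {y\<in>G. \<tau> y = t}" for t
    proof -
      have "connectedin (top_of_set B) (B \<inter> {p. l p = t - b})"
        using convex_connected[OF cvx] by (simp add: connectedin_subtopology)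
      then show ?thesis unfolding lev by (rule connectedin_continuous_map_image[OF \<psi>cont])
    qed
    have "continuous_map (top_of_set {\<tau> x - \<epsilon><..<\<tau> x + \<epsilon>}) (top_of_set B) (\<lambda>t. \<phi> x + (t - \<tau> x) *\<^sub>R u)"
      using tB by (auto intro!: continuous_intros)
    then show "continuous_map (top_of_set {\<tau> x - \<epsilon><..<\<tau> x + \<epsilon>}) X \<sigma>"
      using continuous_map_compose[OF _ \<psi>cont] unfolding \<sigma>_def comp_def by blast
    show "\<sigma> (\<tau> x) = x" unfolding \<sigma>_def using homeomorphism_apply1[OF hom C(2)] by simp
    fix t assume t: "t \<in> {\<tau> x - \<epsilon><..<\<tau> x + \<epsilon>}"
    show "\<sigma> t \<in> G" unfolding \<sigma>_def G\<psi> using tB[OF t] by blast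
    show "\<tau> (\<sigma> t) = t"
      unfolding \<sigma>_def \<psi>(4)[OF tB[OF t]] using lu \<tau>x
      by (simp add: linear_add[OF T(4)] linear_scale[OF T(4)])
  qed
  moreover have "G \<subseteq> V" unfolding G_def by blast
  moreover have "\<exists>\<delta>. pathin X \<delta> \<and> \<delta> 0 = y \<and> \<delta> 1 = z \<and> \<delta> ` {0..1} \<subseteq> {w\<in>G. \<tau> w = \<tau> z}"
    if yz: "y \<in> G" "z \<in> G" "\<tau> y = \<tau> z" for y z
  proof -
    let ?S = "B \<inter> {p. l p = \<tau> z - b}"
    have "y \<in> \<psi> ` ?S" "z \<in> \<psi> ` ?S" using yz unfolding lev[symmetric] by auto
    then obtain p q where pq: "p \<in> ?S" "y = \<psi> p" "q \<in> ?S" "z = \<psi> q" by blast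
    have seg: "linepath p q t \<in> ?S" if "t \<in> {0..1}" for t
    proof -
      have "linepath p q t \<in> closed_segment p q" using that by (metis imageI linepath_image_01)
      then show ?thesis using closed_segment_subset[OF pq(1,3) cvx] by blast
    qed
    have "continuous_map (top_of_set {0..1}) (top_of_set B) (linepath p q)"
      using seg by (auto intro!: continuous_on_linepath)
    then have "pathin X (\<psi> \<circ> linepath p q)"
      unfolding pathin_def by (rule continuous_map_compose[OF _ \<psi>cont])
    moreover have "(\<psi> \<circ> linepath p q) ` {0..1} \<subseteq> {w\<in>G. \<tau> w = \<tau> z}" unfolding lev using seg by auto
    moreover have "(\<psi> \<circ> linepath p q) 0 = y" "(\<psi> \<circ> linepath p q) 1 = z" using pq by (simp_all add: linepath_def)
    ultimately show ?thesis by blast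
  qed
  ultimately show ?thesis by blast
qed

lemma tchart_continuous:
  assumes "tchart M A F G \<tau>"
  shows "continuous_map (subtopology X G) euclideanreal \<tau>"
proof -
  have GM: "G \<subseteq> M" using openin_subset[OF tchart_open[OF assms]] by simp
  have loc: "\<exists>T. openin (top_of_set G) T \<and> x \<in> T \<and> continuous_on T \<tau>" if x: "x \<in> G" for x
  proof -
    obtain V \<phi> where V: "(V, \<phi>) \<in> A" "x \<in> V" using affine_chart_at GM x by blast
    obtain S l w b where S: "openin X S" "x \<in> S" "S \<subseteq> G \<inter> V" "linear l" "l w \<noteq> 0" "\<forall>y\<in>S. \<tau> y = l (\<phi> y) + b"
      using tchart_affine_in_chart[OF assms x V] by (elim exE conjE)
    obtain \<psi> where hom: "homeomorphism V (\<phi> ` V) \<phi> \<psi>" using affine_chart(3)[OF V(1)] by blast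
    have "continuous_on S \<phi>" using homeomorphism_cont1[OF hom] S(3) continuous_on_subset by blast
    moreover have "bounded_linear l" using S(4) by (simp add: linear_conv_bounded_linear)
    ultimately have "continuous_on S (\<lambda>y. l (\<phi> y))" by (rule bounded_linear.continuous_on[rotated])
    then have "continuous_on S (\<lambda>y. l (\<phi> y) + b)" by (rule continuous_on_add[OF _ continuous_on_const])
    then have "continuous_on S \<tau>" using S(6) by (simp cong: continuous_on_cong)
    moreover have "openin (top_of_set G) S" using openin_subset_trans[OF S(1) _ GM] S(3) by blast
    ultimately show ?thesis using S(2) by blast
  qed
  have "continuous_on G \<tau>" by (rule continuous_on_locally_openin[OF loc])
  moreover have "subtopology X G = top_of_set G" using GM by (simp add: subtopology_subtopology inf_absorb2)
  ultimately show ?thesis by simp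
qed

end

text \<open>The extra assumption is what linearity of the foliation and the transverse orientation
  jointly provide; the theory of tubes then becomes available through the sublocale.\<close>

locale oriented_affine_foliation = foliated_affine_manifold M A F
  for M :: "'m::topological_space set" and A :: "('m, 'e::euclidean_space) chart set"
    and F :: "('m, real) chart set" +
  assumes tchart_exists: "\<And>x. x \<in> M \<Longrightarrow> \<exists>G \<tau>. tchart M A F G \<tau> \<and> x \<in> G"
begin

sublocale transverse_affine X "tchart M A F"
proof
  show "compact_space X" using compact_M by (simp add: compact_space_subtopology)
  show "Hausdorff_space X" "connected_space X"
    using affine_manifold unfolding affine_manifold_def by (auto simp: connected_space_subtopology)
  show "\<exists>G \<tau>. tchart M A F G \<tau> \<and> x \<in> G" if "x \<in> topspace X" for x using tchart_exists that by simp
  show "\<exists>G \<epsilon> \<sigma>. box X H \<tau> x G \<epsilon> \<sigma> \<and> G \<subseteq> V"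
    if "tchart M A F H \<tau>" "x \<in> H" "openin X V" "x \<in> V" for H \<tau> x V
    using tchart_box[OF that] by meson
  fix G H :: "'m set" and \<tau> \<mu> :: "'m \<Rightarrow> real"
  show "openin X G" if "tchart M A F G \<tau>" by (rule tchart_open[OF that])
  show "continuous_map (subtopology X G) euclideanreal \<tau>" if "tchart M A F G \<tau>"
    by (rule tchart_continuous[OF that])
  show "tchart M A F G \<tau>"
    if "openin X G" "\<And>x. x \<in> G \<Longrightarrow>
      \<exists>H \<mu> T. tchart M A F H \<mu> \<and> openin X T \<and> x \<in> T \<and> T \<subseteq> H \<and> (\<forall>y\<in>T. \<tau> y = \<mu> y)"
    by (rule tchart_local[OF that])
  show "tchart M A F G (\<lambda>y. \<alpha> * \<tau> y + \<beta>)" if "tchart M A F G \<tau>" "0 < \<alpha>" for \<alpha> \<beta>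
    by (rule tchart_affine[OF that])
  show "\<exists>T \<alpha> \<beta>. openin X T \<and> x \<in> T \<and> T \<subseteq> G \<inter> H \<and> 0 < \<alpha> \<and> (\<forall>y\<in>T. \<mu> y = \<alpha> * \<tau> y + \<beta>)"
    if "tchart M A F G \<tau>" "tchart M A F H \<mu>" "x \<in> G" "x \<in> H" for x
    by (rule tchart_transition[OF that])
qed

end

section \<open>Leaves\<close>

context oriented_affine_foliation
begin

abbreviation Y :: "'m topology" where "Y \<equiv> leaf_topology M F"

lemma leaf_topology_basis:
  assumes "(W, f) \<in> F" "openin X T"
  shows "openin Y (T \<inter> (W \<inter> f -` {c}))"
  unfolding leaf_topology_def by (rule topology_generated_by_Basis) (use assms in blast)

lemma topspace_leaf_topology: "topspace Y = M"
proof
  show "M \<subseteq> topspace Y"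
  proof
    fix x assume x: "x \<in> M"
    obtain W f where W: "(W, f) \<in> F" "x \<in> W" using F_cover[OF x] by blast
    have "openin X M" by simp
    from openin_subset[OF leaf_topology_basis[OF W(1) this, of "f x"]] show "x \<in> topspace Y" using W(2) x by blast
  qed
  show "topspace Y \<subseteq> M" unfolding leaf_topology_def by (auto dest: openin_imp_subset)
qed

lemma leaf_topology_finer:
  assumes "openin X T"
  shows "openin Y T"
proof (rule openin_subopen[THEN iffD2], rule ballI)
  fix x assume x: "x \<in> T"
  then have "x \<in> M" using openin_subset[OF assms] by auto
  then obtain W f where W: "(W, f) \<in> F" "x \<in> W" using F_cover by blast
  show "\<exists>N. openin Y N \<and> x \<in> N \<and> N \<subseteq> T"
    using leaf_topology_basis[OF W(1) assms, of "f x"] W(2) x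
    by (intro exI[of _ "T \<inter> (W \<inter> f -` {f x})"]) auto
qed

lemma leaf_topology_closed: "closedin X S \<Longrightarrow> closedin Y S"
  using leaf_topology_finer[of "topspace X - S"] topspace_leaf_topology by (simp add: closedin_def)

lemma continuous_map_leaf_topology: "continuous_map Y X id"
proof -
  have "{x \<in> M. x \<in> U} = U" if "openin X U" for U using openin_subset[OF that] by auto
  then show ?thesis using topspace_leaf_topology leaf_topology_finer by (simp add: continuous_map)
qed

text \<open>Near each point a chart and a distinguished map induce the same order and so have the
  same levels.\<close>

lemma level_leaf_open:
  assumes H: "tchart M A F H \<tau>"
  shows "openin Y {y\<in>H. \<tau> y = c}"
proof (rule openin_subopen[THEN iffD2], rule ballI)
  fix x assume x: "x \<in> {y\<in>H. \<tau> y = c}"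
  then have "x \<in> M" using openin_subset[OF tchart_open[OF H]] by auto
  then obtain W f where W: "(W, f) \<in> F" "x \<in> W" using F_cover by blast
  have xH: "x \<in> H" using x by blast
  obtain T where T: "openin X T" "x \<in> T" "T \<subseteq> H \<inter> W" "\<forall>y\<in>T. \<forall>z\<in>T. f y < f z \<longleftrightarrow> \<tau> y < \<tau> z"
    using tchart_order[OF H xH W] by (elim exE conjE)
  have lev: "\<tau> y = c" if "y \<in> T" "f y = f x" for y
  proof -
    have "\<tau> y = \<tau> x"
      using T(4)[rule_format, OF that(1) T(2)] T(4)[rule_format, OF T(2) that(1)] that(2) by linarith
    then show ?thesis using x by simp
  qed
  have "T \<inter> (W \<inter> f -` {f x}) \<subseteq> {y\<in>H. \<tau> y = c}"
  proof
    fix y assume "y \<in> T \<inter> (W \<inter> f -` {f x})"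
    then show "y \<in> {y\<in>H. \<tau> y = c}" using lev[of y] T(3) by blast
  qed
  moreover have "x \<in> T \<inter> (W \<inter> f -` {f x})" using T(2) W(2) by simp
  ultimately show "\<exists>N. openin Y N \<and> x \<in> N \<and> N \<subseteq> {y\<in>H. \<tau> y = c}"
    using leaf_topology_basis[OF W(1) T(1), of "f x"] by (intro exI[of _ "T \<inter> (W \<inter> f -` {f x})"] conjI)
qed

text \<open>The leaf topology is finer than that of \<open>M\<close>, but on one level of a chart it
  adds nothing, since a distinguished map is locally constant there. The induction follows the
  generation of the topology and keeps a pointwise form of the claim, which passes to intersections
  and unions.\<close>

lemma leaf_open_in_level:
  assumes H: "tchart M A F H \<tau>" and S: "S \<subseteq> {y\<in>H. \<tau> y = c}" and U: "openin Y U"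
  shows "\<exists>V. openin X V \<and> U \<inter> S = V \<inter> S"
proof -
  have "generate_topology_on {T \<inter> (W \<inter> f -` {c}) |T W f c. openin X T \<and> (W, f) \<in> F} U"
    using U unfolding leaf_topology_def by (rule openin_topology_generated_by)
  then have "\<forall>x\<in>U \<inter> S. \<exists>N. openin X N \<and> x \<in> N \<and> N \<inter> S \<subseteq> U"
  proof induction
    case (Int a b)
    show ?case
    proof
      fix x assume "x \<in> a \<inter> b \<inter> S"
      then have "x \<in> a \<inter> S" "x \<in> b \<inter> S" by auto
      from bspec[OF Int.IH(1) this(1)] bspec[OF Int.IH(2) this(2)]
      obtain N N' where "openin X N" "x \<in> N" "N \<inter> S \<subseteq> a" "openin X N'" "x \<in> N'" "N' \<inter> S \<subseteq> b"
        by (elim exE conjE)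
      then have "openin X (N \<inter> N')" "x \<in> N \<inter> N'" "N \<inter> N' \<inter> S \<subseteq> a \<inter> b" by blast+
      then show "\<exists>N. openin X N \<and> x \<in> N \<and> N \<inter> S \<subseteq> a \<inter> b" by (intro exI[of _ "N \<inter> N'"] conjI)
    qed
  next
    case (UN K)
    show ?case
    proof
      fix x assume "x \<in> \<Union>K \<inter> S"
      then obtain k where k: "k \<in> K" "x \<in> k \<inter> S" by blast
      then obtain N where "openin X N" "x \<in> N" "N \<inter> S \<subseteq> k" using UN.IH by blast
      then show "\<exists>N. openin X N \<and> x \<in> N \<and> N \<inter> S \<subseteq> \<Union>K" using k(1) by blast
    qed
  next
    case (Basis s)
    then obtain T W f d where s: "s = T \<inter> (W \<inter> f -` {d})" "openin X T" "(W, f) \<in> F" by blast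
    show ?case
    proof
      fix x assume x: "x \<in> s \<inter> S"
      then have xW: "x \<in> H" "x \<in> W" using s(1) S by auto
      obtain N where N: "openin X N" "x \<in> N" "N \<subseteq> H \<inter> W" "\<forall>y\<in>N. \<forall>z\<in>N. f y < f z \<longleftrightarrow> \<tau> y < \<tau> z"
        using tchart_order[OF H xW(1) s(3) xW(2)] by (elim exE conjE)
      have lev: "f y = d" if "y \<in> N" "y \<in> S" for y
      proof -
        have "\<tau> y = \<tau> x" using that x S by auto
        then show ?thesis
          using N(4)[rule_format, OF that(1) N(2)] N(4)[rule_format, OF N(2) that(1)] x s(1) by force
      qed
      have "N \<inter> T \<inter> S \<subseteq> s"
      proof
        fix y assume "y \<in> N \<inter> T \<inter> S"
        then show "y \<in> s" using lev[of y] N(3) s(1) by blast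
      qed
      moreover have "openin X (N \<inter> T)" "x \<in> N \<inter> T" using N(1,2) s(1,2) x by (auto intro: openin_Int)
      ultimately show "\<exists>N. openin X N \<and> x \<in> N \<and> N \<inter> S \<subseteq> s" by (intro exI[of _ "N \<inter> T"] conjI)
    qed
  qed simp
  then have "U \<inter> S = \<Union>{N. openin X N \<and> N \<inter> S \<subseteq> U} \<inter> S" by blast
  moreover have "openin X (\<Union>{N. openin X N \<and> N \<inter> S \<subseteq> U})" by blast
  ultimately show ?thesis by blast
qed

lemma subtopology_level:
  assumes "tchart M A F H \<tau>" "S \<subseteq> {y\<in>H. \<tau> y = c}"
  shows "subtopology Y S = subtopology X S"
  unfolding topology_eq
proof (intro allI iffI)
  fix V
  {
    assume "openin (subtopology Y S) V"
    then obtain U where "openin Y U" "V = U \<inter> S" unfolding openin_subtopology by blast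
    moreover obtain V' where "openin X V'" "U \<inter> S = V' \<inter> S"
      using leaf_open_in_level[OF assms \<open>openin Y U\<close>] by (elim exE conjE)
    ultimately show "openin (subtopology X S) V" unfolding openin_subtopology by metis
  }
  assume "openin (subtopology X S) V"
  then obtain U where U: "openin X U" "V = U \<inter> S" unfolding openin_subtopology by blast
  then show "openin (subtopology Y S) V"
    unfolding openin_subtopology using leaf_topology_finer[OF U(1)] by (intro exI[of _ U] conjI)
qed

lemma level_connected:
  assumes "tchart M A F H \<tau>" "S \<subseteq> {y\<in>H. \<tau> y = c}" "connectedin X S"
  shows "connectedin Y S"
  using assms(3) connectedin_subset_topspace[OF assms(3)] topspace_leaf_topology
  unfolding connectedin_def subtopology_level[OF assms(1,2)] by simp

lemma level_path:
  assumes "tchart M A F H \<tau>" "S \<subseteq> {y\<in>H. \<tau> y = c}" "pathin X \<delta>" "\<delta> ` {0..1} \<subseteq> S"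
  shows "pathin Y \<delta>"
proof -
  have "pathin (subtopology X S) \<delta>" using assms(3,4) unfolding pathin_subtopology by blast
  then have "pathin (subtopology Y S) \<delta>" unfolding subtopology_level[OF assms(1,2)] .
  then show ?thesis unfolding pathin_subtopology by blast
qed

text \<open>The level is open in the leaf topology, closed there because it is closed in
  \<open>M\<close>, and connected, hence a component; both topologies agree on it, so it stays
  compact.\<close>

lemma compact_level_is_leaf:
  assumes H: "tchart M A F H \<tau>" and S: "S = {y\<in>H. \<tau> y = c}" "connectedin X S" "closedin X S" "S \<noteq> {}"
  shows "compact_leaf M F S"
proof -
  have SS: "S \<subseteq> {y\<in>H. \<tau> y = c}" using S(1) by blast
  obtain x where x: "x \<in> S" using S(4) by blast
  have xY: "x \<in> topspace Y" using closedin_subset[OF S(3)] x topspace_leaf_topology by auto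
  let ?C = "connected_component_of_set Y x"
  have "S \<subseteq> ?C"
    using level_connected[OF H SS S(2)] x by (rule connected_component_of_maximal)
  moreover have "?C \<subseteq> S"
  proof (rule connectedin_subset_closedin[OF connectedin_connected_component_of leaf_topology_closed[OF S(3)]])
    show "?C \<inter> S \<noteq> {}" using x \<open>S \<subseteq> ?C\<close> by blast
    show "\<exists>T. openin Y T \<and> y \<in> T \<and> ?C \<inter> T \<subseteq> S" if "y \<in> ?C \<inter> S" for y
      using level_leaf_open[OF H, of c] that unfolding S(1)[symmetric] by blast
  qed
  ultimately have "S = ?C" by blast
  then have "S \<in> leaves M F"
    unfolding leaves_def connected_components_of_def using xY by blast
  moreover have "compactin X S" using closedin_compact_space[OF compact_X S(3)] .
  then have "compactin Y S"
    using closedin_subset[OF S(3)] topspace_leaf_topology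
    unfolding compactin_subspace subtopology_level[OF H SS] by simp
  ultimately show ?thesis unfolding compact_leaf_def by blast
qed

lemma compact_leafD:
  assumes "compact_leaf M F L"
  shows "L \<noteq> {}" "L \<subseteq> M" "connectedin Y L" "compactin Y L" "connectedin X L" "closedin X L"
proof -
  have L: "L \<in> connected_components_of Y" "compactin Y L"
    using assms unfolding compact_leaf_def leaves_def by auto
  show "L \<noteq> {}" by (rule nonempty_connected_components_of[OF L(1)])
  show "L \<subseteq> M" using connected_components_of_subset[OF L(1)] topspace_leaf_topology by simp
  show c: "connectedin Y L" by (rule connectedin_connected_components_of[OF L(1)])
  show "compactin Y L" by (rule L(2))
  show "connectedin X L" using connectedin_continuous_map_image[OF continuous_map_leaf_topology c] by simp
  have "compactin X L" using image_compactin[OF L(2) continuous_map_leaf_topology] by simp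
  then show "closedin X L" using compactin_imp_closedin[OF Hausdorff_X] by blast
qed

lemma plaque_in_leaf:
  assumes "L \<in> leaves M F" "tchart M A F H \<tau>" "S \<subseteq> {y\<in>H. \<tau> y = c}" "connectedin X S" "S \<inter> L \<noteq> {}"
  shows "S \<subseteq> L"
  using connected_components_of_maximal[of L Y S] level_connected[OF assms(2,3,4)] assms(1,5)
  unfolding leaves_def disjnt_def by blast

text \<open>Each plaque of a box meets the transversal once, so the intersection of the leaf with a
  compact piece of transversal is locally finite in the leaf topology, hence finite. A shorter
  transversal then meets the leaf at \<open>x\<close> alone.\<close>

lemma compact_leaf_isolated:
  assumes L: "compact_leaf M F L" and H: "tchart M A F H \<tau>" and x: "x \<in> L" "x \<in> H"
  shows "\<exists>T. openin X T \<and> x \<in> T \<and> T \<subseteq> H \<and> (\<forall>y\<in>T. y \<in> L \<longleftrightarrow> \<tau> y = \<tau> x)"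
proof -
  have Lv: "L \<in> leaves M F" using L unfolding compact_leaf_def by blast
  obtain G \<epsilon> \<sigma> where B: "box X H \<tau> x G \<epsilon> \<sigma>"
    using box_exists[OF H x(2) tchart_open[OF H] x(2)] by (elim exE conjE)
  have G: "openin X G" "x \<in> G" "G \<subseteq> H" "0 < \<epsilon>" "\<sigma> (\<tau> x) = x" "connectedin X {y\<in>G. \<tau> y = t}"
    "continuous_map (top_of_set {\<tau> x - \<epsilon><..<\<tau> x + \<epsilon>}) X \<sigma>" for t
    using B unfolding box_def by simp_all
  have G': "tchart M A F G \<tau>" by (rule tch_subset[OF H G(1,3)])
  have plaque: "z \<in> L" if "y \<in> L" "y \<in> G" "z \<in> G" "\<tau> z = \<tau> y" for y z
    using plaque_in_leaf[OF Lv G' order_refl G(6), of "\<tau> y"] that by blast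
  \<comment> \<open>The closed interval of half the length makes the piece of transversal compact,
    hence closed in \<open>M\<close>, so leaf points off it have neighbourhoods that miss
    it.\<close>
  define I where "I = {\<tau> x - \<epsilon> / 2..\<tau> x + \<epsilon> / 2}"
  have I: "I \<subseteq> {\<tau> x - \<epsilon><..<\<tau> x + \<epsilon>}" using G(4) unfolding I_def by auto
  have \<sigma>: "\<sigma> t \<in> G" "\<tau> (\<sigma> t) = t" if "t \<in> I" for t using B I that unfolding box_def by blast+
  define C where "C = \<sigma> ` {t\<in>I. \<sigma> t \<in> L}"
  have "compactin (top_of_set {\<tau> x - \<epsilon><..<\<tau> x + \<epsilon>}) I"
    using I by (simp add: compactin_subtopology I_def)
  then have "compactin X (\<sigma> ` I)" by (rule image_compactin[OF _ G(7)])
  then have Icl: "closedin X (\<sigma> ` I)" by (rule compactin_imp_closedin[OF Hausdorff_X])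
  have "\<exists>N. openin Y N \<and> y \<in> N \<and> finite (N \<inter> C)" if y: "y \<in> L" for y
  proof (cases "y \<in> C")
    case True
    then obtain t where t: "t \<in> I" "y = \<sigma> t" unfolding C_def by blast
    have "{z\<in>G. \<tau> z = t} \<inter> C \<subseteq> {\<sigma> t}" using \<sigma> unfolding C_def by auto
    then have "finite ({z\<in>G. \<tau> z = t} \<inter> C)" by (rule finite_subset) simp
    then show ?thesis using level_leaf_open[OF G', of t] \<sigma>[OF t(1)] t(2) by blast
  next
    case False
    then have "y \<in> M - \<sigma> ` I" using y compact_leafD(2)[OF L] unfolding C_def by blast
    moreover have "openin Y (M - \<sigma> ` I)" using leaf_topology_finer Icl by (simp add: closedin_def)
    moreover have "(M - \<sigma> ` I) \<inter> C = {}" unfolding C_def by blast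
    ultimately show ?thesis by (metis finite.emptyI)
  qed
  then obtain O' where O': "\<And>y. y \<in> L \<Longrightarrow> openin Y (O' y) \<and> y \<in> O' y \<and> finite (O' y \<inter> C)" by metis
  have "\<forall>U\<in>O' ` L. openin Y U" "L \<subseteq> \<Union>(O' ` L)" using O' by auto
  then obtain \<F> where \<F>: "finite \<F>" "\<F> \<subseteq> O' ` L" "L \<subseteq> \<Union>\<F>"
    using compact_leafD(4)[OF L] unfolding compactin_def by meson
  have "C = (\<Union>U\<in>\<F>. U \<inter> C)" using \<F>(3) unfolding C_def by blast
  moreover have "finite (\<Union>U\<in>\<F>. U \<inter> C)" using \<F>(1,2) O' by blast
  ultimately have "finite C" by simp
  moreover have "{t\<in>I. \<sigma> t \<in> L} \<subseteq> \<tau> ` C" unfolding C_def using \<sigma> by force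
  ultimately have "finite {t\<in>I. \<sigma> t \<in> L}" by (meson finite_imageI finite_subset)
  then obtain d where d: "d > 0" "\<forall>t\<in>{t\<in>I. \<sigma> t \<in> L}. t \<noteq> \<tau> x \<longrightarrow> d \<le> dist (\<tau> x) t"
    using finite_set_avoid by blast
  define \<rho> where "\<rho> = min d (\<epsilon> / 2)"
  have \<rho>: "\<rho> > 0" "\<rho> \<le> d" "\<rho> \<le> \<epsilon> / 2" using d(1) G(4) unfolding \<rho>_def by auto
  define T where "T = {y\<in>G. \<tau> y \<in> {\<tau> x - \<rho><..<\<tau> x + \<rho>}}"
  have "openin X T" unfolding T_def by (rule tch_preimage_open[OF G']) simp
  moreover have "x \<in> T" using G(2) \<rho>(1) unfolding T_def by auto
  moreover have "y \<in> L \<longleftrightarrow> \<tau> y = \<tau> x" if y: "y \<in> T" for y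
  proof
    assume "\<tau> y = \<tau> x"
    then show "y \<in> L" using plaque[OF x(1) G(2)] y unfolding T_def by blast
  next
    assume yL: "y \<in> L"
    have tI: "\<tau> y \<in> I" "y \<in> G" using y \<rho>(3) unfolding T_def I_def by auto
    then have "\<sigma> (\<tau> y) \<in> L" using plaque[OF yL] \<sigma> by blast
    moreover have "dist (\<tau> x) (\<tau> y) < d" using y \<rho>(2) unfolding T_def dist_real_def by auto
    ultimately show "\<tau> y = \<tau> x" using d(2) tI(1) by force
  qed
  ultimately show ?thesis using G(3) by (intro exI[of _ T]) (auto simp: T_def)
qed

end

section \<open>Transport of transverse charts along a leaf without holonomy\<close>

lemma pathin_join:
  assumes "pathin X g" "pathin X k" "g 1 = k 0"
  shows "pathin X (\<lambda>t. if t \<le> 1 / 2 then g (2 * t) else k (2 * t - 1))"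
proof -
  let ?I = "top_of_set {0..1::real}"
  have g: "continuous_map ?I X g" "continuous_map ?I X k" using assms(1,2) unfolding pathin_def by auto
  have "continuous_map ?I X (\<lambda>x. if x \<le> 1 / 2 then (g \<circ> (\<lambda>t. 2 * t)) x else (k \<circ> (\<lambda>t. 2 * t - 1)) x)"
  proof (intro continuous_map_cases_le continuous_map_compose, force, force)
    show "continuous_map (subtopology ?I {x \<in> topspace ?I. x \<le> 1/2}) ?I ((*) 2)"
      by (auto simp: continuous_map_in_subtopology continuous_map_from_subtopology)
    have "continuous_map (subtopology ?I {x. 0 \<le> x \<and> x \<le> 1 \<and> 1 \<le> x * 2}) euclideanreal (\<lambda>t. 2 * t - 1)"
      by (intro continuous_intros) (force intro: continuous_map_from_subtopology)
    then show "continuous_map (subtopology ?I {x \<in> topspace ?I. 1/2 \<le> x}) ?I (\<lambda>t. 2 * t - 1)"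
      by (force simp: continuous_map_in_subtopology)
    show "(g \<circ> (*) 2) x = (k \<circ> (\<lambda>t. 2 * t - 1)) x" if "x \<in> topspace ?I" "x = 1/2" for x
      unfolding that(2) using assms(3) by simp
  qed (use g in auto)
  then show ?thesis unfolding pathin_def comp_def .
qed

lemma holonomy_along_range:
  assumes "holonomy_along M F \<gamma> c t c' h"
  shows "0 \<le> t \<and> t \<le> 1 \<and> c' \<in> F \<and> \<gamma> t \<in> fst c'"
  using assms
proof induction
  case (slide s c' h t)
  then show ?case by auto
next
  case (change t c' h c'' g)
  then show ?case unfolding transition_germ_def by blast
qed auto

text \<open>Needed for the first half of a concatenated path, which runs at double speed: the chain
  of distinguished maps is kept and its times are halved.\<close>

lemma holonomy_along_reparametrize:
  assumes "holonomy_along M F \<gamma> c t c' h" and "\<And>s. s \<in> {0..1/2} \<Longrightarrow> \<gamma>' s = \<gamma> (2 * s)"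
  shows "holonomy_along M F \<gamma>' c (t / 2) c' h"
  using assms(1)
proof induction
  case start
  have "\<gamma>' 0 = \<gamma> 0" using assms(2)[of 0] by simp
  moreover have zero: "(0::real) / 2 = 0" by simp
  ultimately show ?case unfolding zero using start by (intro holonomy_along.start) simp_all
next
  case (slide s c' h t)
  have "0 \<le> s" using holonomy_along_range[OF slide.hyps(1)] by blast
  have "\<gamma>' ` {s / 2..t / 2} \<subseteq> fst c'"
  proof
    fix y assume "y \<in> \<gamma>' ` {s / 2..t / 2}"
    then obtain r where r: "r \<in> {s / 2..t / 2}" "y = \<gamma>' r" by blast
    then have "y = \<gamma> (2 * r)" "2 * r \<in> {s..t}" using assms(2)[of r] \<open>0 \<le> s\<close> slide.hyps(3) by auto
    then show "y \<in> fst c'" using slide.hyps(4) by blast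
  qed
  then show ?case using slide by (intro holonomy_along.slide[OF slide.IH]) auto
next
  case (change t c' h c'' g)
  have "\<gamma>' (t / 2) = \<gamma> t" using assms(2)[of "t / 2"] holonomy_along_range[OF change.hyps(1)] by simp
  then show ?case using change.hyps(2,3) by (intro holonomy_along.change[OF change.IH]) simp_all
qed

text \<open>The local condition transfers the property between any two points of the neighbourhood
  in either direction, so both the set where it holds and the set where it fails are open in
  \<open>L\<close>.\<close>

lemma connectedin_local_property:
  assumes L: "connectedin Y L" and x0: "x\<^sub>0 \<in> L" "P x\<^sub>0"
    and loc: "\<And>x. x \<in> L \<Longrightarrow> \<exists>T. openin Y T \<and> x \<in> T \<and> (\<forall>y\<in>T \<inter> L. \<forall>z\<in>T \<inter> L. P y \<longrightarrow> P z)"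
    and x: "x \<in> L"
  shows "P x"
proof (rule ccontr)
  assume "\<not> P x"
  obtain T where T: "\<And>x. x \<in> L \<Longrightarrow> openin Y (T x) \<and> x \<in> T x \<and> (\<forall>y\<in>T x \<inter> L. \<forall>z\<in>T x \<inter> L. P y \<longrightarrow> P z)"
    using loc by metis
  define E1 E2 where "E1 = (\<Union>x\<in>{x\<in>L. P x}. T x)" and "E2 = (\<Union>x\<in>{x\<in>L. \<not> P x}. T x)"
  have in_E1: "P y" if y: "y \<in> E1" "y \<in> L" for y
  proof -
    obtain z where z: "z \<in> L" "P z" "y \<in> T z" using y(1) unfolding E1_def by blast
    then show ?thesis using T[OF z(1)] y(2) by blast
  qed
  have in_E2: "\<not> P y" if y: "y \<in> E2" "y \<in> L" for y
  proof -
    obtain z where z: "z \<in> L" "\<not> P z" "y \<in> T z" using y(1) unfolding E2_def by blast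
    then show ?thesis using T[OF z(1)] y(2) by blast
  qed
  have "openin Y E1" "openin Y E2" unfolding E1_def E2_def using T by (auto intro!: openin_Union)
  moreover have "L \<subseteq> E1 \<union> E2"
  proof
    fix y assume y: "y \<in> L"
    then show "y \<in> E1 \<union> E2" using T[OF y] unfolding E1_def E2_def by (cases "P y") auto
  qed
  moreover have "E1 \<inter> E2 \<inter> L = {}" using in_E1 in_E2 by blast
  moreover have "x\<^sub>0 \<in> E1" using T[OF x0(1)] x0 unfolding E1_def by blast
  then have "E1 \<inter> L \<noteq> {}" using x0(1) by blast
  moreover have "x \<in> E2" using T[OF x] x \<open>\<not> P x\<close> unfolding E2_def by blast
  then have "E2 \<inter> L \<noteq> {}" using x by blast
  ultimately show False using L unfolding connectedin by blast
qed

text \<open>Here \<open>\<kappa>\<close> expresses the distinguished map \<open>snd c\<^sub>0\<close> near \<open>x\<^sub>0\<close> by a transverse chart with value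
  \<open>v\<^sub>0\<close> at \<open>x\<^sub>0\<close>, and \<open>\<mu>\<close> is the transverse chart into which the holonomy of some path in the leaf
  transports that chart.\<close>

definition transported ::
    "'m::topological_space set \<Rightarrow> ('m, 'e::euclidean_space) chart set \<Rightarrow> ('m, real) chart set \<Rightarrow>
     'm \<Rightarrow> ('m, real) chart \<Rightarrow> (real \<Rightarrow> real) \<Rightarrow> real \<Rightarrow> 'm \<Rightarrow> 'm set \<Rightarrow> ('m \<Rightarrow> real) \<Rightarrow> bool" where
  "transported M A F x\<^sub>0 c\<^sub>0 \<kappa> v\<^sub>0 x H \<mu> \<longleftrightarrow> tchart M A F H \<mu> \<and> x \<in> H \<and> \<mu> x = v\<^sub>0 \<and>
     (\<exists>\<gamma> c h T. pathin (leaf_topology M F) \<gamma> \<and> \<gamma> 0 = x\<^sub>0 \<and> \<gamma> 1 = x \<and> holonomy_along M F \<gamma> c\<^sub>0 1 c h \<and>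
        openin (top_of_set M) T \<and> x \<in> T \<and> (\<forall>z\<in>T. snd c z = h (\<kappa> (\<mu> z))))"

context oriented_affine_foliation
begin

lemma tchart_affine_unique:
  assumes H: "tchart M A F H \<nu>" and N: "openin X N" "y \<in> N" "N \<subseteq> H"
    and eq: "\<And>w. w \<in> N \<Longrightarrow> a * \<nu> w + b = a' * \<nu> w + b'"
  shows "a = a'" "b = b'"
proof -
  obtain z where z: "z \<in> N" "\<nu> z < \<nu> y" using tch_value_near[OF H N, of "\<nu> y - 1"] by auto
  have "a * \<nu> y + b - (a * \<nu> z + b) = a' * \<nu> y + b' - (a' * \<nu> z + b')" using eq[OF N(2)] eq[OF z(1)] by simp
  then have "a * (\<nu> y - \<nu> z) = a' * (\<nu> y - \<nu> z)" by (simp add: algebra_simps)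
  then show "a = a'" using z(2) by simp
  then show "b = b'" using eq[OF N(2)] by simp
qed

text \<open>A transport to \<open>y\<close> is prolonged by a path inside the plaque to
  \<open>z\<close>; within one box a single change to the distinguished map \<open>f\<close>
  suffices, and the chart carried is the same affine function of \<nu> at both ends. Expressing it
  through \<nu> lets transports along different paths be compared by their coefficients.\<close>

lemma transported_step:
  assumes H: "tchart M A F H \<nu>" and x: "x \<in> H"
  shows "\<exists>G. openin X G \<and> x \<in> G \<and> G \<subseteq> H \<and> (\<forall>y\<in>G. \<forall>z\<in>G. \<nu> y = \<nu> x \<longrightarrow> \<nu> z = \<nu> x \<longrightarrow>
    (\<forall>K \<mu>. transported M A F x\<^sub>0 c\<^sub>0 \<kappa> v\<^sub>0 y K \<mu> \<longrightarrow> (\<exists>\<alpha> \<beta>. 0 < \<alpha> \<and> germ_eq X y \<mu> (\<lambda>w. \<alpha> * \<nu> w + \<beta>) \<and>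
       transported M A F x\<^sub>0 c\<^sub>0 \<kappa> v\<^sub>0 z G (\<lambda>w. \<alpha> * \<nu> w + \<beta>))))"
proof -
  have xM: "x \<in> M" using openin_subset[OF tchart_open[OF H]] x by auto
  obtain W f where W: "(W, f) \<in> F" "x \<in> W" using F_cover[OF xM] by blast
  obtain T where T: "openin X T" "x \<in> T" "T \<subseteq> H \<inter> W" "\<forall>y\<in>T. \<forall>z\<in>T. f y < f z \<longleftrightarrow> \<nu> y < \<nu> z"
    using tchart_order[OF H x W] by (elim exE conjE)
  obtain G \<epsilon> \<sigma> where B: "box X H \<nu> x G \<epsilon> \<sigma>" and GT: "G \<subseteq> T" and path: "\<forall>y\<in>G. \<forall>z\<in>G. \<nu> y = \<nu> z \<longrightarrow>
    (\<exists>\<delta>. pathin X \<delta> \<and> \<delta> 0 = y \<and> \<delta> 1 = z \<and> \<delta> ` {0..1} \<subseteq> {w\<in>G. \<nu> w = \<nu> z})"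
    using tchart_box[OF H x T(1,2)] by (elim exE conjE)
  have G: "openin X G" "x \<in> G" "G \<subseteq> H" using B unfolding box_def by auto
  have G': "tchart M A F G \<nu>" by (rule tch_subset[OF H G(1,3)])
  have fval: "f w = f w'" if "w \<in> G" "w' \<in> G" "\<nu> w = \<nu> w'" for w w'
  proof -
    have "w \<in> T" "w' \<in> T" using that GT by auto
    then have "\<not> f w < f w'" "\<not> f w' < f w" using T(4) that(3) by auto
    then show ?thesis by linarith
  qed
  have "\<exists>\<alpha> \<beta>. 0 < \<alpha> \<and> germ_eq X y \<mu> (\<lambda>w. \<alpha> * \<nu> w + \<beta>) \<and>
       transported M A F x\<^sub>0 c\<^sub>0 \<kappa> v\<^sub>0 z G (\<lambda>w. \<alpha> * \<nu> w + \<beta>)"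
    if yz: "y \<in> G" "z \<in> G" "\<nu> y = \<nu> x" "\<nu> z = \<nu> x" and tr: "transported M A F x\<^sub>0 c\<^sub>0 \<kappa> v\<^sub>0 y K \<mu>" for y z K \<mu>
  proof -
    have K: "tchart M A F K \<mu>" "y \<in> K" "\<mu> y = v\<^sub>0" using tr unfolding transported_def by auto
    obtain \<gamma> c h T1 where \<gamma>: "pathin Y \<gamma>" "\<gamma> 0 = x\<^sub>0" "\<gamma> 1 = y" "holonomy_along M F \<gamma> c\<^sub>0 1 c h"
        "openin X T1" "y \<in> T1" "\<forall>z\<in>T1. snd c z = h (\<kappa> (\<mu> z))"
      using tr unfolding transported_def by (elim exE conjE)
    obtain T2 \<alpha> \<beta> where T2: "openin X T2" "y \<in> T2" "T2 \<subseteq> G \<inter> K" "0 < \<alpha>" "\<forall>w\<in>T2. \<mu> w = \<alpha> * \<nu> w + \<beta>"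
      using tchart_transition[OF G' K(1) yz(1) K(2)] by (elim exE conjE)
    have c: "c \<in> F" "y \<in> fst c" using holonomy_along_range[OF \<gamma>(4)] \<gamma>(3) by auto
    have yW: "y \<in> fst (W, f)" using yz(1) GT T(3) by auto
    obtain g where g: "transition_germ M c (W, f) y g" using F_transition[OF c(1) W(1) c(2) yW] by blast
    obtain T3 where T3: "openin X T3" "y \<in> T3" "\<forall>w\<in>T3. f w = g (snd c w)"
      using g unfolding transition_germ_def by auto
    define N where "N = T1 \<inter> T2 \<inter> T3"
    have N: "openin X N" "y \<in> N" "N \<subseteq> G" unfolding N_def using \<gamma>(5,6) T2 T3 by (auto intro!: openin_Int)
    have fN: "f w = (g \<circ> h) (\<kappa> (\<alpha> * \<nu> w + \<beta>))" if w: "w \<in> N" for w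
      using \<gamma>(7) T2(5) T3(3) w unfolding N_def by simp
    \<comment> \<open>The relation between \<open>f\<close> and \<nu> is known near
      \<open>y\<close>. Both are constant on the plaques of the box, so it persists on all plaques
      that meet \<open>N\<close>, and these fill a neighbourhood of \<open>z\<close>.\<close>
    define T' where "T' = {w\<in>G. \<nu> w \<in> \<nu> ` N}"
    have "openin X T'" unfolding T'_def
      by (rule tch_preimage_open[OF G' tch_image_open[OF G' N(1,3)]])
    moreover have "z \<in> T'" using yz N(2) unfolding T'_def by (metis (mono_tags, lifting) imageI mem_Collect_eq)
    moreover have "snd (W, f) w = (g \<circ> h) (\<kappa> (\<alpha> * \<nu> w + \<beta>))" if w: "w \<in> T'" for w
    proof -
      obtain w' where w': "w' \<in> N" "\<nu> w = \<nu> w'" using w unfolding T'_def by blast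
      then have "f w = f w'" using fval[of w w'] w N(3) unfolding T'_def by blast
      then show ?thesis using fN[OF w'(1)] w'(2) by simp
    qed
    moreover
    obtain \<delta> where \<delta>: "pathin X \<delta>" "\<delta> 0 = y" "\<delta> 1 = z" "\<delta> ` {0..1} \<subseteq> {w\<in>G. \<nu> w = \<nu> z}"
      using path[rule_format, OF yz(1,2)] yz(3,4) by auto
    define \<gamma>' where "\<gamma>' t = (if t \<le> 1 / 2 then \<gamma> (2 * t) else \<delta> (2 * t - 1))" for t
    have "pathin Y \<delta>" by (rule level_path[OF G' order_refl \<delta>(1,4)])
    then have "pathin Y \<gamma>'" unfolding \<gamma>'_def using pathin_join[OF \<gamma>(1)] \<gamma>(3) \<delta>(2) by simp
    moreover have "\<gamma>' 0 = x\<^sub>0" "\<gamma>' 1 = z" unfolding \<gamma>'_def using \<gamma>(2) \<delta>(3) by simp_all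
    moreover have "holonomy_along M F \<gamma>' c\<^sub>0 1 (W, f) (g \<circ> h)"
    proof (rule holonomy_along.slide)
      \<comment> \<open>At time one half the old path is completed; there the chain changes to
        \<open>f\<close> and then slides along the rest inside the box.\<close>
      have half: "holonomy_along M F \<gamma>' c\<^sub>0 (1 / 2) c h"
        by (rule holonomy_along_reparametrize[OF \<gamma>(4)]) (simp add: \<gamma>'_def)
      have "\<gamma>' (1 / 2) = y" unfolding \<gamma>'_def using \<gamma>(3) by simp
      then show "holonomy_along M F \<gamma>' c\<^sub>0 (1 / 2) (W, f) (g \<circ> h)"
        using holonomy_along.change[OF half W(1)] g by simp
      have inG: "\<gamma>' s \<in> G" if "s \<in> {1 / 2..1}" for s
      proof (cases "s = 1 / 2")
        case False
        then have "2 * s - 1 \<in> {0..1}" "\<gamma>' s = \<delta> (2 * s - 1)" using that unfolding \<gamma>'_def by auto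
        then show ?thesis using \<delta>(4) by (metis (no_types, lifting) imageI mem_Collect_eq subsetD)
      next
        case True
        show ?thesis unfolding True \<open>\<gamma>' (1 / 2) = y\<close> by (rule yz(1))
      qed
      have "G \<subseteq> fst (W, f)" using GT T(3) by auto
      then show "\<gamma>' ` {1 / 2..1} \<subseteq> fst (W, f)" using inG by (meson image_subsetI subsetD)
    qed auto
    moreover have "tchart M A F G (\<lambda>w. \<alpha> * \<nu> w + \<beta>)" by (rule tchart_affine[OF G' T2(4)])
    moreover have "\<alpha> * \<nu> z + \<beta> = v\<^sub>0" using T2(2,5) K(3) yz by simp
    ultimately have "transported M A F x\<^sub>0 c\<^sub>0 \<kappa> v\<^sub>0 z G (\<lambda>w. \<alpha> * \<nu> w + \<beta>)"
      unfolding transported_def using yz(2)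
      by (intro conjI exI[of _ \<gamma>'] exI[of _ "(W, f)"] exI[of _ "g \<circ> h"] exI[of _ T'] ballI)
    moreover have "germ_eq X y \<mu> (\<lambda>w. \<alpha> * \<nu> w + \<beta>)"
      unfolding germ_eq_def using T2(1,2,5) by (intro exI[of _ T2] conjI)
    ultimately show ?thesis using T2(4) by (intro exI conjI)
  qed
  then show ?thesis using G by (intro exI[of _ G] conjI ballI allI impI) blast+
qed

lemma transported_plaque:
  assumes x: "x \<in> M"
  shows "\<exists>\<nu> G T. tchart M A F G \<nu> \<and> openin Y T \<and> x \<in> T \<and> T = {y\<in>G. \<nu> y = \<nu> x} \<and>
    (\<forall>y\<in>T. \<forall>z\<in>T. \<forall>K \<mu>. transported M A F x\<^sub>0 c\<^sub>0 \<kappa> v\<^sub>0 y K \<mu> \<longrightarrow>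
       (\<exists>\<alpha> \<beta>. 0 < \<alpha> \<and> germ_eq X y \<mu> (\<lambda>w. \<alpha> * \<nu> w + \<beta>) \<and>
          transported M A F x\<^sub>0 c\<^sub>0 \<kappa> v\<^sub>0 z G (\<lambda>w. \<alpha> * \<nu> w + \<beta>)))"
proof -
  obtain H \<nu> where H: "tchart M A F H \<nu>" "x \<in> H" using tchart_exists[OF x] by blast
  obtain G where G: "openin X G" "x \<in> G" "G \<subseteq> H" "\<forall>y\<in>G. \<forall>z\<in>G. \<nu> y = \<nu> x \<longrightarrow> \<nu> z = \<nu> x \<longrightarrow>
    (\<forall>K \<mu>. transported M A F x\<^sub>0 c\<^sub>0 \<kappa> v\<^sub>0 y K \<mu> \<longrightarrow> (\<exists>\<alpha> \<beta>. 0 < \<alpha> \<and> germ_eq X y \<mu> (\<lambda>w. \<alpha> * \<nu> w + \<beta>) \<and>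
       transported M A F x\<^sub>0 c\<^sub>0 \<kappa> v\<^sub>0 z G (\<lambda>w. \<alpha> * \<nu> w + \<beta>)))"
    using transported_step[OF H, of x\<^sub>0 c\<^sub>0 \<kappa> v\<^sub>0] by (elim exE conjE)
  have G': "tchart M A F G \<nu>" by (rule tch_subset[OF H(1) G(1,3)])
  show ?thesis
    using G' level_leaf_open[OF G', of "\<nu> x"] G(2,4)
    by (intro exI[of _ \<nu>] exI[of _ G] exI[of _ "{y\<in>G. \<nu> y = \<nu> x}"] conjI) simp_all
qed

text \<open>\<kappa> is \<open>f\<close> read along the transversal; \<open>f\<close> is constant on
  plaques, so \<kappa> determines it on the box. Injectivity comes from the common order.\<close>

lemma distinguished_map_in_tchart:
  assumes H: "tchart M A F H \<tau>" "x \<in> H" and W: "(W, f) \<in> F" "x \<in> W"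
  shows "\<exists>\<kappa> I G. open I \<and> \<tau> x \<in> I \<and> openin X G \<and> x \<in> G \<and> G \<subseteq> H \<inter> W \<and> \<tau> ` G \<subseteq> I \<and>
    (\<forall>w\<in>G. f w = \<kappa> (\<tau> w)) \<and> inj_on \<kappa> I \<and> (\<forall>S. open S \<longrightarrow> open {t\<in>I. \<kappa> t \<in> S})"
proof -
  obtain T where T: "openin X T" "x \<in> T" "T \<subseteq> H \<inter> W" "\<forall>y\<in>T. \<forall>z\<in>T. f y < f z \<longleftrightarrow> \<tau> y < \<tau> z"
    using tchart_order[OF H W] by (elim exE conjE)
  obtain G \<epsilon> \<sigma> where B: "box X H \<tau> x G \<epsilon> \<sigma>" and GT: "G \<subseteq> T"
    using box_exists[OF H T(1,2)] by (elim exE conjE)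
  define I where "I = {\<tau> x - \<epsilon><..<\<tau> x + \<epsilon>}"
  have G: "openin X G" "x \<in> G" "0 < \<epsilon>" "\<tau> ` G \<subseteq> I" using B unfolding box_def I_def by auto
  have \<sigma>: "\<sigma> t \<in> G" "\<tau> (\<sigma> t) = t" if "t \<in> I" for t using B that unfolding box_def I_def by auto
  have ord: "f y < f z \<longleftrightarrow> \<tau> y < \<tau> z" if "y \<in> G" "z \<in> G" for y z using T(4) GT that by blast
  have "f w = f (\<sigma> (\<tau> w))" if w: "w \<in> G" for w
  proof -
    have t: "\<tau> w \<in> I" using G(4) w by blast
    show ?thesis using ord[OF w \<sigma>(1)[OF t]] ord[OF \<sigma>(1)[OF t] w] \<sigma>(2)[OF t] by linarith
  qed
  moreover have "inj_on (f \<circ> \<sigma>) I"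
  proof (rule inj_onI)
    fix s t assume st: "s \<in> I" "t \<in> I" "(f \<circ> \<sigma>) s = (f \<circ> \<sigma>) t"
    then show "s = t"
      using ord[OF \<sigma>(1)[OF st(1)] \<sigma>(1)[OF st(2)]] ord[OF \<sigma>(1)[OF st(2)] \<sigma>(1)[OF st(1)]] \<sigma>(2) by simp
  qed
  moreover have "open {t\<in>I. (f \<circ> \<sigma>) t \<in> S}" if S: "open S" for S
  proof -
    have "openin X (G \<inter> {y\<in>W. f y \<in> S})" using G(1) F_preimage_open[OF W(1) S] by blast
    then have "open {t\<in>I. \<sigma> t \<in> G \<inter> {y\<in>W. f y \<in> S}}"
      unfolding I_def by (rule box_transversal_open[OF B])
    moreover have "{t\<in>I. \<sigma> t \<in> G \<inter> {y\<in>W. f y \<in> S}} = {t\<in>I. (f \<circ> \<sigma>) t \<in> S}"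
      using \<sigma>(1) GT T(3) by auto
    ultimately show ?thesis by simp
  qed
  moreover have "open I" "\<tau> x \<in> I" unfolding I_def using G(3) by auto
  moreover have "G \<subseteq> H \<inter> W" using GT T(3) by blast
  ultimately show ?thesis using G(1,2,4)
    by (intro exI[of _ "f \<circ> \<sigma>"] exI[of _ I] exI[of _ G] conjI) simp_all
qed

text \<open>Connectedness of the leaf makes transports exist at each of its points. Two transports
  at one point differ by an affine map, and moving both along the leaf keeps that map; back at
  \<open>x\<^sub>0\<close> the absence of holonomy makes it the identity. So the germs are well
  defined.\<close>

lemma leaf_transport:
  assumes L: "compact_leaf M F L" and hol: "without_holonomy M F L" and x0: "x\<^sub>0 \<in> L"
  shows "\<exists>H \<tau> v\<^sub>0. (\<forall>x\<in>L. tchart M A F (H x) (\<tau> x) \<and> x \<in> H x \<and> \<tau> x x = v\<^sub>0) \<and>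
    (\<forall>x\<in>L. \<exists>T. openin X T \<and> x \<in> T \<and> (\<forall>y\<in>L \<inter> T. germ_eq X y (\<tau> x) (\<tau> y)))"
proof -
  note LD = compact_leafD[OF L]
  have x0M: "x\<^sub>0 \<in> M" using x0 LD(2) by blast
  obtain H0 \<tau>0 where H0: "tchart M A F H0 \<tau>0" "x\<^sub>0 \<in> H0" using tchart_exists[OF x0M] by blast
  obtain W0 f0 where W0: "(W0, f0) \<in> F" "x\<^sub>0 \<in> W0" using F_cover[OF x0M] by blast
  obtain \<kappa> I G0 where \<kappa>: "open I" "\<tau>0 x\<^sub>0 \<in> I" "openin X G0" "x\<^sub>0 \<in> G0" "G0 \<subseteq> H0 \<inter> W0" "\<tau>0 ` G0 \<subseteq> I"
      "\<forall>w\<in>G0. f0 w = \<kappa> (\<tau>0 w)" "inj_on \<kappa> I" "\<forall>S. open S \<longrightarrow> open {t\<in>I. \<kappa> t \<in> S}"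
    using distinguished_map_in_tchart[OF H0 W0] by (elim exE conjE)
  define v0 where "v0 = \<tau>0 x\<^sub>0"
  define tr where "tr = transported M A F x\<^sub>0 (W0, f0) \<kappa> v0"
  have trD: "tchart M A F H \<mu>" "x \<in> H" "\<mu> x = v0" if "tr x H \<mu>" for x H \<mu>
    using that unfolding tr_def transported_def by auto
  have base: "tr x\<^sub>0 H0 \<tau>0"
  proof -
    have "holonomy_along M F (\<lambda>_. x\<^sub>0) (W0, f0) 1 (W0, f0) id"
      by (rule holonomy_along.slide[OF holonomy_along.start]) (use W0 in auto)
    moreover have "pathin Y (\<lambda>_. x\<^sub>0)" using x0M topspace_leaf_topology by simp
    moreover have "\<forall>z\<in>G0. snd (W0, f0) z = id (\<kappa> (\<tau>0 z))" using \<kappa>(7) by simp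
    ultimately show ?thesis
      unfolding tr_def transported_def v0_def using H0 \<kappa>(3,4)
      by (intro conjI exI[of _ "\<lambda>_. x\<^sub>0"] exI[of _ "(W0, f0)"] exI[of _ id] exI[of _ G0]) simp_all
  qed
  \<comment> \<open>Closing the chain with a change to the initial distinguished map turns the
    transport into the holonomy of a loop, which is the identity near the value of
    \<open>f0\<close>; injectivity of \<kappa> turns equality of distinguished values into equality
    of charts.\<close>
  have at_base: "germ_eq X x\<^sub>0 \<mu> \<tau>0" if t: "tr x\<^sub>0 K \<mu>" for K \<mu>
  proof -
    note K = trD[OF t]
    obtain \<gamma> c h T where \<gamma>: "pathin Y \<gamma>" "\<gamma> 0 = x\<^sub>0" "\<gamma> 1 = x\<^sub>0" "holonomy_along M F \<gamma> (W0, f0) 1 c h"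
        "openin X T" "x\<^sub>0 \<in> T" "\<forall>z\<in>T. snd c z = h (\<kappa> (\<mu> z))"
      using t unfolding tr_def transported_def by (elim exE conjE)
    have c: "c \<in> F" "x\<^sub>0 \<in> fst c" using holonomy_along_range[OF \<gamma>(4)] \<gamma>(3) by auto
    obtain g where g: "transition_germ M c (W0, f0) x\<^sub>0 g"
      using F_transition[OF c(1) W0(1) c(2)] W0(2) by auto
    obtain T' where T': "openin X T'" "x\<^sub>0 \<in> T'" "\<forall>w\<in>T'. f0 w = g (snd c w)"
      using g unfolding transition_germ_def by auto
    have "holonomy_along M F \<gamma> (W0, f0) 1 (W0, f0) (g \<circ> h)"
      using holonomy_along.change[OF \<gamma>(4) W0(1)] g \<gamma>(3) by simp
    then have "\<forall>\<^sub>F y in nhds (snd (W0, f0) (\<gamma> 0)). (g \<circ> h) y = y"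
      using hol[unfolded without_holonomy_def, rule_format, of \<gamma> "(W0, f0)" "g \<circ> h"] \<gamma>(1-3) x0 by simp
    then obtain S where S: "open S" "f0 x\<^sub>0 \<in> S" "\<forall>y\<in>S. g (h y) = y"
      unfolding eventually_nhds using \<gamma>(2) by auto
    define J where "J = {t\<in>I. \<kappa> t \<in> S}"
    have J: "open J" "v0 \<in> J" unfolding J_def v0_def using \<kappa>(2,4,7,9) S(1,2) by auto
    define N where "N = T \<inter> T' \<inter> G0 \<inter> {w\<in>K. \<mu> w \<in> J}"
    have "openin X N"
      unfolding N_def using \<gamma>(5) T'(1) \<kappa>(3) tch_preimage_open[OF K(1) J(1)] by (intro openin_Int)
    moreover have "x\<^sub>0 \<in> N" unfolding N_def using \<gamma>(6) T'(2) \<kappa>(4) K(2,3) J(2) by simp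
    moreover have "\<mu> w = \<tau>0 w" if w: "w \<in> N" for w
    proof -
      have "\<kappa> (\<mu> w) \<in> S" "\<mu> w \<in> I" using w unfolding N_def J_def by auto
      moreover have "f0 w = g (h (\<kappa> (\<mu> w)))" using w T'(3) \<gamma>(7) unfolding N_def by auto
      moreover have "f0 w = \<kappa> (\<tau>0 w)" "\<tau>0 w \<in> I" using w \<kappa>(6,7) unfolding N_def by auto
      ultimately show ?thesis using S(3) inj_onD[OF \<kappa>(8)] by auto
    qed
    ultimately show ?thesis unfolding germ_eq_def by (intro exI[of _ N]) simp
  qed
  have plaque: "\<exists>\<nu> G T. tchart M A F G \<nu> \<and> openin Y T \<and> x \<in> T \<and> T = {y\<in>G. \<nu> y = \<nu> x} \<and>
    (\<forall>y\<in>T. \<forall>z\<in>T. \<forall>K \<mu>. tr y K \<mu> \<longrightarrow> (\<exists>\<alpha> \<beta>. 0 < \<alpha> \<and> germ_eq X y \<mu> (\<lambda>w. \<alpha> * \<nu> w + \<beta>) \<and>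
          tr z G (\<lambda>w. \<alpha> * \<nu> w + \<beta>)))" if "x \<in> L" for x
    unfolding tr_def by (rule transported_plaque) (use that LD(2) in blast)
  have ex: "\<exists>H \<mu>. tr x H \<mu>" if x: "x \<in> L" for x
  proof (rule connectedin_local_property[where P = "\<lambda>x. \<exists>H \<mu>. tr x H \<mu>", OF LD(3) x0 _ _ x])
    show "\<exists>H \<mu>. tr x\<^sub>0 H \<mu>" using base by blast
    fix y assume "y \<in> L"
    then show "\<exists>T. openin Y T \<and> y \<in> T \<and> (\<forall>y\<in>T \<inter> L. \<forall>z\<in>T \<inter> L. (\<exists>H \<mu>. tr y H \<mu>) \<longrightarrow> (\<exists>H \<mu>. tr z H \<mu>))"
    proof -
      obtain \<nu> G T where T: "openin Y T" "y \<in> T" "\<forall>y\<in>T. \<forall>z\<in>T. \<forall>K \<mu>. tr y K \<mu> \<longrightarrow>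
          (\<exists>\<alpha> \<beta>. 0 < \<alpha> \<and> germ_eq X y \<mu> (\<lambda>w. \<alpha> * \<nu> w + \<beta>) \<and> tr z G (\<lambda>w. \<alpha> * \<nu> w + \<beta>))"
        using plaque[OF \<open>y \<in> L\<close>] by (elim exE conjE)
      have "\<exists>H \<mu>. tr z H \<mu>" if yz: "y \<in> T" "z \<in> T" and t: "tr y H \<mu>" for y z H \<mu>
        using T(3)[rule_format, OF yz t] by (elim exE conjE) (intro exI)
      then have "\<forall>y\<in>T \<inter> L. \<forall>z\<in>T \<inter> L. (\<exists>H \<mu>. tr y H \<mu>) \<longrightarrow> (\<exists>H \<mu>. tr z H \<mu>)"
        by (intro ballI impI, elim exE IntE)
      then show ?thesis using T(1,2) by (intro exI[of _ T] conjI)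
    qed
  qed
  have unique: "germ_eq X x \<mu> \<mu>'" if x: "x \<in> L" and t: "tr x H \<mu>" "tr x H' \<mu>'" for x H \<mu> H' \<mu>'
  proof -
    obtain N \<alpha> \<beta> where N: "openin X N" "x \<in> N" "N \<subseteq> H \<inter> H'" "0 < \<alpha>" "\<forall>y\<in>N. \<mu>' y = \<alpha> * \<mu> y + \<beta>"
      using tchart_transition[OF trD(1)[OF t(1)] trD(1)[OF t(2)] trD(2)[OF t(1)] trD(2)[OF t(2)]]
      by (elim exE conjE)
    have vb: "v0 = \<alpha> * v0 + \<beta>" using N(2,5) trD(3)[OF t(1)] trD(3)[OF t(2)] by force
    \<comment> \<open>The discrepancy given by \<alpha> and \<beta> stays fixed while it is carried
      from \<open>x\<close> back to the base point.\<close>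
    define P where "P y \<longleftrightarrow> (\<exists>K1 \<mu>1 K2 \<mu>2. tr y K1 \<mu>1 \<and> tr y K2 \<mu>2 \<and> germ_eq X y \<mu>2 (\<lambda>w. \<alpha> * \<mu>1 w + \<beta>))" for y
    have "P x" unfolding P_def germ_eq_def using t N(1,2,5) by blast
    have "P x\<^sub>0"
    proof (rule connectedin_local_property[where P = P, OF LD(3) x \<open>P x\<close> _ x0])
      fix q assume q: "q \<in> L"
      obtain \<nu> G T where T: "tchart M A F G \<nu>" "openin Y T" "q \<in> T" "T = {y\<in>G. \<nu> y = \<nu> q}"
        "\<forall>y\<in>T. \<forall>z\<in>T. \<forall>K \<mu>. tr y K \<mu> \<longrightarrow> (\<exists>\<alpha> \<beta>. 0 < \<alpha> \<and> germ_eq X y \<mu> (\<lambda>w. \<alpha> * \<nu> w + \<beta>) \<and>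
          tr z G (\<lambda>w. \<alpha> * \<nu> w + \<beta>))"
        using plaque[OF q] by (elim exE conjE)
      have "P z" if y: "y \<in> T" "P y" and z: "z \<in> T" for y z
      proof -
        obtain K1 \<mu>1 K2 \<mu>2 where P: "tr y K1 \<mu>1" "tr y K2 \<mu>2" "germ_eq X y \<mu>2 (\<lambda>w. \<alpha> * \<mu>1 w + \<beta>)"
          using y(2) unfolding P_def by blast
        obtain a1 b1 where 1: "germ_eq X y \<mu>1 (\<lambda>w. a1 * \<nu> w + b1)" "tr z G (\<lambda>w. a1 * \<nu> w + b1)"
          using T(5)[rule_format, OF y(1) z P(1)] by blast
        obtain a2 b2 where 2: "germ_eq X y \<mu>2 (\<lambda>w. a2 * \<nu> w + b2)" "tr z G (\<lambda>w. a2 * \<nu> w + b2)"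
          using T(5)[rule_format, OF y(1) z P(2)] by blast
        obtain N1 N2 N3 where N: "openin X N1" "y \<in> N1" "\<forall>w\<in>N1. \<mu>1 w = a1 * \<nu> w + b1"
            "openin X N2" "y \<in> N2" "\<forall>w\<in>N2. \<mu>2 w = a2 * \<nu> w + b2"
            "openin X N3" "y \<in> N3" "\<forall>w\<in>N3. \<mu>2 w = \<alpha> * \<mu>1 w + \<beta>"
          using 1(1) 2(1) P(3) unfolding germ_eq_def by (elim exE conjE)
        define O' where "O' = N1 \<inter> N2 \<inter> N3 \<inter> G"
        have O': "openin X O'" "y \<in> O'" "O' \<subseteq> G"
          unfolding O'_def using N tchart_open[OF T(1)] y(1) T(4) by (auto intro!: openin_Int)
        have eq: "a2 * \<nu> w + b2 = (\<alpha> * a1) * \<nu> w + (\<alpha> * b1 + \<beta>)" if w: "w \<in> O'" for w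
        proof -
          have "\<mu>1 w = a1 * \<nu> w + b1" "\<mu>2 w = a2 * \<nu> w + b2" "\<mu>2 w = \<alpha> * \<mu>1 w + \<beta>"
            using N(3,6,9) w unfolding O'_def by auto
          then show ?thesis by (simp add: algebra_simps)
        qed
        have "a2 = \<alpha> * a1" "b2 = \<alpha> * b1 + \<beta>"
          by (rule tchart_affine_unique[OF T(1) O' eq], assumption)+
        then have same: "a2 * \<nu> w + b2 = \<alpha> * (a1 * \<nu> w + b1) + \<beta>" for w by (simp add: algebra_simps)
        have "germ_eq X z (\<lambda>w. a2 * \<nu> w + b2) (\<lambda>w. \<alpha> * (a1 * \<nu> w + b1) + \<beta>)"
          unfolding germ_eq_def using same tchart_open[OF T(1)] z T(4) by (intro exI[of _ G]) auto
        then show ?thesis unfolding P_def using 1(2) 2(2) by blast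
      qed
      then show "\<exists>T. openin Y T \<and> q \<in> T \<and> (\<forall>y\<in>T \<inter> L. \<forall>z\<in>T \<inter> L. P y \<longrightarrow> P z)"
        using T(2,3) by blast
    qed
    then obtain K1 \<mu>1 K2 \<mu>2 where P: "tr x\<^sub>0 K1 \<mu>1" "tr x\<^sub>0 K2 \<mu>2" "germ_eq X x\<^sub>0 \<mu>2 (\<lambda>w. \<alpha> * \<mu>1 w + \<beta>)"
      unfolding P_def by blast
    have "germ_eq X x\<^sub>0 \<mu>1 \<mu>2"
      using germ_eq_trans[OF at_base[OF P(1)] germ_eq_sym[OF at_base[OF P(2)]]] .
    then have "germ_eq X x\<^sub>0 \<mu>1 (\<lambda>w. \<alpha> * \<mu>1 w + \<beta>)" using P(3) by (rule germ_eq_trans)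
    then obtain Q where Q: "openin X Q" "x\<^sub>0 \<in> Q" "\<forall>w\<in>Q. \<mu>1 w = \<alpha> * \<mu>1 w + \<beta>" unfolding germ_eq_def by blast
    have "openin X (Q \<inter> K1)" "x\<^sub>0 \<in> Q \<inter> K1" "Q \<inter> K1 \<subseteq> K1"
      using Q(1,2) trD(1,2)[OF P(1)] tchart_open[of K1 \<mu>1] by auto
    note O1 = this
    have eq1: "1 * \<mu>1 w + 0 = \<alpha> * \<mu>1 w + \<beta>" if "w \<in> Q \<inter> K1" for w
    proof -
      have "\<mu>1 w = \<alpha> * \<mu>1 w + \<beta>" using Q(3) that by blast
      then show ?thesis by linarith
    qed
    have "1 = \<alpha>" "0 = \<beta>" by (rule tchart_affine_unique[OF trD(1)[OF P(1)] O1 eq1], assumption)+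
    then show ?thesis unfolding germ_eq_def using N(1,2,5) by (intro exI[of _ N]) simp
  qed
  obtain H \<tau> where H: "\<And>x. x \<in> L \<Longrightarrow> tr x (H x) (\<tau> x)" using ex by metis
  have coh: "\<exists>T. openin X T \<and> x \<in> T \<and> (\<forall>y\<in>L \<inter> T. germ_eq X y (\<tau> x) (\<tau> y))" if x: "x \<in> L" for x
  proof -
    obtain \<nu> G T where T: "tchart M A F G \<nu>" "openin Y T" "x \<in> T" "T = {y\<in>G. \<nu> y = \<nu> x}"
      "\<forall>y\<in>T. \<forall>z\<in>T. \<forall>K \<mu>. tr y K \<mu> \<longrightarrow> (\<exists>\<alpha> \<beta>. 0 < \<alpha> \<and> germ_eq X y \<mu> (\<lambda>w. \<alpha> * \<nu> w + \<beta>) \<and>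
        tr z G (\<lambda>w. \<alpha> * \<nu> w + \<beta>))"
      using plaque[OF x] by (elim exE conjE)
    have xG: "x \<in> G" using T(3,4) by blast
    \<comment> \<open>The compact leaf does not accumulate on itself, so its points close to
      \<open>x\<close> in \<open>M\<close> lie on the plaque of \<open>x\<close>, where transports
      are compared through \<nu>.\<close>
    obtain N1 where N1: "openin X N1" "x \<in> N1" "N1 \<subseteq> G" "\<forall>y\<in>N1. y \<in> L \<longleftrightarrow> \<nu> y = \<nu> x"
      using compact_leaf_isolated[OF L T(1) x xG] by (elim exE conjE)
    obtain a b where ab: "germ_eq X x (\<tau> x) (\<lambda>w. a * \<nu> w + b)" "tr x G (\<lambda>w. a * \<nu> w + b)"
      using T(5)[rule_format, OF T(3,3) H[OF x]] by (elim exE conjE)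
    obtain N2 where N2: "openin X N2" "x \<in> N2" "\<forall>w\<in>N2. \<tau> x w = a * \<nu> w + b"
      using ab(1) unfolding germ_eq_def by blast
    have "germ_eq X y (\<tau> x) (\<tau> y)" if y: "y \<in> L" "y \<in> N1 \<inter> N2" for y
    proof -
      have yT: "y \<in> T" using N1(3,4) y unfolding T(4) by blast
      obtain a' b' where ab': "germ_eq X x (\<tau> x) (\<lambda>w. a' * \<nu> w + b')" "tr y G (\<lambda>w. a' * \<nu> w + b')"
        using T(5)[rule_format, OF T(3) yT H[OF x]] by (elim exE conjE)
      obtain N3 where N3: "openin X N3" "x \<in> N3" "\<forall>w\<in>N3. \<tau> x w = a' * \<nu> w + b'"
        using ab'(1) unfolding germ_eq_def by blast
      have O1: "openin X (N2 \<inter> N3 \<inter> G)" "x \<in> N2 \<inter> N3 \<inter> G" "N2 \<inter> N3 \<inter> G \<subseteq> G"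
        using N2(1,2) N3(1,2) xG tchart_open[OF T(1)] by (auto intro!: openin_Int)
      have eq1: "a * \<nu> w + b = a' * \<nu> w + b'" if "w \<in> N2 \<inter> N3 \<inter> G" for w using N2(3) N3(3) that by force
      have "a = a'" "b = b'" by (rule tchart_affine_unique[OF T(1) O1 eq1], assumption)+
      then have "tr y G (\<lambda>w. a * \<nu> w + b)" using ab'(2) by simp
      then have "germ_eq X y (\<lambda>w. a * \<nu> w + b) (\<tau> y)" using unique[OF y(1) _ H[OF y(1)]] by blast
      moreover have "germ_eq X y (\<tau> x) (\<lambda>w. a * \<nu> w + b)"
        unfolding germ_eq_def using N2(1,3) y(2) by (intro exI[of _ N2]) blast
      ultimately show ?thesis by (rule germ_eq_trans[rotated])
    qed
    then show ?thesis using N1(1,2) N2(1,2) by (intro exI[of _ "N1 \<inter> N2"]) auto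
  qed
  have "\<forall>x\<in>L. tchart M A F (H x) (\<tau> x) \<and> x \<in> H x \<and> \<tau> x x = v0" using trD[OF H] by simp
  then show ?thesis using coh by (intro exI[of _ H] exI[of _ \<tau>] exI[of _ v0]) blast
qed

text \<open>The glued chart is constant on the leaf, and isolation of the leaf allows the domain to
  be cut down until the leaf is a full level, shifted to the value 0.\<close>

lemma leaf_tube:
  assumes L: "compact_leaf M F L" and hol: "without_holonomy M F L"
  shows "\<exists>W u. tube W u \<and> 0 \<in> u ` W"
proof -
  note LD = compact_leafD[OF L]
  obtain x0 where x0: "x0 \<in> L" using LD(1) by blast
  obtain H \<tau> v0 where H: "\<forall>x\<in>L. tchart M A F (H x) (\<tau> x) \<and> x \<in> H x \<and> \<tau> x x = v0"
      "\<forall>x\<in>L. \<exists>T. openin X T \<and> x \<in> T \<and> (\<forall>y\<in>L \<inter> T. germ_eq X y (\<tau> x) (\<tau> y))"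
    using leaf_transport[OF L hol x0] by (elim exE conjE)
  have "\<exists>G v. tchart M A F G v \<and> L \<subseteq> G \<and> (\<forall>x\<in>L. germ_eq X x v (\<tau> x))"
    by (rule glue_germs[OF LD(6)]) (use H in blast)+
  then obtain G v where G: "tchart M A F G v" "L \<subseteq> G" "\<forall>x\<in>L. germ_eq X x v (\<tau> x)" by (elim exE conjE)
  have vL: "v x = v0" if "x \<in> L" for x using G(3) H(1) that germ_eqD[of X x v "\<tau> x"] by simp
  have "\<exists>T. openin X T \<and> x \<in> T \<and> T \<subseteq> G \<and> (\<forall>y\<in>T. y \<in> L \<longleftrightarrow> v y = v x)" if "x \<in> L" for x
    by (rule compact_leaf_isolated[OF L G(1) that]) (use G(2) that in blast)
  then obtain T where T: "\<And>x. x \<in> L \<Longrightarrow> openin X (T x) \<and> x \<in> T x \<and> T x \<subseteq> G \<and> (\<forall>y\<in>T x. y \<in> L \<longleftrightarrow> v y = v x)"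
    by metis
  define E where "E = (\<Union>x\<in>L. T x)"
  have "openin X E" unfolding E_def using T by (intro openin_Union) auto
  moreover have "E \<subseteq> G" unfolding E_def using T by blast
  ultimately have "tchart M A F E v" by (rule tch_subset[OF G(1)])
  from tchart_affine[OF this, of 1 "- v0"] have E: "tchart M A F E (\<lambda>y. 1 * v y + - v0)" by simp
  have lev: "L = {y\<in>E. 1 * v y + - v0 = 0}"
  proof
    show "L \<subseteq> {y\<in>E. 1 * v y + - v0 = 0}" using T vL unfolding E_def by auto
    show "{y\<in>E. 1 * v y + - v0 = 0} \<subseteq> L"
    proof
      fix y assume "y \<in> {y\<in>E. 1 * v y + - v0 = 0}"
      then obtain x where "x \<in> L" "y \<in> T x" "v y = v0" unfolding E_def by auto
      then show "y \<in> L" using T[of x] vL[of x] by simp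
    qed
  qed
  have op: "openin X (topspace X)" by simp
  have sub: "L \<subseteq> topspace X" using LD(2) by simp
  obtain W \<delta> where W: "0 < \<delta>" "tube W (\<lambda>y. 1 * v y + - v0)"
      "(\<lambda>y. 1 * v y + - v0) ` W = {0 - \<delta><..<0 + \<delta>}"
    using tube_around[OF E op lev LD(6,5,1) sub] by (elim exE conjE)
  have "0 \<in> (\<lambda>y. 1 * v y + - v0) ` W" unfolding W(3) using W(1) by simp
  then show ?thesis using W(2) by blast
qed

end

section \<open>Linear foliations\<close>

lemma local_diffeo_monotone:
  fixes h :: "real \<Rightarrow> real"
  assumes "local_diffeo_at h c"
  shows "\<exists>\<delta>>0. strict_mono_on {c - \<delta><..<c + \<delta>} h \<or> strict_antimono_on {c - \<delta><..<c + \<delta>} h"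
proof -
  obtain S k where S: "open S" "c \<in> S" "smooth_on S h" "\<forall>y\<in>S. k (h y) = y"
    using assms unfolding local_diffeo_at_def by (elim exE conjE)
  obtain \<delta> where \<delta>: "\<delta> > 0" "ball c \<delta> \<subseteq> S" using S(1,2) open_contains_ball by blast
  define I where "I = {c - \<delta><..<c + \<delta>}"
  have "I = ball c \<delta>" unfolding I_def by (auto simp: dist_real_def)
  then have IS: "I \<subseteq> S" using \<delta>(2) by simp
  have "Ck_on 0 h S" using S(3) unfolding smooth_on_def by blast
  then have "continuous_on I h" using continuous_on_subset[OF _ IS] by simp
  moreover have "is_interval I" unfolding I_def by (rule is_interval_oo)
  moreover have "inj_on h I" using S(4) IS by (metis inj_onI subsetD)
  ultimately have "strict_mono_on I h \<or> strict_antimono_on I h" using injective_eq_monotone_map by blast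
  then show ?thesis using \<delta>(1) unfolding I_def by blast
qed

lemma local_diffeo_increasing:
  fixes h :: "real \<Rightarrow> real"
  assumes h: "local_diffeo_at h c" and pos: "0 < deriv h c"
  shows "\<exists>\<delta>>0. strict_mono_on {c - \<delta><..<c + \<delta>} h"
proof -
  obtain \<delta> where \<delta>: "\<delta> > 0" "strict_mono_on {c - \<delta><..<c + \<delta>} h \<or> strict_antimono_on {c - \<delta><..<c + \<delta>} h"
    using local_diffeo_monotone[OF h] by blast
  have "\<not> strict_antimono_on {c - \<delta><..<c + \<delta>} h"
  proof
    assume anti: "strict_antimono_on {c - \<delta><..<c + \<delta>} h"
    obtain S where S: "open S" "c \<in> S" "smooth_on S h" using h unfolding local_diffeo_at_def by blast
    have "Ck_on (Suc 0) h S" using S(3) unfolding smooth_on_def by blast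
    then have "h differentiable_on S" by simp
    then have "h differentiable (at c within S)" using S(2) unfolding differentiable_on_def by blast
    then have "h differentiable (at c)" using at_within_open[OF S(2,1)] by simp
    then have "(h has_real_derivative deriv h c) (at c)" using DERIV_deriv_iff_real_differentiable by blast
    from DERIV_pos_inc_right[OF this pos] obtain d where d: "d > 0" "\<forall>s>0. s < d \<longrightarrow> h c < h (c + s)" by blast
    define s where "s = min d \<delta> / 2"
    have s: "0 < s" "s < d" "s < \<delta>" unfolding s_def using d(1) \<delta>(1) by auto
    have "c \<in> {c - \<delta><..<c + \<delta>}" "c + s \<in> {c - \<delta><..<c + \<delta>}" "c < c + s" using s \<delta>(1) by auto
    then have "h (c + s) < h c" using anti unfolding monotone_on_def by blast
    then show False using d(2) s(1,2) by force
  qed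
  then show ?thesis using \<delta> by blast
qed

lemma hyperplane_functional:
  fixes U :: "'e::euclidean_space set"
  assumes "subspace U" "dim U + 1 = DIM('e)"
  shows "\<exists>l :: 'e \<Rightarrow> real. linear l \<and> surj l \<and> {x. l x = 0} = U"
proof -
  obtain a :: 'e where a: "a \<noteq> 0" "span U \<subseteq> {x. a \<bullet> x = 0}"
    using lowdim_subset_hyperplane[of U] assms(2) by auto
  have "U \<subseteq> {x. a \<bullet> x = 0}" using a(2) span_superset[of U] by (rule subset_trans[rotated])
  moreover have "dim {x. a \<bullet> x = 0} \<le> dim U" using dim_hyperplane[OF a(1)] assms(2) by simp
  ultimately have "U = {x. a \<bullet> x = 0}"
    using subspace_dim_equal[OF assms(1) subspace_hyperplane] by blast
  moreover have "linear ((\<bullet>) a)" by (rule bounded_linear.linear[OF bounded_linear_inner_right])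
  moreover have "surj ((\<bullet>) a)"
  proof (rule surjI)
    show "a \<bullet> ((r / (a \<bullet> a)) *\<^sub>R a) = r" for r using a(1) by simp
  qed
  ultimately show ?thesis by blast
qed

lemma covering_sheet:
  assumes "covering_space N p M" "x \<in> M"
  shows "\<exists>y u T q. y \<in> u \<and> p y = x \<and> openin (top_of_set N) u \<and> openin (top_of_set M) T \<and> homeomorphism u T p q"
proof -
  have "p ` N = M" and "\<forall>x\<in>M. \<exists>T. x \<in> T \<and> openin (top_of_set M) T \<and> (\<exists>v. \<Union>v = N \<inter> p -` T \<and>
      (\<forall>u\<in>v. openin (top_of_set N) u) \<and> pairwise disjnt v \<and> (\<forall>u\<in>v. \<exists>q. homeomorphism u T p q))"
    using assms(1) unfolding covering_space_def by simp_all
  from bspec[OF this(2) assms(2)] obtain T v where T: "x \<in> T" "openin (top_of_set M) T" "\<Union>v = N \<inter> p -` T"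
      "\<forall>u\<in>v. openin (top_of_set N) u" "\<forall>u\<in>v. \<exists>q. homeomorphism u T p q"
    by (elim exE conjE)
  obtain y where y: "y \<in> N" "p y = x" using \<open>p ` N = M\<close> assms(2) by blast
  then have "y \<in> \<Union>v" using T(1,3) by simp
  then obtain u where u: "u \<in> v" "y \<in> u" by blast
  obtain q where "homeomorphism u T p q" using T(5) u(1) by blast
  then show ?thesis using u T(2,4) y(2) by (intro exI conjI) auto
qed

lemma (in foliated_affine_manifold) transition_order:
  assumes c: "(W, f) \<in> F" and tr: "transition_germ M (W, f) c' x h" and pos: "0 < deriv h (f x)"
  shows "\<exists>T. openin X T \<and> x \<in> T \<and> T \<subseteq> W \<inter> fst c' \<and> (\<forall>y\<in>T. \<forall>z\<in>T. snd c' y < snd c' z \<longleftrightarrow> f y < f z)"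
proof -
  obtain T where T: "openin X T" "x \<in> T" "T \<subseteq> W \<inter> fst c'" "\<forall>y\<in>T. snd c' y = h (f y)"
    using tr unfolding transition_germ_def by auto
  have "local_diffeo_at h (f x)" using tr unfolding transition_germ_def by simp
  then obtain \<delta> where \<delta>: "\<delta> > 0" "strict_mono_on {f x - \<delta><..<f x + \<delta>} h"
    using local_diffeo_increasing[OF _ pos] by blast
  define N where "N = T \<inter> {y\<in>W. f y \<in> {f x - \<delta><..<f x + \<delta>}}"
  have "openin X N" unfolding N_def by (rule openin_Int[OF T(1) F_preimage_open[OF c]]) simp
  moreover have "x \<in> N" unfolding N_def using T(2,3) \<delta>(1) by auto
  moreover have "snd c' y < snd c' z \<longleftrightarrow> f y < f z" if "y \<in> N" "z \<in> N" for y z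
  proof -
    have "snd c' y = h (f y)" "snd c' z = h (f z)" using T(4) that unfolding N_def by auto
    moreover have "f y \<in> {f x - \<delta><..<f x + \<delta>}" "f z \<in> {f x - \<delta><..<f x + \<delta>}" using that unfolding N_def by auto
    ultimately show ?thesis using strict_mono_on_less[OF \<delta>(2)] by simp
  qed
  moreover have "N \<subseteq> W \<inter> fst c'" unfolding N_def using T(3) by blast
  ultimately show ?thesis by (intro exI[of _ N] conjI) blast+
qed

text \<open>A sheet of the covering brings the composition of \<open>D\<close> with a functional
  \<open>l\<close> of kernel \<open>U\<close> down to a neighbourhood of \<open>x\<close>. It is
  affine in affine charts because \<open>D\<close> is; a sign makes it increase with the
  distinguished maps.\<close>

lemma (in foliated_affine_manifold) tchart_from_linear_foliation:
  assumes cov: "covering_space N p M" and dev: "developing_map N p M A D"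
    and U: "subspace U" "dim U + 1 = DIM('e)" and lin: "linear_foliation M A N p D U F"
    and ori: "transversely_oriented M F" and x: "x \<in> M"
  shows "\<exists>G \<tau>. tchart M A F G \<tau> \<and> x \<in> G"
proof -
  obtain l :: "'e \<Rightarrow> real" where l: "linear l" "surj l" "{x. l x = 0} = U"
    using hyperplane_functional[OF U] by blast
  obtain y u T q where y: "y \<in> u" "p y = x" and u: "openin (top_of_set N) u" and T: "openin X T"
    and hom: "homeomorphism u T p q"
    using covering_sheet[OF cov x] by (elim exE conjE)
  have uN: "u \<subseteq> N" using openin_subset[OF u] by simp
  have TM: "T \<subseteq> M" using openin_subset[OF T] by simp
  have p_open: "openin X (p ` S)" if S: "openin (top_of_set N) S" "S \<subseteq> u" for S
  proof -
    have "openin (top_of_set u) S" using openin_subset_trans[OF S uN] .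
    then have "openin (top_of_set T) (p ` S)" by (rule homeomorphism_imp_open_map[OF hom])
    then show ?thesis using T by (rule openin_trans)
  qed
  obtain V \<phi> where V: "(V, \<phi>) \<in> A" "x \<in> V" using affine_chart_at[OF x] by blast
  define W where "W = u \<inter> p -` V"
  have pu: "p ` u = T" using homeomorphism_image1[OF hom] .
  have pW: "p ` W = T \<inter> V" unfolding W_def using pu by blast
  have W: "openin (top_of_set N) W"
  proof -
    have "openin (top_of_set T) (T \<inter> V)"
      by (rule openin_subset_trans[OF openin_Int[OF T affine_chart(1)[OF V(1)]] Int_lower1 TM])
    then have "openin (top_of_set u) (u \<inter> p -` (T \<inter> V))"
      using homeomorphism_cont1[OF hom] pu by (intro continuous_openin_preimage[of u p T]) auto
    moreover have "u \<inter> p -` (T \<inter> V) = W" unfolding W_def using pu by blast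
    ultimately show ?thesis using u openin_trans by metis
  qed
  have "(W, \<phi> \<circ> p) \<in> pullback_atlas N p M A"
  proof -
    have "homeomorphism W (p ` W) p q"
      by (rule homeomorphism_of_subsets[OF hom]) (use pW in \<open>auto simp: W_def\<close>)
    moreover have "openin X (p ` W)" unfolding pW using T affine_chart(1)[OF V(1)] by blast
    ultimately show ?thesis unfolding pullback_atlas_def using V(1) W pW by blast
  qed
  note chart = this
  have yW: "y \<in> W" unfolding W_def using y V(2) by simp
  have "\<forall>(V, \<phi>)\<in>pullback_atlas N p M A. \<forall>(W, \<psi>)\<in>{(UNIV, id)}. \<forall>x\<in>V \<inter> D -` W.
        \<exists>T a. openin (top_of_set N) T \<and> x \<in> T \<and> T \<subseteq> V \<inter> D -` W \<and>
              affine_map a \<and> (\<forall>y\<in>T. \<psi> (D y) = a (\<phi> y))"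
    using dev unfolding developing_map_def affine_morphism_def by (elim conjE)
  from bspec[OF this chart, unfolded prod.case]
  have "\<exists>S a. openin (top_of_set N) S \<and> y \<in> S \<and> S \<subseteq> W \<and> affine_map a \<and> (\<forall>z\<in>S. D z = a (\<phi> (p z)))"
    using yW by simp
  then obtain S a where S: "openin (top_of_set N) S" "y \<in> S" "S \<subseteq> W" "affine_map a" "\<forall>z\<in>S. D z = a (\<phi> (p z))"
    by (elim exE conjE)
  obtain m d where m: "linear m" "a = (\<lambda>v. m v + d)" using S(4) unfolding affine_map_def by blast
  have lm: "linear (l \<circ> m)" using linear_compose[OF m(1) l(1)] .
  \<comment> \<open>\<open>D\<close> is a local homeomorphism and \<open>l\<close> an open map, so
    their composition is not locally constant; this excludes a vanishing linear part.\<close>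
  have ex_w: "\<exists>w. (l \<circ> m) w \<noteq> 0"
  proof (rule ccontr)
    assume "\<nexists>w. (l \<circ> m) w \<noteq> 0"
    then have lm0: "l (m v) = 0" for v by simp
    have yN: "y \<in> N" using y(1) uN by blast
    have "\<forall>x\<in>N. \<exists>W q. openin (top_of_set N) W \<and> x \<in> W \<and> open (D ` W) \<and> homeomorphism W (D ` W) D q"
      using dev unfolding developing_map_def by (elim conjE)
    from bspec[OF this yN] obtain W2 q2 where W2: "openin (top_of_set N) W2" "y \<in> W2" "open (D ` W2)"
        "homeomorphism W2 (D ` W2) D q2" by (elim exE conjE)
    have "W2 \<subseteq> N" using openin_subset[OF W2(1)] by simp
    then have "openin (top_of_set W2) (S \<inter> W2)"
      by (rule openin_subset_trans[OF openin_Int[OF S(1) W2(1)] Int_lower2])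
    then have "openin (top_of_set (D ` W2)) (D ` (S \<inter> W2))" by (rule homeomorphism_imp_open_map[OF W2(4)])
    then have "open (D ` (S \<inter> W2))" using W2(3) openin_open_trans by blast
    then have "open (l ` D ` (S \<inter> W2))" using open_surjective_linear_image[OF _ l(1,2)] by blast
    moreover have "l ` D ` (S \<inter> W2) = {l d}"
    proof -
      have "l (D z) = l d" if "z \<in> S \<inter> W2" for z
        using S(5) that m(2) lm0 by (simp add: linear_add[OF l(1)])
      then have "(\<lambda>z. l (D z)) ` (S \<inter> W2) = (\<lambda>_. l d) ` (S \<inter> W2)" by (rule image_cong[OF refl])
      moreover have "S \<inter> W2 \<noteq> {}" using S(2) W2(2) by blast
      ultimately show ?thesis by (simp only: image_image image_constant_conv) simp
    qed
    ultimately have "open {l d}" by simp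
    then show False using not_open_singleton by blast
  qed
  then obtain w where w: "(l \<circ> m) w \<noteq> 0" by blast
  obtain W1 f where W1: "(W1, f) \<in> F" "x \<in> W1" using F_cover[OF x] by blast
  have "foliation N (pullback_atlas N p M A) (pullback_foliation N p F \<union> pullback_foliation N D (parallel_foliation U))"
    using lin unfolding linear_foliation_def same_foliation_def by (elim conjE)
  then have tr: "\<forall>c\<in>pullback_foliation N p F \<union> pullback_foliation N D (parallel_foliation U).
      \<forall>c'\<in>pullback_foliation N p F \<union> pullback_foliation N D (parallel_foliation U).
      \<forall>x\<in>fst c \<inter> fst c'. \<exists>h. transition_germ N c c' x h"
    unfolding foliation_def by (elim conjE)
  have c1: "(N \<inter> p -` W1, f \<circ> p) \<in> pullback_foliation N p F" unfolding pullback_foliation_def using W1(1) by blast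
  have "(UNIV, l) \<in> parallel_foliation U" unfolding parallel_foliation_def using l by blast
  then have c2: "(N \<inter> D -` UNIV, l \<circ> D) \<in> pullback_foliation N D (parallel_foliation U)"
    unfolding pullback_foliation_def by blast
  have "y \<in> fst (N \<inter> p -` W1, f \<circ> p) \<inter> fst (N \<inter> D -` UNIV, l \<circ> D)" using y uN W1(2) by auto
  from bspec[OF bspec[OF bspec[OF tr UnI1[OF c1]] UnI2[OF c2]] this]
  obtain h where h: "transition_germ N (N \<inter> p -` W1, f \<circ> p) (N \<inter> D -` UNIV, l \<circ> D) y h" by blast
  obtain T3 where T3: "openin (top_of_set N) T3" "y \<in> T3" "\<forall>z\<in>T3. l (D z) = h (f (p z))"
    using h unfolding transition_germ_def by auto
  have "local_diffeo_at h (f x)" using h y(2) unfolding transition_germ_def by simp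
  then obtain \<delta> where \<delta>: "\<delta> > 0"
      "strict_mono_on {f x - \<delta><..<f x + \<delta>} h \<or> strict_antimono_on {f x - \<delta><..<f x + \<delta>} h"
    using local_diffeo_monotone by blast
  \<comment> \<open>The transition from the distinguished map to the composed functional may reverse
    order; the sign compensates for this.\<close>
  define s :: real where "s = (if strict_mono_on {f x - \<delta><..<f x + \<delta>} h then 1 else - 1)"
  have s0: "s \<noteq> 0" unfolding s_def by simp
  have smono: "s * h v < s * h v' \<longleftrightarrow> v < v'" if "v \<in> {f x - \<delta><..<f x + \<delta>}" "v' \<in> {f x - \<delta><..<f x + \<delta>}" for v v'
  proof (cases "strict_mono_on {f x - \<delta><..<f x + \<delta>} h")
    case True
    then show ?thesis using strict_mono_on_less[OF True that] unfolding s_def by simp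
  next
    case False
    then have anti: "strict_antimono_on {f x - \<delta><..<f x + \<delta>} h" using \<delta>(2) by blast
    have "v < v' \<Longrightarrow> h v' < h v" "v' < v \<Longrightarrow> h v < h v'" using anti that unfolding monotone_on_def by blast+
    then show ?thesis using False unfolding s_def by (cases v v' rule: linorder_cases) auto
  qed
  have Su: "S \<inter> T3 \<subseteq> u" using S(3) unfolding W_def by blast
  define G where "G = p ` (S \<inter> T3) \<inter> {z\<in>W1. f z \<in> {f x - \<delta><..<f x + \<delta>}}"
  define \<tau> where "\<tau> z = (s * (l \<circ> m) (\<phi> z)) + s * l d" for z
  have "openin X (p ` (S \<inter> T3))" by (rule p_open[OF openin_Int[OF S(1) T3(1)] Su])
  then have G: "openin X G" unfolding G_def by (rule openin_Int[OF _ F_preimage_open[OF W1(1)]]) simp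
  have xG: "x \<in> G" unfolding G_def using S(2) T3(2) y(2) W1(2) \<delta>(1) by auto
  have GV: "G \<subseteq> V" using S(3) pW unfolding G_def W_def by blast
  have \<tau>h: "\<tau> z = s * h (f z)" if z: "z \<in> G" for z
  proof -
    obtain z' where z': "z' \<in> S" "z' \<in> T3" "z = p z'" using z unfolding G_def by blast
    have "l (D z') = l (m (\<phi> z)) + l d" using S(5) z' m(2) by (simp add: linear_add[OF l(1)])
    moreover have "l (D z') = h (f z)" using T3(3) z' by simp
    ultimately show ?thesis unfolding \<tau>_def by (simp add: algebra_simps)
  qed
  have ord: "f z < f z' \<longleftrightarrow> \<tau> z < \<tau> z'" if z: "z \<in> G" "z' \<in> G" for z z'
  proof -
    have "f z \<in> {f x - \<delta><..<f x + \<delta>}" "f z' \<in> {f x - \<delta><..<f x + \<delta>}" using z unfolding G_def by blast+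
    then show ?thesis unfolding \<tau>h[OF z(1)] \<tau>h[OF z(2)] using smono by blast
  qed
  have "tchart M A F G \<tau>"
    unfolding tchart_def
  proof (intro conjI G ballI allI impI)
    fix z assume z: "z \<in> G"
    have "linear (\<lambda>v. s * (l \<circ> m) v)" using linear_compose_scale_right[OF lm, of s] by simp
    moreover have "s * (l \<circ> m) w \<noteq> 0" using s0 w by simp
    ultimately show "\<exists>V \<phi> T l w b. (V, \<phi>) \<in> A \<and> openin X T \<and> z \<in> T \<and> T \<subseteq> G \<inter> V \<and>
        linear l \<and> l w \<noteq> 0 \<and> (\<forall>y\<in>T. \<tau> y = l (\<phi> y) + b)"
      using V(1) G z GV
      by (intro exI[of _ V] exI[of _ \<phi>] exI[of _ G] exI[of _ "\<lambda>v. s * (l \<circ> m) v"] exI[of _ w]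
          exI[of _ "s * l d"]) (auto simp: \<tau>_def)
    fix W' f' assume W': "(W', f') \<in> F" "z \<in> W'"
    have zW1: "z \<in> fst (W1, f)" "z \<in> fst (W', f')" using z W'(2) unfolding G_def by auto
    obtain h' where h': "transition_germ M (W1, f) (W', f') z h'"
      using F_transition[OF W1(1) W'(1) zW1] by blast
    \<comment> \<open>The orientation makes transitions between distinguished maps increasing, so
      agreement of order with the single map \<open>f\<close> gives agreement with all of
      them.\<close>
    then have "0 < deriv h' (f z)"
      using ori W1(1) W'(1) unfolding transversely_oriented_def by fastforce
    then obtain N' where N': "openin X N'" "z \<in> N'" "N' \<subseteq> W1 \<inter> fst (W', f')"
        "\<forall>y\<in>N'. \<forall>z\<in>N'. snd (W', f') y < snd (W', f') z \<longleftrightarrow> f y < f z"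
      using transition_order[OF W1(1) h'] by (elim meta_impE exE conjE)
    have "f' v < f' v' \<longleftrightarrow> \<tau> v < \<tau> v'" if "v \<in> N' \<inter> G" "v' \<in> N' \<inter> G" for v v'
      using N'(4) ord that by simp
    then show "\<exists>T. openin X T \<and> z \<in> T \<and> T \<subseteq> G \<inter> W' \<and> (\<forall>y\<in>T. \<forall>z\<in>T. f' y < f' z \<longleftrightarrow> \<tau> y < \<tau> z)"
      using N'(1,2,3) G z by (intro exI[of _ "N' \<inter> G"]) auto
  qed
  then show ?thesis using xG by blast
qed

section \<open>The morphism to the circle and its fibres\<close>

context oriented_affine_foliation
begin

text \<open>Circle charts are locally affine in \<open>e\<close> of the angle, and \<open>e\<close>
  of the angle \<open>inv e (\<tau> z)\<close> of \<open>g z\<close> is the transverse chart, which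
  is affine in the charts of \<open>M\<close>.\<close>

lemma affine_morphism_to_circle:
  assumes dev: "circle_development e P Q k R b r" and g: "g ` M \<subseteq> sphere 0 1"
    and loc: "\<And>y. y \<in> M \<Longrightarrow> \<exists>T \<tau>. tchart M A F T \<tau> \<and> y \<in> T \<and> (\<forall>z\<in>T. \<tau> z \<in> range e \<and> g z = cis (inv e (\<tau> z)))"
  shows "affine_morphism M A (sphere 0 1) (circle_development.circle_atlas e) g"
proof -
  interpret E: circle_development e P Q k R b r by (rule dev)
  have cont: "continuous_on M g"
  proof (rule continuous_on_locally_openin)
    fix y assume "y \<in> M"
    then obtain T \<tau> where T: "tchart M A F T \<tau>" "y \<in> T" "\<forall>z\<in>T. \<tau> z \<in> range e \<and> g z = cis (inv e (\<tau> z))"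
      using loc by blast
    have TM: "T \<subseteq> M" using openin_subset[OF tchart_open[OF T(1)]] by simp
    have "continuous_map (subtopology X T) euclideanreal \<tau>" by (rule tchart_continuous[OF T(1)])
    moreover have "subtopology X T = top_of_set T" using TM by (simp add: subtopology_subtopology inf_absorb2)
    ultimately have "continuous_on T \<tau>" by simp
    moreover have "continuous_on (\<tau> ` T) (inv e)"
      by (rule continuous_on_subset[OF E.e_inv_continuous]) (use T(3) in blast)
    ultimately have "continuous_on T (inv e \<circ> \<tau>)" by (rule continuous_on_compose)
    then have "continuous_on T (\<lambda>z. cis ((inv e \<circ> \<tau>) z))" by (rule continuous_on_cis)
    then have "continuous_on T g" using T(3) by (simp cong: continuous_on_cong)
    then show "\<exists>T. openin X T \<and> y \<in> T \<and> continuous_on T g" using T(2) tchart_open[OF T(1)] by blast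
  qed
  have mor: "\<exists>N a. openin X N \<and> x \<in> N \<and> N \<subseteq> V \<inter> g -` W \<and> affine_map a \<and> (\<forall>y\<in>N. \<psi> (g y) = a (\<phi> y))"
    if V: "(V, \<phi>) \<in> A" and W: "(W, \<psi>) \<in> E.circle_atlas" and x: "x \<in> V \<inter> g -` W" for V \<phi> W \<psi> x
  proof -
    obtain c where c: "W = slit_circle c" "\<psi> = e \<circ> angle c" using W unfolding E.circle_atlas_def by blast
    have xM: "x \<in> M" using openin_subset[OF affine_chart(1)[OF V]] x by auto
    obtain T \<tau> where T: "tchart M A F T \<tau>" "x \<in> T" "\<forall>z\<in>T. \<tau> z \<in> range e \<and> g z = cis (inv e (\<tau> z))"
      using loc[OF xM] by (elim exE conjE)
    have "cis (inv e (\<tau> x)) \<in> slit_circle c" using T(2,3) x c(1) by auto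
    from E.circle_chart_locally[OF this] obtain \<delta> \<alpha> \<beta> where \<delta>: "\<delta> > 0"
        "\<forall>\<theta>. \<bar>\<theta> - inv e (\<tau> x)\<bar> < \<delta> \<longrightarrow> cis \<theta> \<in> slit_circle c \<and> (e \<circ> angle c) (cis \<theta>) = \<alpha> * e \<theta> + \<beta>"
      by (elim exE conjE)
    define I where "I = {inv e (\<tau> x) - \<delta><..<inv e (\<tau> x) + \<delta>}"
    obtain N l w b' where N: "openin X N" "x \<in> N" "N \<subseteq> T \<inter> V" "linear l" "\<forall>y\<in>N. \<tau> y = l (\<phi> y) + b'"
      using tchart_affine_in_chart[OF T(1,2) V] x by (elim meta_impE exE conjE) auto
    define N' where "N' = N \<inter> {y\<in>T. \<tau> y \<in> e ` I}"
    have "open (e ` I)" unfolding I_def by (rule E.e_range_open) simp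
    then have "openin X N'" unfolding N'_def using N(1) tch_preimage_open[OF T(1)] by blast
    moreover have "\<tau> x = e (inv e (\<tau> x))" using T(2,3) by (simp add: f_inv_into_f)
    then have "\<tau> x \<in> e ` I" unfolding I_def using \<delta>(1) by (intro image_eqI[of _ _ "inv e (\<tau> x)"]) auto
    then have "x \<in> N'" unfolding N'_def using N(2) T(2) by blast
    moreover have val: "g y \<in> W \<and> \<psi> (g y) = (\<alpha> * l (\<phi> y) + (\<alpha> * b' + \<beta>))" if y: "y \<in> N'" for y
    proof -
      obtain \<theta> where \<theta>: "\<theta> \<in> I" "\<tau> y = e \<theta>" using y unfolding N'_def by blast
      have "g y = cis \<theta>" using T(3) y \<theta>(2) unfolding N'_def by simp
      moreover have "\<bar>\<theta> - inv e (\<tau> x)\<bar> < \<delta>" using \<theta>(1) unfolding I_def by auto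
      ultimately have "g y \<in> slit_circle c" "(e \<circ> angle c) (g y) = \<alpha> * \<tau> y + \<beta>" using \<delta>(2) \<theta>(2) by auto
      moreover have "\<tau> y = l (\<phi> y) + b'" using N(5) y unfolding N'_def by blast
      ultimately show ?thesis using c by (simp add: algebra_simps)
    qed
    have "N' \<subseteq> V \<inter> g -` W" using N(3) val unfolding N'_def by blast
    moreover have "linear (\<lambda>v. \<alpha> * l v)" using linear_compose_scale_right[OF N(4), of \<alpha>] by simp
    then have "affine_map (\<lambda>v. \<alpha> * l v + (\<alpha> * b' + \<beta>))" unfolding affine_map_def by blast
    ultimately show ?thesis using val
      by (intro exI[of _ N'] exI[of _ "\<lambda>v. \<alpha> * l v + (\<alpha> * b' + \<beta>)"]) simp
  qed
  have "\<forall>c\<in>A. \<forall>d\<in>E.circle_atlas. \<forall>x\<in>fst c \<inter> g -` fst d. \<exists>N a. openin X N \<and> x \<in> N \<and>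
      N \<subseteq> fst c \<inter> g -` fst d \<and> affine_map a \<and> (\<forall>y\<in>N. snd d (g y) = a (snd c y))"
  proof (intro ballI)
    fix c d x assume "c \<in> A" "d \<in> E.circle_atlas" "x \<in> fst c \<inter> g -` fst d"
    then show "\<exists>N a. openin X N \<and> x \<in> N \<and>
        N \<subseteq> fst c \<inter> g -` fst d \<and> affine_map a \<and> (\<forall>y\<in>N. snd d (g y) = a (snd c y))"
      by (intro mor) simp_all
  qed
  then show ?thesis unfolding affine_morphism_def case_prod_beta using cont g by (intro conjI)
qed

text \<open>Each fibre is a closed connected level of a chart, hence a compact leaf; leaves are
  disjoint or equal, so the leaf through a point is the fibre through it.\<close>

lemma leaves_are_circle_fibres:
  assumes L: "compact_leaf M F L" and hol: "without_holonomy M F L"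
  shows "(\<forall>L\<in>leaves M F. compact_leaf M F L) \<and> (\<exists>B g. affine_structure_on_circle B \<and>
    affine_morphism M A (sphere 0 1) B g \<and> {M \<inter> g -` {z} |z. z \<in> sphere 0 1} = leaves M F)"
proof -
  obtain W u where W: "tube W u" "0 \<in> u ` W" using leaf_tube[OF L hol] by blast
  obtain e P Q k R b r g where dev: "circle_development e P Q k R b r" and gM: "g ` topspace X \<subseteq> sphere 0 1"
    and loc: "\<forall>y\<in>topspace X. \<exists>T \<tau>. tchart M A F T \<tau> \<and> y \<in> T \<and> (\<forall>z\<in>T. \<tau> z \<in> range e \<and> g z = cis (inv e (\<tau> z)))"
    and fib: "\<forall>z\<in>sphere 0 1. \<exists>T \<tau> c. tchart M A F T \<tau> \<and> {y\<in>topspace X. g y = z} = {y\<in>T. \<tau> y = c} \<and>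
       connectedin X {y\<in>T. \<tau> y = c} \<and> closedin X {y\<in>T. \<tau> y = c} \<and> {y\<in>T. \<tau> y = c} \<noteq> {}"
    using fibration_over_circle[OF W] by (elim exE conjE)
  interpret E: circle_development e P Q k R b r by (rule dev)
  have gM': "g ` M \<subseteq> sphere 0 1" using gM by simp
  have mor: "affine_morphism M A (sphere 0 1) E.circle_atlas g"
    by (rule affine_morphism_to_circle[OF dev gM']) (use loc in simp)
  have fibre: "compact_leaf M F (M \<inter> g -` {z})" if z: "z \<in> sphere 0 1" for z
  proof -
    obtain T \<tau> c where T: "tchart M A F T \<tau>" "{y\<in>topspace X. g y = z} = {y\<in>T. \<tau> y = c}"
        "connectedin X {y\<in>T. \<tau> y = c}" "closedin X {y\<in>T. \<tau> y = c}" "{y\<in>T. \<tau> y = c} \<noteq> {}"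
      using bspec[OF fib z] by (elim exE conjE)
    have "M \<inter> g -` {z} = {y\<in>T. \<tau> y = c}" using T(2) by auto
    then show ?thesis using compact_level_is_leaf[OF T(1) refl T(3-5)] by simp
  qed
  have leaf: "\<exists>z\<in>sphere 0 1. L = M \<inter> g -` {z}" if L: "L \<in> leaves M F" for L
  proof -
    have LY: "L \<in> connected_components_of Y" using L unfolding leaves_def .
    obtain x where x: "x \<in> L" using nonempty_connected_components_of[OF LY] by blast
    have xM: "x \<in> M" using connected_components_of_subset[OF LY] x topspace_leaf_topology by blast
    then have z: "g x \<in> sphere 0 1" using gM' by blast
    have "M \<inter> g -` {g x} \<in> connected_components_of Y"
      using fibre[OF z] unfolding compact_leaf_def leaves_def by blast
    moreover have "x \<in> L \<inter> (M \<inter> g -` {g x})" using x xM by simp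
    ultimately have "L = M \<inter> g -` {g x}" using connected_components_of_overlap[OF LY] by blast
    then show ?thesis using z by blast
  qed
  have "{M \<inter> g -` {z} |z. z \<in> sphere 0 1} = leaves M F"
  proof
    show "{M \<inter> g -` {z} |z. z \<in> sphere 0 1} \<subseteq> leaves M F" using fibre unfolding compact_leaf_def by blast
    show "leaves M F \<subseteq> {M \<inter> g -` {z} |z. z \<in> sphere 0 1}" using leaf by blast
  qed
  moreover have "compact_leaf M F L" if "L \<in> leaves M F" for L
    using leaf[OF that] fibre by (elim bexE) simp
  ultimately show ?thesis using E.affine_structure_circle_atlas mor
    by (intro conjI ballI exI[of _ E.circle_atlas] exI[of _ g])
qed

end

theorem proposition4p5:
  fixes M :: "'m::topological_space set"
    and A :: "('m, real ^ 'n::finite) chart set"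
    and N :: "'u::topological_space set"
    and p :: "'u \<Rightarrow> 'm"
    and D :: "'u \<Rightarrow> real ^ 'n"
    and h :: "('u \<Rightarrow> 'u) \<Rightarrow> real ^ 'n \<Rightarrow> real ^ 'n"
    and U :: "(real ^ 'n) set"
    and F :: "('m, real) chart set"
    and F\<^sub>0 :: "'m set"
  assumes "affine_manifold M A" and "compact M"
    and "universal_cover N p M"
    and "developing_map N p M A D"
    and "holonomy_representation N p D h"
    and "subspace U" and "dim U + 1 = CARD('n)"
    and "\<forall>\<gamma>\<in>deck_transformations N p. linear_part (h \<gamma>) ` U = U"
    and "linear_foliation M A N p D U F"
    and "transversely_oriented M F"
    and "compact_leaf M F F\<^sub>0" and "without_holonomy M F F\<^sub>0"
  shows "(\<forall>L\<in>leaves M F. compact_leaf M F L) \<and>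
         (\<exists>B g. affine_structure_on_circle B \<and>
                affine_morphism M A (sphere 0 1) B g \<and>
                {M \<inter> g -` {z} |z. z \<in> sphere 0 1} = leaves M F)"
proof -
  have "covering_space N p M" using assms(3) unfolding universal_cover_def by blast
  moreover have "dim U + 1 = DIM(real ^ 'n)" using assms(7) by simp
  moreover have fol: "foliated_affine_manifold M A F"
    using assms(1,2,9) unfolding linear_foliation_def by unfold_locales blast+
  ultimately have "oriented_affine_foliation M A F"
    using foliated_affine_manifold.tchart_from_linear_foliation[OF fol _ assms(4,6) _ assms(9,10)]
    by (intro oriented_affine_foliation.intro oriented_affine_foliation_axioms.intro) blast+
  then show ?thesis using oriented_affine_foliation.leaves_are_circle_fibres assms(11,12) by blast
qed

end
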